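(* Let $(M,\eta)$ be a contact manifold with Reeb vector field $\xi$, let $\Pi:M\to N$ be a fibration and let $H:M\to\mathbb{R}$ be a smooth function such that $\xi(H)=0$. If a pseudo-isotropic complete solution $\Sigma:N\times\Lambda\to M$ of the $\Pi$-HJE for the contact field $X_H$ is known, then the integral curves of $X_H$ can be constructed up to quadratures. In the particular case $H=1$ (so that $X_H=\xi$), the integral curves of the Reeb vector field $\xi$ can be constructed up to quadratures.
   Context: All manifolds are finite-dimensional and smooth, all maps smooth. A contact manifold $(M,\eta)$ is a $(2n+1)$-dimensional manifold $M$ with a 1-form $\eta$ such that $(d\eta)^n\wedge\eta$ is nowhere zero. Its Reeb vector field $\xi$ is the unique vector field with $i_\xi d\eta=0$ and $i_\xi\eta=1$. For $H\in C^\infty(M)$ the contact field $X_H$ is the unique vector field with $i_{X_H}d\eta=-dH+\xi(H)\,\eta$ and $i_{X_H}\eta=H$. A fibration $\Pi:M\to N$ is a surjective submersion. For a vector field $X$ on $M$, a section $\sigma:N\to M$ of $\Pi$ is a solution of the $\Pi$-Hamilton-Jacobi equation ($\Pi$-HJE) for $X$ if $\sigma_*\circ\Pi_*\circ X\circ\sigma=X\circ\sigma$. A complete solution of the $\Pi$-HJE for $X$ is a surjective local diffeomorphism $\Sigma:N\times\Lambda\to M$, where $\Lambda$ is a manifold with $\dim\Lambda+\dim N=\dim M$, such that for every $\lambda\in\Lambda$ the map $\sigma_\lambda:=\Sigma(\cdot,\lambda):N\to M$ is a section of $\Pi$ solving the $\Pi$-HJE for $X$. It is pseudo-isotropic if $\sigma_\lambda^*d\eta=0$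 for all $\lambda\in\Lambda$. "The integral curves of $X$ can be constructed up to quadratures" (or "$X$ is integrable by quadratures") has its usual meaning: starting from the known data ($M$, $\eta$, $H$, $\Pi$, and the known complete solution), the integral curves can be obtained (locally, around each point) by a finite number of operations consisting of algebraic operations, differentiation, solving of algebraic (i.e. finite, non-differential) equations via inversion of known local diffeomorphisms or immersions, and quadratures (computing integrals, i.e. primitives, of known functions or known closed 1-forms). *)

theory Defs
  imports "HOL-Analysis.Analysis" "HOL-Combinatorics.Permutations"
begin

text \<open>
  The space R^k is the library's topology \<open>Euclidean_space k\<close>, whose points are the sequences
  \<open>x :: nat \<Rightarrow> real\<close> with \<open>x i = 0\<close> for \<open>i \<ge> k\<close>.  The dimension is thus a natural number, which may
  be 0 and which can vary inside a formula or an inductive definition.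
\<close>

section \<open>Smooth functions on open subsets of R^k\<close>

definition partial :: "nat \<Rightarrow> ((nat \<Rightarrow> real) \<Rightarrow> real) \<Rightarrow> (nat \<Rightarrow> real) \<Rightarrow> real" where
  "partial i f x = deriv (\<lambda>s. f (x(i := s))) (x i)"

fun iter_partial :: "nat list \<Rightarrow> ((nat \<Rightarrow> real) \<Rightarrow> real) \<Rightarrow> (nat \<Rightarrow> real) \<Rightarrow> real" where
  "iter_partial [] f = f"
| "iter_partial (i # is) f = partial i (iter_partial is f)"

text \<open>All iterated partial derivatives exist and are continuous.  The library's \<open>deriv\<close> is an
  arbitrary value where there is no derivative, hence the explicit differentiability.\<close>

definition smooth_on :: "nat \<Rightarrow> (nat \<Rightarrow> real) set \<Rightarrow> ((nat \<Rightarrow> real) \<Rightarrow> real) \<Rightarrow> bool" where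
  "smooth_on k U f \<longleftrightarrow> openin (Euclidean_space k) U \<and>
     (\<forall>is. set is \<subseteq> {..<k} \<longrightarrow>
        continuous_map (subtopology (Euclidean_space k) U) euclideanreal (iter_partial is f) \<and>
        (\<forall>x\<in>U. \<forall>i<k. (\<lambda>s. iter_partial is f (x(i := s))) differentiable (at (x i))))"

section \<open>Manifolds and smooth maps\<close>

type_synonym 'a chart = "'a set \<times> ('a \<Rightarrow> nat \<Rightarrow> real)"

record 'a manifold =
  mtop :: "'a topology"
  mdim :: nat
  atlas :: "'a chart set"

definition param :: "'a chart \<Rightarrow> (nat \<Rightarrow> real) \<Rightarrow> 'a" where
  "param c = inv_into (fst c) (snd c)"

definition map_dom :: "'a chart \<Rightarrow> 'b chart \<Rightarrow> ('a \<Rightarrow> 'b) \<Rightarrow> (nat \<Rightarrow> real) set" where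
  "map_dom c d F = snd c ` {p \<in> fst c. F p \<in> fst d}"

definition map_rep :: "'a chart \<Rightarrow> 'b chart \<Rightarrow> ('a \<Rightarrow> 'b) \<Rightarrow> nat \<Rightarrow> (nat \<Rightarrow> real) \<Rightarrow> real" where
  "map_rep c d F i x = snd d (F (param c x)) i"

definition smooth_manifold :: "'a manifold \<Rightarrow> bool" where
  "smooth_manifold M \<longleftrightarrow>
     Hausdorff_space (mtop M) \<and> second_countable (mtop M) \<and>
     (\<Union>c\<in>atlas M. fst c) = topspace (mtop M) \<and>
     (\<forall>c\<in>atlas M. openin (mtop M) (fst c) \<and>
        openin (Euclidean_space (mdim M)) (snd c ` fst c) \<and>
        homeomorphic_map (subtopology (mtop M) (fst c))
          (subtopology (Euclidean_space (mdim M)) (snd c ` fst c)) (snd c)) \<and>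
     (\<forall>c\<in>atlas M. \<forall>d\<in>atlas M. \<forall>i<mdim M. smooth_on (mdim M) (map_dom c d id) (map_rep c d id i))"

definition smooth_function :: "'a manifold \<Rightarrow> ('a \<Rightarrow> real) \<Rightarrow> bool" where
  "smooth_function M H \<longleftrightarrow> (\<forall>c\<in>atlas M. smooth_on (mdim M) (snd c ` fst c) (\<lambda>x. H (param c x)))"

definition smooth_map :: "'a manifold \<Rightarrow> 'b manifold \<Rightarrow> ('a \<Rightarrow> 'b) \<Rightarrow> bool" where
  "smooth_map M N F \<longleftrightarrow> continuous_map (mtop M) (mtop N) F \<and>
     (\<forall>c\<in>atlas M. \<forall>d\<in>atlas N. \<forall>i<mdim N. smooth_on (mdim M) (map_dom c d F) (map_rep c d F i))"

definition open_submanifold :: "'a manifold \<Rightarrow> 'a set \<Rightarrow> 'a manifold" where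
  "open_submanifold M U =
     \<lparr>mtop = subtopology (mtop M) U, mdim = mdim M, atlas = (\<lambda>c. (fst c \<inter> U, snd c)) ` atlas M\<rparr>"

definition prod_chart :: "nat \<Rightarrow> 'a chart \<Rightarrow> 'b chart \<Rightarrow> ('a \<times> 'b) chart" where
  "prod_chart m c d =
     (fst c \<times> fst d, \<lambda>(p, q) i. if i < m then snd c p i else snd d q (i - m))"

definition prod_manifold :: "'a manifold \<Rightarrow> 'b manifold \<Rightarrow> ('a \<times> 'b) manifold" where
  "prod_manifold M N =
     \<lparr>mtop = prod_topology (mtop M) (mtop N), mdim = mdim M + mdim N,
      atlas = {prod_chart (mdim M) c d |c d. c \<in> atlas M \<and> d \<in> atlas N}\<rparr>"

definition diffeomorphism :: "'a manifold \<Rightarrow> 'b manifold \<Rightarrow> ('a \<Rightarrow> 'b) \<Rightarrow> bool" where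
  "diffeomorphism M N F \<longleftrightarrow> smooth_map M N F \<and>
     (\<exists>G. smooth_map N M G \<and> (\<forall>p\<in>topspace (mtop M). G (F p) = p) \<and>
          (\<forall>q\<in>topspace (mtop N). F (G q) = q))"

definition local_diffeomorphism :: "'a manifold \<Rightarrow> 'b manifold \<Rightarrow> ('a \<Rightarrow> 'b) \<Rightarrow> bool" where
  "local_diffeomorphism M N F \<longleftrightarrow> smooth_map M N F \<and>
     (\<forall>p\<in>topspace (mtop M). \<exists>U. openin (mtop M) U \<and> p \<in> U \<and> openin (mtop N) (F ` U) \<and>
        diffeomorphism (open_submanifold M U) (open_submanifold N (F ` U)) F)"

section \<open>Tangent maps, vector fields and 1-forms\<close>

text \<open>A tangent vector at \<open>p\<close> is given, in a chart around \<open>p\<close>, by its components \<open>v i\<close>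
  (\<open>i < mdim M\<close>).  The next function is the tangent map of \<open>F\<close> at \<open>p\<close> in the charts \<open>c\<close> and \<open>d\<close>.\<close>

definition tangent_map ::
    "'a manifold \<Rightarrow> 'a chart \<Rightarrow> 'b chart \<Rightarrow> ('a \<Rightarrow> 'b) \<Rightarrow> 'a \<Rightarrow> (nat \<Rightarrow> real) \<Rightarrow> nat \<Rightarrow> real" where
  "tangent_map M c d F p v i = (\<Sum>j<mdim M. partial j (map_rep c d F i) (snd c p) * v j)"

text \<open>Vector fields and 1-forms are given by their components in all charts of the atlas, subject
  to the usual transformation laws under changes of charts.\<close>

type_synonym 'a field = "'a chart \<Rightarrow> 'a \<Rightarrow> nat \<Rightarrow> real"

definition vector_field :: "'a manifold \<Rightarrow> 'a field \<Rightarrow> bool" where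
  "vector_field M X \<longleftrightarrow>
     (\<forall>c\<in>atlas M. \<forall>i<mdim M. smooth_on (mdim M) (snd c ` fst c) (\<lambda>x. X c (param c x) i)) \<and>
     (\<forall>c\<in>atlas M. \<forall>d\<in>atlas M. \<forall>p\<in>fst c \<inter> fst d. \<forall>i<mdim M.
        X d p i = tangent_map M c d id p (X c p) i)"

definition one_form :: "'a manifold \<Rightarrow> 'a field \<Rightarrow> bool" where
  "one_form M \<eta> \<longleftrightarrow>
     (\<forall>c\<in>atlas M. \<forall>i<mdim M. smooth_on (mdim M) (snd c ` fst c) (\<lambda>x. \<eta> c (param c x) i)) \<and>
     (\<forall>c\<in>atlas M. \<forall>d\<in>atlas M. \<forall>p\<in>fst c \<inter> fst d. \<forall>j<mdim M.
        \<eta> c p j = (\<Sum>i<mdim M. \<eta> d p i * partial j (map_rep c d id i) (snd c p)))"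

text \<open>Components of \<open>dH\<close> and of \<open>d\<eta> = (\<Sum>i<j. (\<partial>\<^sub>i \<eta>\<^sub>j - \<partial>\<^sub>j \<eta>\<^sub>i) dx\<^sub>i \<and> dx\<^sub>j)\<close>.\<close>

definition differential :: "('a \<Rightarrow> real) \<Rightarrow> 'a field" where
  "differential H c p j = partial j (\<lambda>x. H (param c x)) (snd c p)"

definition ext_deriv :: "'a field \<Rightarrow> 'a chart \<Rightarrow> 'a \<Rightarrow> nat \<Rightarrow> nat \<Rightarrow> real" where
  "ext_deriv \<eta> c p i j =
     partial i (\<lambda>x. \<eta> c (param c x) j) (snd c p) - partial j (\<lambda>x. \<eta> c (param c x) i) (snd c p)"

definition pairing :: "nat \<Rightarrow> (nat \<Rightarrow> real) \<Rightarrow> (nat \<Rightarrow> real) \<Rightarrow> real" where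
  "pairing m \<alpha> v = (\<Sum>i<m. \<alpha> i * v i)"

definition contraction :: "nat \<Rightarrow> (nat \<Rightarrow> real) \<Rightarrow> (nat \<Rightarrow> nat \<Rightarrow> real) \<Rightarrow> nat \<Rightarrow> real" where
  "contraction m v \<omega> j = (\<Sum>i<m. v i * \<omega> i j)"

section \<open>Contact manifolds\<close>

text \<open>A p-form at a point is given by its components, i.e. by its values on the p-tuples of
  coordinate vectors, the tuples being lists of indices.\<close>

definition wedge ::
    "nat \<Rightarrow> nat \<Rightarrow> (nat list \<Rightarrow> real) \<Rightarrow> (nat list \<Rightarrow> real) \<Rightarrow> nat list \<Rightarrow> real" where
  "wedge p q \<alpha> \<beta> is =
     (\<Sum>\<pi> | \<pi> permutes {..<p + q}. of_int (sign \<pi>) *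
        \<alpha> (take p (permute_list \<pi> is)) * \<beta> (drop p (permute_list \<pi> is))) / (fact p * fact q)"

fun wedge_power :: "nat \<Rightarrow> (nat list \<Rightarrow> real) \<Rightarrow> nat \<Rightarrow> nat list \<Rightarrow> real" where
  "wedge_power p \<alpha> 0 = (\<lambda>is. 1)"
| "wedge_power p \<alpha> (Suc n) = wedge p (n * p) \<alpha> (wedge_power p \<alpha> n)"

definition contact_volume :: "nat \<Rightarrow> 'a field \<Rightarrow> 'a chart \<Rightarrow> 'a \<Rightarrow> nat list \<Rightarrow> real" where
  "contact_volume n \<eta> c p =
     wedge (2 * n) 1 (wedge_power 2 (\<lambda>is. ext_deriv \<eta> c p (is ! 0) (is ! 1)) n)
       (\<lambda>is. \<eta> c p (is ! 0))"

definition contact_manifold :: "'a manifold \<Rightarrow> 'a field \<Rightarrow> bool" where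
  "contact_manifold M \<eta> \<longleftrightarrow> smooth_manifold M \<and> one_form M \<eta> \<and>
     (\<exists>n. mdim M = 2 * n + 1 \<and>
        (\<forall>c\<in>atlas M. \<forall>p\<in>fst c. \<exists>is. length is = 2 * n + 1 \<and> set is \<subseteq> {..<2 * n + 1} \<and>
           contact_volume n \<eta> c p is \<noteq> 0))"

text \<open>On a contact manifold exactly one vector field satisfies each of the following two
  predicates.\<close>

definition reeb_field :: "'a manifold \<Rightarrow> 'a field \<Rightarrow> 'a field \<Rightarrow> bool" where
  "reeb_field M \<eta> \<xi> \<longleftrightarrow> vector_field M \<xi> \<and>
     (\<forall>c\<in>atlas M. \<forall>p\<in>fst c.
        (\<forall>j<mdim M. contraction (mdim M) (\<xi> c p) (ext_deriv \<eta> c p) j = 0) \<and>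
        pairing (mdim M) (\<eta> c p) (\<xi> c p) = 1)"

definition contact_field ::
    "'a manifold \<Rightarrow> 'a field \<Rightarrow> 'a field \<Rightarrow> ('a \<Rightarrow> real) \<Rightarrow> 'a field \<Rightarrow> bool" where
  "contact_field M \<eta> \<xi> H X \<longleftrightarrow> vector_field M X \<and>
     (\<forall>c\<in>atlas M. \<forall>p\<in>fst c.
        (\<forall>j<mdim M. contraction (mdim M) (X c p) (ext_deriv \<eta> c p) j =
           - differential H c p j + pairing (mdim M) (differential H c p) (\<xi> c p) * \<eta> c p j) \<and>
        pairing (mdim M) (\<eta> c p) (X c p) = H p)"

section \<open>Hamilton-Jacobi equation and complete solutions\<close>

definition fibration :: "'a manifold \<Rightarrow> 'b manifold \<Rightarrow> ('a \<Rightarrow> 'b) \<Rightarrow> bool" where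
  "fibration M N P \<longleftrightarrow> smooth_map M N P \<and> P ` topspace (mtop M) = topspace (mtop N) \<and>
     (\<forall>c\<in>atlas M. \<forall>d\<in>atlas N. \<forall>p\<in>fst c. P p \<in> fst d \<longrightarrow>
        (\<forall>w. \<exists>v. \<forall>i<mdim N. tangent_map M c d P p v i = w i))"

definition smooth_section :: "'a manifold \<Rightarrow> 'b manifold \<Rightarrow> ('a \<Rightarrow> 'b) \<Rightarrow> ('b \<Rightarrow> 'a) \<Rightarrow> bool" where
  "smooth_section M N P \<sigma> \<longleftrightarrow> smooth_map N M \<sigma> \<and> (\<forall>q\<in>topspace (mtop N). P (\<sigma> q) = q)"

definition solves_HJE ::
    "'a manifold \<Rightarrow> 'b manifold \<Rightarrow> ('a \<Rightarrow> 'b) \<Rightarrow> 'a field \<Rightarrow> ('b \<Rightarrow> 'a) \<Rightarrow> bool" where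
  "solves_HJE M N P X \<sigma> \<longleftrightarrow> smooth_section M N P \<sigma> \<and>
     (\<forall>c\<in>atlas M. \<forall>d\<in>atlas N. \<forall>q\<in>fst d. \<sigma> q \<in> fst c \<longrightarrow>
        (\<forall>i<mdim M. tangent_map N d c \<sigma> q (tangent_map M c d P (\<sigma> q) (X c (\<sigma> q))) i
                    = X c (\<sigma> q) i))"

definition complete_solution ::
    "'a manifold \<Rightarrow> 'b manifold \<Rightarrow> ('a \<Rightarrow> 'b) \<Rightarrow> 'a field \<Rightarrow> 'l manifold \<Rightarrow> ('b \<times> 'l \<Rightarrow> 'a) \<Rightarrow> bool"
  where
  "complete_solution M N P X L \<Sigma> \<longleftrightarrow> smooth_manifold L \<and> mdim L + mdim N = mdim M \<and>
     local_diffeomorphism (prod_manifold N L) M \<Sigma> \<and>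
     \<Sigma> ` topspace (mtop (prod_manifold N L)) = topspace (mtop M) \<and>
     (\<forall>l\<in>topspace (mtop L). solves_HJE M N P X (\<lambda>q. \<Sigma> (q, l)))"

text \<open>The pull-back of \<open>d\<eta>\<close> along every \<open>\<Sigma>(\<cdot>, l)\<close> vanishes on all pairs of tangent vectors.\<close>

definition pseudo_isotropic ::
    "'a manifold \<Rightarrow> 'b manifold \<Rightarrow> 'a field \<Rightarrow> 'l manifold \<Rightarrow> ('b \<times> 'l \<Rightarrow> 'a) \<Rightarrow> bool" where
  "pseudo_isotropic M N \<eta> L \<Sigma> \<longleftrightarrow>
     (\<forall>l\<in>topspace (mtop L). \<forall>c\<in>atlas M. \<forall>d\<in>atlas N. \<forall>q\<in>fst d. \<Sigma> (q, l) \<in> fst c \<longrightarrow>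
        (\<forall>v w. (\<Sum>i<mdim M. \<Sum>j<mdim M. ext_deriv \<eta> c (\<Sigma> (q, l)) i j *
                  tangent_map N d c (\<lambda>q. \<Sigma> (q, l)) q v i *
                  tangent_map N d c (\<lambda>q. \<Sigma> (q, l)) q w j) = 0))"

section \<open>Construction up to quadratures\<close>

text \<open>
  \<open>known D k U f\<close>: the function \<open>f\<close> on the open set \<open>U\<close> of R^k is obtained from the functions in
  \<open>D\<close> by finitely many algebraic operations, substitutions, differentiations, inversions and
  quadratures.  Only the values of \<open>f\<close> on \<open>U\<close> matter.

  The rule \<open>solve\<close> solves \<open>g(u) = h(y)\<close> for \<open>u\<close>, where \<open>g\<close> is a known injective immersion of an open
  subset of R^k into R^l (for \<open>k = l\<close>, a diffeomorphism onto an open set) and \<open>h\<close> is known.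

  The rule \<open>integrate\<close> is the integral of \<open>f\<close> over the \<open>i\<close>-th variable from \<open>a\<close> to \<open>x i\<close>, the other
  variables being parameters.  The normalization at \<open>x i = a\<close> is essential: without it, an arbitrary
  function of the parameters could be added.  The rule \<open>primitive\<close> is a primitive on a connected
  set of a 1-form with known components; that form is closed because it has a primitive.

  Every rule preserves real-analyticity, and each result is determined by the premises up to a
  constant, so that the notion does not become trivial.
\<close>

definition clip :: "nat \<Rightarrow> (nat \<Rightarrow> real) \<Rightarrow> nat \<Rightarrow> real" where
  "clip k x = (\<lambda>i. if i < k then x i else 0)"

type_synonym local_function = "nat \<times> (nat \<Rightarrow> real) set \<times> ((nat \<Rightarrow> real) \<Rightarrow> real)"

inductive known ::
    "local_function set \<Rightarrow> nat \<Rightarrow> (nat \<Rightarrow> real) set \<Rightarrow> ((nat \<Rightarrow> real) \<Rightarrow> real) \<Rightarrow> bool"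
  for D :: "local_function set" where
  datum: "(k, U, f) \<in> D \<Longrightarrow> known D k U f"
| restriction: "known D k U f \<Longrightarrow> openin (Euclidean_space k) V \<Longrightarrow> V \<subseteq> U \<Longrightarrow> known D k V f"
| equal: "known D k U f \<Longrightarrow> (\<And>x. x \<in> U \<Longrightarrow> g x = f x) \<Longrightarrow> known D k U g"
| const: "openin (Euclidean_space k) U \<Longrightarrow> known D k U (\<lambda>x. a)"
| coord: "openin (Euclidean_space k) U \<Longrightarrow> i < k \<Longrightarrow> known D k U (\<lambda>x. x i)"
| sum: "known D k U f \<Longrightarrow> known D k U g \<Longrightarrow> known D k U (\<lambda>x. f x + g x)"
| product: "known D k U f \<Longrightarrow> known D k U g \<Longrightarrow> known D k U (\<lambda>x. f x * g x)"
| quotient: "known D k U f \<Longrightarrow> known D k U g \<Longrightarrow> (\<And>x. x \<in> U \<Longrightarrow> g x \<noteq> 0) \<Longrightarrow>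
    known D k U (\<lambda>x. f x / g x)"
| substitution: "known D k U f \<Longrightarrow> openin (Euclidean_space l) V \<Longrightarrow>
    (\<And>i. i < k \<Longrightarrow> known D l V (g i)) \<Longrightarrow>
    (\<And>y. y \<in> V \<Longrightarrow> clip k (\<lambda>i. g i y) \<in> U) \<Longrightarrow>
    known D l V (\<lambda>y. f (clip k (\<lambda>i. g i y)))"
| differentiation: "known D k U f \<Longrightarrow> i < k \<Longrightarrow> known D k U (partial i f)"
| solve: "openin (Euclidean_space k) U \<Longrightarrow>
    (\<And>j. j < l \<Longrightarrow> known D k U (g j)) \<Longrightarrow>
    inj_on (\<lambda>x. clip l (\<lambda>j. g j x)) U \<Longrightarrow>
    (\<And>x v. x \<in> U \<Longrightarrow> (\<And>j. j < l \<Longrightarrow> (\<Sum>i<k. partial i (g j) x * v i) = 0) \<Longrightarrow>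
       (\<forall>i<k. v i = 0)) \<Longrightarrow>
    openin (Euclidean_space m) V \<Longrightarrow>
    (\<And>j. j < l \<Longrightarrow> known D m V (h j)) \<Longrightarrow>
    continuous_map (subtopology (Euclidean_space m) V) (subtopology (Euclidean_space k) U) u \<Longrightarrow>
    (\<And>y j. y \<in> V \<Longrightarrow> j < l \<Longrightarrow> g j (u y) = h j y) \<Longrightarrow>
    i < k \<Longrightarrow> known D m V (\<lambda>y. u y i)"
| integrate: "known D k U f \<Longrightarrow> i < k \<Longrightarrow>
    (\<And>x s. x \<in> U \<Longrightarrow> s \<in> closed_segment a (x i) \<Longrightarrow> x(i := s) \<in> U) \<Longrightarrow>
    (\<And>x. x \<in> U \<Longrightarrow> F (x(i := a)) = 0) \<Longrightarrow>
    (\<And>x. x \<in> U \<Longrightarrow> ((\<lambda>s. F (x(i := s))) has_real_derivative f x) (at (x i))) \<Longrightarrow>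
    known D k U F"
| primitive: "openin (Euclidean_space k) U \<Longrightarrow> connectedin (Euclidean_space k) U \<Longrightarrow>
    (\<And>i. i < k \<Longrightarrow> known D k U (\<omega> i)) \<Longrightarrow>
    (\<And>x i. x \<in> U \<Longrightarrow> i < k \<Longrightarrow>
       ((\<lambda>s. F (x(i := s))) has_real_derivative \<omega> i x) (at (x i))) \<Longrightarrow>
    known D k U F"

definition function_data :: "'a manifold \<Rightarrow> ('a \<Rightarrow> real) \<Rightarrow> local_function set" where
  "function_data M H = {(mdim M, snd c ` fst c, \<lambda>x. H (param c x)) |c. c \<in> atlas M}"

definition form_data :: "'a manifold \<Rightarrow> 'a field \<Rightarrow> local_function set" where
  "form_data M \<eta> =
     {(mdim M, snd c ` fst c, \<lambda>x. \<eta> c (param c x) i) |c i. c \<in> atlas M \<and> i < mdim M}"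

definition map_data :: "'a manifold \<Rightarrow> 'b manifold \<Rightarrow> ('a \<Rightarrow> 'b) \<Rightarrow> local_function set" where
  "map_data M N F =
     {(mdim M, map_dom c d F, map_rep c d F i) |c d i. c \<in> atlas M \<and> d \<in> atlas N \<and> i < mdim N}"

text \<open>A manifold is known through its changes of charts, i.e. the local representatives of \<open>id\<close>.\<close>

definition HJ_data ::
    "'a manifold \<Rightarrow> 'a field \<Rightarrow> ('a \<Rightarrow> real) \<Rightarrow> 'b manifold \<Rightarrow> ('a \<Rightarrow> 'b) \<Rightarrow> 'l manifold \<Rightarrow>
     ('b \<times> 'l \<Rightarrow> 'a) \<Rightarrow> local_function set" where
  "HJ_data M \<eta> H N P L \<Sigma> =
     map_data M M id \<union> map_data N N id \<union> map_data L L id \<union>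
     form_data M \<eta> \<union> function_data M H \<union> map_data M N P \<union> map_data (prod_manifold N L) M \<Sigma>"

definition integral_curve :: "'a manifold \<Rightarrow> 'a field \<Rightarrow> real set \<Rightarrow> (real \<Rightarrow> 'a) \<Rightarrow> bool" where
  "integral_curve M X J \<gamma> \<longleftrightarrow> continuous_map (top_of_set J) (mtop M) \<gamma> \<and>
     (\<forall>t\<in>J. \<forall>c\<in>atlas M. \<gamma> t \<in> fst c \<longrightarrow>
        (\<forall>i<mdim M. ((\<lambda>s. snd c (\<gamma> s) i) has_real_derivative X c (\<gamma> t) i) (at t)))"

text \<open>Around each point, the local flow of \<open>X\<close>, as a function of the initial point and of the time
  (which is the last of the \<open>mdim M + 1\<close> variables), is known.  The curve is unique since \<open>X\<close> is
  smooth.\<close>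

definition integrable_by_quadratures :: "'a manifold \<Rightarrow> 'a field \<Rightarrow> local_function set \<Rightarrow> bool" where
  "integrable_by_quadratures M X D \<longleftrightarrow>
     (\<forall>c\<in>atlas M. \<forall>p\<in>fst c. \<exists>\<epsilon>>0. \<exists>V. openin (mtop M) V \<and> p \<in> V \<and> V \<subseteq> fst c \<and>
        (\<exists>F. (\<forall>i<mdim M. known D (mdim M + 1)
                 {z \<in> topspace (Euclidean_space (mdim M + 1)).
                    clip (mdim M) z \<in> snd c ` V \<and> \<bar>z (mdim M)\<bar> < \<epsilon>} (F i)) \<and>
             (\<forall>q\<in>V. \<exists>\<gamma>. integral_curve M X {-\<epsilon><..<\<epsilon>} \<gamma> \<and> \<gamma> 0 = q \<and>
                (\<forall>t\<in>{-\<epsilon><..<\<epsilon>}. \<gamma> t \<in> fst c \<and>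
                   (\<forall>i<mdim M. snd c (\<gamma> t) i = F i ((snd c q)(mdim M := t)))))))"

end

theory Submission
  imports Defs "HOL-Homology.Invariance_of_Domain"
begin

text \<open>
  Read \<open>X\<close> on \<open>N \<times> L\<close> through the local diffeomorphism \<open>\<Sigma>\<close>, and call it \<open>Y\<close>.  The Hamilton-Jacobi
  equation says that \<open>Y\<close> is tangent to the slices, on which the parameter \<open>l\<close> in \<open>L\<close> is fixed.
  Let \<open>\<theta>\<close> and \<open>h\<close> be the pull-backs of \<open>\<eta>\<close> and \<open>H\<close>.  As \<open>\<xi>(H) = 0\<close>, the definition of the contact field
  becomes: \<open>\<theta>(Y) = h\<close>, and the contraction of \<open>d\<theta>\<close> with \<open>Y\<close> is \<open>- dh\<close>.  Pseudo-isotropy says that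
  \<open>d\<theta>\<close> vanishes on pairs of vectors that are tangent to a slice.

  Three things follow.  First, \<open>dh\<close> vanishes along the slices, so that \<open>h\<close> depends on \<open>l\<close> alone.
  Second, on each slice the form \<open>\<theta>\<close> and the contractions of \<open>d\<theta>\<close> with the parameter directions \<open>a\<close>
  are closed.  They have potentials \<open>W\<close> and \<open>b\<^sub>a\<close> along the slices, which are found by quadratures with
  \<open>l\<close> as a parameter (\<open>potential_by_quadratures\<close>); and \<open>Y\<close> changes \<open>W\<close> at the rate \<open>h\<close> and \<open>b\<^sub>a\<close> at the
  rate \<open>- \<partial>\<^sub>a h\<close>, which are both constant on a slice.  Third, a vector tangent to a slice
  along which neither \<open>W\<close> nor any \<open>b\<^sub>a\<close> changes lies in the kernels of \<open>\<theta>\<close> and \<open>d\<theta>\<close>; such a vector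
  is zero since \<open>\<eta>\<close> is a contact form (\<open>contact_nondegenerate\<close>, \<open>slice_forms_separate\<close>).  Hence
  \<open>mdim N\<close> combinations of \<open>W\<close> and the \<open>b\<^sub>a\<close> form coordinates on each slice, in which \<open>Y\<close> is a constant
  vector and its integral curves are straight lines.  Inverting these coordinates
  (\<open>flow_by_rectification\<close>) and then applying \<open>\<Sigma>\<close> gives the flow of \<open>X\<close> (\<open>flow_known\<close>).  The flow is thus
  constructed from the quadratures, and the differential equation is verified afterwards.

  Dimensions are natural numbers that vary, so calculus is done one coordinate at a time.  Its basis
  is a mean value theorem that expresses an increment by partial derivatives at intermediate points
  (\<open>coordinatewise_mvt\<close>).  It yields the chain rule, the local injectivity of the rectifying
  coordinates and the derivative of the flow; that the rectifying coordinates have an open image and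
  a continuous inverse is the invariance of domain.
\<close>


section \<open>Cubes and continuity in Euclidean space\<close>

definition cube :: "nat \<Rightarrow> (nat \<Rightarrow> real) \<Rightarrow> real \<Rightarrow> (nat \<Rightarrow> real) set" where
  "cube k x \<delta> = {y. (\<forall>i\<ge>k. y i = 0) \<and> (\<forall>i<k. \<bar>y i - x i\<bar> < \<delta>)}"

lemma Euclidean_space_eq_top_of_set: "Euclidean_space k = top_of_set {x. \<forall>i\<ge>k. x i = 0}"
  by (simp add: Euclidean_space_def euclidean_product_topology)

lemma openin_cube: "openin (Euclidean_space k) (cube k x \<delta>)"
proof -
  have "open (\<Inter>i<k. {y :: nat \<Rightarrow> real. \<bar>y i - x i\<bar> < \<delta>})"
    by (intro open_INT finite_lessThan ballI open_Collect_less continuous_intros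
        continuous_on_product_coordinates)
  moreover have "cube k x \<delta> = {x. \<forall>i\<ge>k. x i = 0} \<inter> (\<Inter>i<k. {y. \<bar>y i - x i\<bar> < \<delta>})"
    by (auto simp: cube_def)
  ultimately show ?thesis
    unfolding Euclidean_space_eq_top_of_set openin_open by blast
qed

lemma cube_subset_topspace: "cube k x \<delta> \<subseteq> topspace (Euclidean_space k)"
  by (auto simp: cube_def topspace_Euclidean_space)

lemma centre_in_cube: "x \<in> topspace (Euclidean_space k) \<Longrightarrow> \<delta> > 0 \<Longrightarrow> x \<in> cube k x \<delta>"
  by (auto simp: cube_def topspace_Euclidean_space)

lemma cube_mono: "\<delta> \<le> \<epsilon> \<Longrightarrow> cube k x \<delta> \<subseteq> cube k x \<epsilon>"
  by (fastforce simp: cube_def)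

lemma openin_Euclidean_space_iff:
  "openin (Euclidean_space k) U \<longleftrightarrow>
     U \<subseteq> topspace (Euclidean_space k) \<and> (\<forall>x\<in>U. \<exists>\<delta>>0. cube k x \<delta> \<subseteq> U)"
proof
  assume U: "openin (Euclidean_space k) U"
  have "\<exists>\<delta>>0. cube k x \<delta> \<subseteq> U" if x: "x \<in> U" for x
  proof -
    obtain T where T: "open T" "U = {x. \<forall>i\<ge>k. x i = 0} \<inter> T"
      using U unfolding Euclidean_space_eq_top_of_set openin_open by auto
    have that': "x \<in> T" using T x by blast
    obtain X where X: "x \<in> Pi\<^sub>E UNIV X" "\<And>i. open (X i)" "Pi\<^sub>E UNIV X \<subseteq> T"
      using product_topology_open_contains_basis[where T = "\<lambda>_. euclideanreal" and I = UNIV and U = T, OF _ that']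
        T(1) by (auto simp: euclidean_product_topology)
    have "\<exists>d>0. \<forall>y. \<bar>y - x i\<bar> < d \<longrightarrow> y \<in> X i" for i
      using X(1) X(2)[of i] by (auto simp: open_dist dist_real_def PiE_iff)
    then obtain d where d: "\<And>i. d i > (0::real)" "\<And>i y. \<bar>y - x i\<bar> < d i \<Longrightarrow> y \<in> X i"
      by metis
    define \<delta> where "\<delta> = Min (insert 1 (d ` {..<k}))"
    have \<delta>: "\<delta> > 0" "\<And>i. i < k \<Longrightarrow> \<delta> \<le> d i"
      using d(1) by (auto simp: \<delta>_def)
    have "cube k x \<delta> \<subseteq> U"
    proof
      fix y assume y: "y \<in> cube k x \<delta>"
      have xE: "\<forall>i\<ge>k. x i = 0" using x T by auto
      have "y i \<in> X i" for i
      proof (cases "i < k")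
        case True
        then show ?thesis using y \<delta>(2)[OF True] by (intro d(2)) (auto simp: cube_def)
      next
        case False
        then have "y i = x i" using y xE by (auto simp: cube_def)
        then show ?thesis using X(1) by auto
      qed
      then have "y \<in> T" using X(3) by auto
      then show "y \<in> U" using y T by (auto simp: cube_def)
    qed
    then show ?thesis using \<delta> by blast
  qed
  then show "U \<subseteq> topspace (Euclidean_space k) \<and> (\<forall>x\<in>U. \<exists>\<delta>>0. cube k x \<delta> \<subseteq> U)"
    using openin_subset[OF U] by blast
next
  assume *: "U \<subseteq> topspace (Euclidean_space k) \<and> (\<forall>x\<in>U. \<exists>\<delta>>0. cube k x \<delta> \<subseteq> U)"
  show "openin (Euclidean_space k) U"
    by (subst openin_subopen) (metis * openin_cube centre_in_cube subsetD)
qed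

lemma openin_cubeE:
  assumes "openin (Euclidean_space k) U" "x \<in> U"
  obtains \<delta> where "\<delta> > 0" "cube k x \<delta> \<subseteq> U"
  using assms openin_Euclidean_space_iff by blast

lemma continuous_map_Euclidean_iff_continuous_on:
  assumes "U \<subseteq> topspace (Euclidean_space k)"
  shows "continuous_map (subtopology (Euclidean_space k) U) euclideanreal f \<longleftrightarrow> continuous_on U f"
proof -
  have "{x. \<forall>i\<ge>k. x i = 0} \<inter> U = U"
    using assms by (auto simp: topspace_Euclidean_space)
  then show ?thesis
    by (simp add: Euclidean_space_eq_top_of_set subtopology_subtopology)
qed

lemma continuous_map_into_Euclidean_space:
  assumes "U \<subseteq> topspace (Euclidean_space k)"
  shows "continuous_map (subtopology (Euclidean_space k) U) (Euclidean_space l) f \<longleftrightarrow>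
     (\<forall>i. continuous_on U (\<lambda>x. f x i)) \<and> f ` U \<subseteq> topspace (Euclidean_space l)"
proof -
  have "{x. \<forall>i\<ge>k. x i = 0} \<inter> U = U"
    using assms by (auto simp: topspace_Euclidean_space)
  then have "continuous_map (subtopology (Euclidean_space k) U) (Euclidean_space l) f
     \<longleftrightarrow> continuous_on U f \<and> f ` U \<subseteq> topspace (Euclidean_space l)"
    by (auto simp: Euclidean_space_eq_top_of_set subtopology_subtopology
        continuous_map_in_subtopology image_subset_iff)
  also have "continuous_on U f \<longleftrightarrow> (\<forall>i. continuous_on U (\<lambda>x. f x i))"
  proof (intro iffI allI)
    show "continuous_on U f" if "\<forall>i. continuous_on U (\<lambda>x. f x i)"
      using that by (intro continuous_on_coordinatewise_then_product) simp
    show "continuous_on U (\<lambda>x. f x i)" if "continuous_on U f" for i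
      using that by (rule continuous_on_product_then_coordinatewise)
  qed
  finally show ?thesis .
qed

lemma continuous_on_cubeE:
  fixes f :: "(nat \<Rightarrow> real) \<Rightarrow> real"
  assumes "openin (Euclidean_space k) U" "continuous_on U f" "x \<in> U" "e > 0"
  obtains \<delta> where "\<delta> > 0" "cube k x \<delta> \<subseteq> U" "\<And>y. y \<in> cube k x \<delta> \<Longrightarrow> \<bar>f y - f x\<bar> < e"
proof -
  have U: "U \<subseteq> topspace (Euclidean_space k)" using assms(1) openin_subset by blast
  have "continuous_map (subtopology (Euclidean_space k) U) euclideanreal f"
    using assms U by (simp add: continuous_map_Euclidean_iff_continuous_on)
  moreover have "openin euclideanreal (ball (f x) e)" by simp
  ultimately have
    "openin (subtopology (Euclidean_space k) U) {y \<in> topspace (subtopology (Euclidean_space k) U). f y \<in> ball (f x) e}"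
    by (rule openin_continuous_map_preimage)
  moreover have "topspace (subtopology (Euclidean_space k) U) = U" using U by auto
  ultimately have "openin (Euclidean_space k) {y \<in> U. f y \<in> ball (f x) e}"
    by (intro openin_trans_full[OF _ assms(1)]) (simp only:)
  then obtain \<delta> where "\<delta> > 0" "cube k x \<delta> \<subseteq> {y \<in> U. f y \<in> ball (f x) e}"
    using assms by (auto elim!: openin_cubeE[of k _ x])
  then show ?thesis
    by (intro that[of \<delta>]) (auto simp: dist_real_def abs_minus_commute)
qed

lemma eventually_fun_upd_in:
  assumes "openin (Euclidean_space k) U" "x \<in> U" "i < k"
  shows "\<forall>\<^sub>F s in nhds (x i). x(i := s) \<in> U"
proof -
  obtain \<delta> where \<delta>: "\<delta> > 0" "cube k x \<delta> \<subseteq> U" using assms by (auto elim: openin_cubeE)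
  have "x(i := s) \<in> U" if "dist s (x i) < \<delta>" for s
    using that \<delta> assms openin_subset[OF assms(1)]
    by (intro subsetD[OF \<delta>(2)])
      (auto simp: cube_def dist_real_def topspace_Euclidean_space subset_iff)
  then show ?thesis using \<delta>(1) unfolding eventually_nhds_metric by blast
qed

section \<open>Calculus of smooth functions\<close>

lemma DERIV_fun_upd_cong:
  assumes "openin (Euclidean_space k) U" "x \<in> U" "i < k" "\<And>y. y \<in> U \<Longrightarrow> f y = g y"
  shows "((\<lambda>s. f (x(i := s))) has_real_derivative d) (at (x i)) \<longleftrightarrow>
         ((\<lambda>s. g (x(i := s))) has_real_derivative d) (at (x i))"
  by (rule DERIV_cong_ev)
     (use eventually_mono[OF eventually_fun_upd_in[OF assms(1-3)]] assms(4) in auto)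

lemma partial_cong:
  assumes "openin (Euclidean_space k) U" "x \<in> U" "i < k" "\<And>y. y \<in> U \<Longrightarrow> f y = g y"
  shows "partial i f x = partial i g x"
  unfolding partial_def deriv_def using DERIV_fun_upd_cong[OF assms(1-3), of f g] assms(4) by presburger

lemma partial_eq:
  "((\<lambda>s. f (x(i := s))) has_real_derivative d) (at (x i)) \<Longrightarrow> partial i f x = d"
  unfolding partial_def by (rule DERIV_imp_deriv)

lemma iter_partial_append: "iter_partial (is @ js) f = iter_partial is (iter_partial js f)"
  by (induction "is") auto

lemma smooth_on_openin: "smooth_on k U f \<Longrightarrow> openin (Euclidean_space k) U"
  by (simp add: smooth_on_def)

lemma smooth_on_continuous_on: "smooth_on k U f \<Longrightarrow> continuous_on U f"
  unfolding smooth_on_def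
  by (auto simp: continuous_map_Euclidean_iff_continuous_on openin_subset dest!: spec[of _ "[]"])

lemma smooth_on_has_partial:
  assumes "smooth_on k U f" "x \<in> U" "i < k"
  shows "((\<lambda>s. f (x(i := s))) has_real_derivative partial i f x) (at (x i))"
proof -
  have "(\<lambda>s. iter_partial [] f (x(i := s))) differentiable (at (x i))"
    using assms unfolding smooth_on_def by (auto dest!: spec[of _ "[]"])
  then show ?thesis
    unfolding partial_def by (simp add: DERIV_deriv_iff_real_differentiable)
qed

lemma smooth_on_partial: "smooth_on k U f \<Longrightarrow> i < k \<Longrightarrow> smooth_on k U (partial i f)"
proof -
  assume f: "smooth_on k U f" and i: "i < k"
  have eq: "iter_partial is (partial i f) = iter_partial (is @ [i]) f" for "is"
    by (simp add: iter_partial_append)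
  have sub: "set (is @ [i]) \<subseteq> {..<k}" if "set is \<subseteq> {..<k}" for "is"
    using that i by auto
  have f': "continuous_map (subtopology (Euclidean_space k) U) euclideanreal (iter_partial is f) \<and>
      (\<forall>x\<in>U. \<forall>i<k. (\<lambda>s. iter_partial is f (x(i := s))) differentiable (at (x i)))"
    if "set is \<subseteq> {..<k}" for "is"
    using f that unfolding smooth_on_def by simp
  show ?thesis
    unfolding smooth_on_def eq using smooth_on_openin[OF f] f'[OF sub] by simp
qed

lemma smooth_on_subset:
  assumes "smooth_on k U f" "openin (Euclidean_space k) V" "V \<subseteq> U"
  shows "smooth_on k V f"
  using assms openin_subset[of "Euclidean_space k"]
  by (auto simp: smooth_on_def intro: continuous_map_from_subtopology_mono)

text \<open>Smoothness by coinduction: it is enough to put \<open>f\<close> into a class of continuous functions that is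
  closed under taking partial derivatives.\<close>

lemma smooth_on_coinduct:
  assumes U: "openin (Euclidean_space k) U" and f: "f \<in> C"
    and cont: "\<And>g. g \<in> C \<Longrightarrow> continuous_on U g"
    and step: "\<And>g i. g \<in> C \<Longrightarrow> i < k \<Longrightarrow>
      \<exists>g'\<in>C. \<forall>x\<in>U. ((\<lambda>s. g (x(i := s))) has_real_derivative g' x) (at (x i))"
  shows "smooth_on k U f"
proof -
  have *: "\<exists>g\<in>C. \<forall>x\<in>U. iter_partial is f x = g x" if "set is \<subseteq> {..<k}" for "is"
    using that
  proof (induction "is")
    case Nil
    then show ?case using f by auto
  next
    case (Cons i "is")
    then obtain g where g: "g \<in> C" "\<And>x. x \<in> U \<Longrightarrow> iter_partial is f x = g x" by auto
    have i: "i < k" using Cons.prems by auto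
    obtain g' where g': "g' \<in> C"
      "\<And>x. x \<in> U \<Longrightarrow> ((\<lambda>s. g (x(i := s))) has_real_derivative g' x) (at (x i))"
      using step[OF g(1) i] by blast
    have "iter_partial (i # is) f x = g' x" if "x \<in> U" for x
      using partial_cong[OF U that i g(2)] partial_eq[OF g'(2)[OF that]] by simp
    then show ?case using g'(1) by blast
  qed
  show ?thesis
    unfolding smooth_on_def
  proof (intro conjI allI impI ballI U)
    fix "is" assume "is": "set is \<subseteq> {..<k}"
    obtain g where g: "g \<in> C" "\<And>x. x \<in> U \<Longrightarrow> iter_partial is f x = g x"
      using *[OF "is"] by blast
    have "continuous_on U (iter_partial is f)"
      using cont[OF g(1)] g(2) by (simp cong: continuous_on_cong)
    then show "continuous_map (subtopology (Euclidean_space k) U) euclideanreal (iter_partial is f)"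
      using openin_subset[OF U] by (simp add: continuous_map_Euclidean_iff_continuous_on)
    fix x i assume x: "x \<in> U" and i: "i < k"
    obtain g' where "((\<lambda>s. g (x(i := s))) has_real_derivative g' x) (at (x i))"
      using step[OF g(1) i] x by blast
    then have "((\<lambda>s. iter_partial is f (x(i := s))) has_real_derivative g' x) (at (x i))"
      using DERIV_fun_upd_cong[OF U x i, of "iter_partial is f" g] g(2) by blast
    then show "(\<lambda>s. iter_partial is f (x(i := s))) differentiable (at (x i))"
      using real_differentiable_def by blast
  qed
qed

text \<open>A multivariate mean value theorem: moving one coordinate at a time turns an increment of
  \<open>f\<close> into a combination of partial derivatives at points between the ends.  It takes the
  place of total derivatives on a space whose dimension is a variable.\<close>

lemma coordinatewise_mvt:
  fixes f :: "(nat \<Rightarrow> real) \<Rightarrow> real"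
  assumes "\<And>j. j \<ge> s \<Longrightarrow> x j = y j"
    and "\<And>z k. (\<And>j. z j \<in> closed_segment (x j) (y j)) \<Longrightarrow> k < s \<Longrightarrow>
      ((\<lambda>t. f (z(k := t))) has_real_derivative D k z) (at (z k))"
  shows "\<exists>\<zeta>. (\<forall>k<s. \<forall>j. \<zeta> k j \<in> closed_segment (x j) (y j)) \<and>
     f y - f x = (\<Sum>k<s. D k (\<zeta> k) * (y k - x k))"
  using assms
proof (induction s arbitrary: y)
  case 0
  have "x = y" by (rule ext, rule 0(1), simp)
  show ?case unfolding \<open>x = y\<close> by simp
next
  case (Suc s)
  define y' where "y' = y(s := x s)"
  have seg: "z j \<in> closed_segment (x j) (y j)" if "z j \<in> closed_segment (x j) (y' j)" for z j
    using that by (auto simp: y'_def split: if_splits)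
  have "\<exists>\<zeta>. (\<forall>k<s. \<forall>j. \<zeta> k j \<in> closed_segment (x j) (y' j)) \<and>
     f y' - f x = (\<Sum>k<s. D k (\<zeta> k) * (y' k - x k))"
  proof (rule Suc.IH)
    show "x j = y' j" if "j \<ge> s" for j
      using that Suc.prems(1)[of j] by (cases "j = s") (auto simp: y'_def)
    show "((\<lambda>t. f (z(k := t))) has_real_derivative D k z) (at (z k))"
      if "\<And>j. z j \<in> closed_segment (x j) (y' j)" "k < s" for z k
      using that seg by (intro Suc.prems(2)) auto
  qed
  then obtain \<zeta> where \<zeta>: "\<And>k j. k < s \<Longrightarrow> \<zeta> k j \<in> closed_segment (x j) (y' j)"
    "f y' - f x = (\<Sum>k<s. D k (\<zeta> k) * (y' k - x k))" by blast
  have der: "((\<lambda>t. f (y(s := t))) has_real_derivative D s (y(s := t))) (at t)"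
    if "t \<in> closed_segment (x s) (y s)" for t
    using Suc.prems(2)[of "y(s := t)" s] that by (simp del: fun_upd_apply) simp
  have "\<exists>t \<in> closed_segment (x s) (y s). f y - f y' = D s (y(s := t)) * (y s - x s)"
  proof (cases "x s" "y s" rule: linorder_cases)
    case less
    obtain t where "x s < t" "t < y s"
      "f (y(s := y s)) - f (y(s := x s)) = (y s - x s) * D s (y(s := t))"
      using MVT2[OF less, of "\<lambda>t. f (y(s := t))" "\<lambda>t. D s (y(s := t))"] der less
      by (auto simp: closed_segment_eq_real_ivl)
    then show ?thesis using less
      by (intro bexI[of _ t]) (auto simp: closed_segment_eq_real_ivl y'_def mult.commute)
  next
    case greater
    obtain t where "y s < t" "t < x s"
      "f (y(s := x s)) - f (y(s := y s)) = (x s - y s) * D s (y(s := t))"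
      using MVT2[OF greater, of "\<lambda>t. f (y(s := t))" "\<lambda>t. D s (y(s := t))"] der greater
      by (auto simp: closed_segment_eq_real_ivl)
    then show ?thesis using greater
      by (intro bexI[of _ t]) (auto simp: closed_segment_eq_real_ivl y'_def algebra_simps)
  next
    case equal
    then have "y' = y" by (auto simp: y'_def)
    then show ?thesis using equal by auto
  qed
  then obtain t where t: "t \<in> closed_segment (x s) (y s)"
    "f y - f y' = D s (y(s := t)) * (y s - x s)" by blast
  show ?case
  proof (intro exI[of _ "\<zeta>(s := y(s := t))"] conjI allI impI)
    fix k j assume "k < Suc s"
    then show "(\<zeta>(s := y(s := t))) k j \<in> closed_segment (x j) (y j)"
      using \<zeta>(1)[of k j] seg[of "\<zeta> k" j] t by (cases "k = s") auto
  next
    have "f y - f x = (f y' - f x) + (f y - f y')" by simp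
    also have "\<dots> = (\<Sum>k<Suc s. D k ((\<zeta>(s := y(s := t))) k) * (y k - x k))"
      unfolding \<zeta>(2) t(2) by (auto intro!: sum.cong simp: y'_def)
    finally show "f y - f x = (\<Sum>k<Suc s. D k ((\<zeta>(s := y(s := t))) k) * (y k - x k))" .
  qed
qed

lemma cube_segment:
  assumes "x \<in> cube k c \<delta>" "y \<in> cube k c \<delta>" "\<And>j. z j \<in> closed_segment (x j) (y j)"
  shows "z \<in> cube k c \<delta>"
proof -
  have "z j = 0" if "j \<ge> k" for j
    using assms(1,2) assms(3)[of j] that by (auto simp: cube_def)
  moreover have "\<bar>z j - c j\<bar> < \<delta>" if "j < k" for j
    using assms(1,2) assms(3)[of j] that
    by (auto simp: cube_def closed_segment_eq_real_ivl abs_less_iff split: if_splits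
        dest!: spec[of _ j])
  ultimately show ?thesis by (auto simp: cube_def)
qed

text \<open>The mean value theorem in the form needed for derivatives along a curve \<open>u\<close>: the
  coefficients of the increment converge to the partial derivatives.\<close>

lemma increment_coefficients:
  fixes f :: "(nat \<Rightarrow> real) \<Rightarrow> real"
  assumes U: "openin (Euclidean_space m) U" and x: "x \<in> U"
    and D: "\<And>z k. z \<in> U \<Longrightarrow> k < s \<Longrightarrow>
      ((\<lambda>t. f (z(k := t))) has_real_derivative D k z) (at (z k))"
    and cont: "\<And>k. k < s \<Longrightarrow> continuous_on U (D k)"
    and uE: "\<forall>\<^sub>F t in F. u t \<in> topspace (Euclidean_space m)"
    and u: "\<And>k. k < m \<Longrightarrow> ((\<lambda>t. u t k) \<longlongrightarrow> x k) F"
    and us: "\<forall>\<^sub>F t in F. \<forall>j\<ge>s. u t j = x j"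
  shows "\<exists>\<zeta>. (\<forall>k<s. ((\<lambda>t. D k (\<zeta> t k)) \<longlongrightarrow> D k x) F) \<and> (\<forall>\<^sub>F t in F.
      (\<forall>k<s. \<forall>j. \<zeta> t k j \<in> closed_segment (x j) (u t j)) \<and>
      f (u t) - f x = (\<Sum>k<s. D k (\<zeta> t k) * (u t k - x k)))"
proof -
  have xE: "x \<in> topspace (Euclidean_space m)" using U x openin_subset by blast
  have near: "\<forall>\<^sub>F t in F. u t \<in> cube m x \<delta>" if "\<delta> > 0" for \<delta>
  proof -
    have "\<forall>\<^sub>F t in F. \<forall>k\<in>{..<m}. \<bar>u t k - x k\<bar> < \<delta>"
      using u that by (intro eventually_ball_finite) (auto simp: tendsto_iff dist_real_def)
    then show ?thesis
      using uE by eventually_elim (auto simp: cube_def topspace_Euclidean_space)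
  qed
  obtain \<delta>0 where \<delta>0: "\<delta>0 > 0" "cube m x \<delta>0 \<subseteq> U" using U x by (auto elim: openin_cubeE)
  define Q where "Q t \<zeta> \<longleftrightarrow> (\<forall>k<s. \<forall>j. \<zeta> k j \<in> closed_segment (x j) (u t j)) \<and>
     f (u t) - f x = (\<Sum>k<s. D k (\<zeta> k) * (u t k - x k))" for t \<zeta>
  define \<zeta> where "\<zeta> t = (SOME \<zeta>. Q t \<zeta>)" for t
  have Q: "\<forall>\<^sub>F t in F. Q t (\<zeta> t)"
    using near[OF \<delta>0(1)] us
  proof eventually_elim
    case (elim t)
    have "\<exists>\<zeta>. Q t \<zeta>"
      unfolding Q_def
    proof (rule coordinatewise_mvt)
      show "((\<lambda>t. f (z(k := t))) has_real_derivative D k z) (at (z k))"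
        if "\<And>j. z j \<in> closed_segment (x j) (u t j)" "k < s" for z k
        using cube_segment[OF centre_in_cube[OF xE \<delta>0(1)] elim(1) that(1)] \<delta>0(2) that(2)
        by (intro D) auto
    qed (use elim in auto)
    then show ?case unfolding \<zeta>_def by (rule someI_ex)
  qed
  have "((\<lambda>t. D k (\<zeta> t k)) \<longlongrightarrow> D k x) F" if k: "k < s" for k
    unfolding tendsto_iff
  proof (intro allI impI)
    fix e :: real assume e: "e > 0"
    obtain \<delta> where \<delta>: "\<delta> > 0" "cube m x \<delta> \<subseteq> U" "\<And>y. y \<in> cube m x \<delta> \<Longrightarrow> \<bar>D k y - D k x\<bar> < e"
      using continuous_on_cubeE[OF U cont[OF k] x e] by blast
    show "\<forall>\<^sub>F t in F. dist (D k (\<zeta> t k)) (D k x) < e"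
      using Q near[OF \<delta>(1)]
    proof eventually_elim
      case (elim t)
      have "\<zeta> t k \<in> cube m x \<delta>"
        using elim(1) k
        by (intro cube_segment[OF centre_in_cube[OF xE \<delta>(1)] elim(2)]) (auto simp: Q_def)
      then show ?case using \<delta>(3) by (simp add: dist_real_def)
    qed
  qed
  then show ?thesis using Q unfolding Q_def by blast
qed

lemma chain_rule:
  fixes f :: "(nat \<Rightarrow> real) \<Rightarrow> real"
  assumes f: "smooth_on l U f" and x: "u t0 \<in> U"
    and uE: "\<forall>\<^sub>F t in at t0. u t \<in> topspace (Euclidean_space l)"
    and u: "\<And>k. k < l \<Longrightarrow> ((\<lambda>t. u t k) has_real_derivative u' k) (at t0)"
  shows "((\<lambda>t. f (u t)) has_real_derivative (\<Sum>k<l. partial k f (u t0) * u' k)) (at t0)"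
proof -
  let ?D = "\<lambda>k. partial k f"
  have xE: "u t0 \<in> topspace (Euclidean_space l)"
    using smooth_on_openin[OF f] x openin_subset by blast
  obtain \<zeta> where \<zeta>: "\<And>k. k < l \<Longrightarrow> ((\<lambda>t. ?D k (\<zeta> t k)) \<longlongrightarrow> ?D k (u t0)) (at t0)"
    "\<forall>\<^sub>F t in at t0. f (u t) - f (u t0) = (\<Sum>k<l. ?D k (\<zeta> t k) * (u t k - u t0 k))"
  proof -
    have *: "\<exists>\<zeta>. (\<forall>k<l. ((\<lambda>t. ?D k (\<zeta> t k)) \<longlongrightarrow> ?D k (u t0)) (at t0)) \<and> (\<forall>\<^sub>F t in at t0.
      (\<forall>k<l. \<forall>j. \<zeta> t k j \<in> closed_segment (u t0 j) (u t j)) \<and>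
      f (u t) - f (u t0) = (\<Sum>k<l. ?D k (\<zeta> t k) * (u t k - u t0 k)))"
    proof (rule increment_coefficients[OF smooth_on_openin[OF f] x _ _ uE])
      show "((\<lambda>t. u t k) \<longlongrightarrow> u t0 k) (at t0)" if "k < l" for k
        using DERIV_isCont[OF u[OF that]] by (simp add: isCont_def)
      show "\<forall>\<^sub>F t in at t0. \<forall>j\<ge>l. u t j = u t0 j"
        using uE by eventually_elim (use xE in \<open>auto simp: topspace_Euclidean_space\<close>)
    qed (intro smooth_on_has_partial[OF f] smooth_on_continuous_on[OF smooth_on_partial[OF f]]; assumption)+
    then obtain \<zeta> where "\<And>k. k < l \<Longrightarrow> ((\<lambda>t. ?D k (\<zeta> t k)) \<longlongrightarrow> ?D k (u t0)) (at t0)"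
      and "\<forall>\<^sub>F t in at t0. (\<forall>k<l. \<forall>j. \<zeta> t k j \<in> closed_segment (u t0 j) (u t j)) \<and>
        f (u t) - f (u t0) = (\<Sum>k<l. ?D k (\<zeta> t k) * (u t k - u t0 k))" by auto
    then show ?thesis by (intro that[of \<zeta>]) (auto elim: eventually_mono)
  qed
  have "((\<lambda>t. \<Sum>k<l. ?D k (\<zeta> t k) * ((u t k - u t0 k) / (t - t0))) \<longlongrightarrow>
        (\<Sum>k<l. ?D k (u t0) * u' k)) (at t0)"
    using \<zeta>(1) u by (intro tendsto_intros) (auto simp: has_field_derivative_iff)
  moreover have "\<forall>\<^sub>F t in at t0. (\<Sum>k<l. ?D k (\<zeta> t k) * ((u t k - u t0 k) / (t - t0))) =
      (f (u t) - f (u t0)) / (t - t0)"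
    using \<zeta>(2) by eventually_elim (simp add: sum_divide_distrib)
  ultimately show ?thesis
    unfolding has_field_derivative_iff by (rule Lim_transform_eventually)
qed

text \<open>Sums, products and substitutions are treated together: a partial derivative of a
  substitution is a sum of products that contain substitutions.\<close>

inductive smooth_term :: "nat \<Rightarrow> (nat \<Rightarrow> real) set \<Rightarrow> ((nat \<Rightarrow> real) \<Rightarrow> real) \<Rightarrow> bool"
  for k U where
  base: "smooth_on k U f \<Longrightarrow> smooth_term k U f"
| const: "smooth_term k U (\<lambda>x. a)"
| coord: "i < k \<Longrightarrow> smooth_term k U (\<lambda>x. x i)"
| add: "smooth_term k U f \<Longrightarrow> smooth_term k U g \<Longrightarrow> smooth_term k U (\<lambda>x. f x + g x)"
| mult: "smooth_term k U f \<Longrightarrow> smooth_term k U g \<Longrightarrow> smooth_term k U (\<lambda>x. f x * g x)"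
| comp: "smooth_on l V f \<Longrightarrow> (\<And>i. i < l \<Longrightarrow> smooth_term k U (g i)) \<Longrightarrow>
    (\<And>x. x \<in> U \<Longrightarrow> clip l (\<lambda>i. g i x) \<in> V) \<Longrightarrow> smooth_term k U (\<lambda>x. f (clip l (\<lambda>i. g i x)))"

lemma smooth_term_sum:
  "(\<And>i. i < n \<Longrightarrow> smooth_term k U (f i)) \<Longrightarrow> smooth_term k U (\<lambda>x. \<Sum>i<(n::nat). f i x)"
  by (induction n) (auto intro: smooth_term.intros)

lemma clip_in_topspace: "clip k x \<in> topspace (Euclidean_space k)"
  by (simp add: clip_def topspace_Euclidean_space)

lemma clip_ident: "x \<in> topspace (Euclidean_space k) \<Longrightarrow> clip k x = x"
  by (auto simp: clip_def topspace_Euclidean_space)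

lemma clip_nth: "i < k \<Longrightarrow> clip k x i = x i"
  by (simp add: clip_def)

lemma continuous_on_clip:
  assumes "\<And>i. i < l \<Longrightarrow> continuous_on U (g i)"
  shows "continuous_on U (\<lambda>x. clip l (\<lambda>i. g i x :: real))"
proof (rule continuous_on_coordinatewise_then_product)
  fix i
  show "continuous_on U (\<lambda>x. clip l (\<lambda>i. g i x) i)"
    using assms[of i] by (cases "i < l") (auto simp: clip_def)
qed

lemma smooth_term_smooth_on:
  assumes U: "openin (Euclidean_space k) U" and f: "smooth_term k U f"
  shows "smooth_on k U f"
proof (rule smooth_on_coinduct[where C = "Collect (smooth_term k U)"])
  fix g assume "g \<in> Collect (smooth_term k U)"
  then have "smooth_term k U g" by simp
  then show "continuous_on U g"
  proof (induction rule: smooth_term.induct)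
    case (coord i)
    show ?case by (rule continuous_on_subset[OF continuous_on_product_coordinates subset_UNIV])
  next
    case (comp l V f g)
    show ?case
      by (rule continuous_on_compose2[OF smooth_on_continuous_on[OF comp.hyps(1)]
            continuous_on_clip]) (use comp in auto)
  qed (auto intro: smooth_on_continuous_on continuous_intros)
next
  fix g i assume "g \<in> Collect (smooth_term k U)" and i: "i < k"
  then have "smooth_term k U g" by simp
  then have "\<exists>g'. smooth_term k U g' \<and>
     (\<forall>x\<in>U. ((\<lambda>s. g (x(i := s))) has_real_derivative g' x) (at (x i)))"
  proof (induction rule: smooth_term.induct)
    case (base f)
    then show ?case
      using smooth_on_has_partial[OF base _ i] smooth_term.base[OF smooth_on_partial[OF base i]]
      by blast
  next
    case (const a)
    show ?case by (intro exI[of _ "\<lambda>x. 0"]) (auto intro: smooth_term.const)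
  next
    case (coord j)
    then show ?case
      by (intro exI[of _ "\<lambda>x. if i = j then 1 else 0"])
        (auto intro: smooth_term.const)
  next
    case (add f g)
    then obtain f' g' where
      "smooth_term k U f'" "\<And>x. x \<in> U \<Longrightarrow> ((\<lambda>s. f (x(i := s))) has_real_derivative f' x) (at (x i))"
      "smooth_term k U g'" "\<And>x. x \<in> U \<Longrightarrow> ((\<lambda>s. g (x(i := s))) has_real_derivative g' x) (at (x i))"
      by blast
    then show ?case
      by (intro exI[of _ "\<lambda>x. f' x + g' x"] conjI ballI smooth_term.add DERIV_add)
  next
    case (mult f g)
    then obtain f' g' where fg:
      "smooth_term k U f'" "\<And>x. x \<in> U \<Longrightarrow> ((\<lambda>s. f (x(i := s))) has_real_derivative f' x) (at (x i))"
      "smooth_term k U g'" "\<And>x. x \<in> U \<Longrightarrow> ((\<lambda>s. g (x(i := s))) has_real_derivative g' x) (at (x i))"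
      by blast
    show ?case
    proof (intro exI[of _ "\<lambda>x. f' x * g x + g' x * f x"] conjI ballI)
      show "((\<lambda>s. f (x(i := s)) * g (x(i := s))) has_real_derivative f' x * g x + g' x * f x) (at (x i))"
        if "x \<in> U" for x
        using DERIV_mult[OF fg(2)[OF that] fg(4)[OF that]] by (simp add: fun_upd_idem)
    qed (intro smooth_term.add smooth_term.mult fg(1,3) mult.hyps)
  next
    case (comp l V f g)
    have "\<forall>j\<in>{..<l}. \<exists>g'. smooth_term k U g' \<and>
       (\<forall>x\<in>U. ((\<lambda>s. g j (x(i := s))) has_real_derivative g' x) (at (x i)))"
      using comp.IH by blast
    then obtain g' where g': "\<And>j. j < l \<Longrightarrow> smooth_term k U (g' j)"
      "\<And>j x. j < l \<Longrightarrow> x \<in> U \<Longrightarrow> ((\<lambda>s. g j (x(i := s))) has_real_derivative g' j x) (at (x i))"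
      by (auto dest!: bchoice)
    show ?case
    proof (intro exI[of _ "\<lambda>x. \<Sum>j<l. partial j f (clip l (\<lambda>i. g i x)) * g' j x"] conjI ballI)
      show "smooth_term k U (\<lambda>x. \<Sum>j<l. partial j f (clip l (\<lambda>i. g i x)) * g' j x)"
        using comp g'(1)
        by (intro smooth_term_sum smooth_term.mult smooth_term.comp[where V = V]
            smooth_on_partial) auto
      fix x assume x: "x \<in> U"
      have "((\<lambda>s. f (clip l (\<lambda>j. g j (x(i := s))))) has_real_derivative
         (\<Sum>j<l. partial j f (clip l (\<lambda>j. g j (x(i := x i)))) * g' j x)) (at (x i))"
      proof (rule chain_rule[OF comp.hyps(1)])
        show "((\<lambda>s. clip l (\<lambda>j. g j (x(i := s))) j) has_real_derivative g' j x) (at (x i))"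
          if "j < l" for j
          using g'(2)[OF that x] that by (simp add: clip_nth)
      qed (use comp x in \<open>auto simp: clip_in_topspace\<close>)
      then show "((\<lambda>s. f (clip l (\<lambda>j. g j (x(i := s))))) has_real_derivative
         (\<Sum>j<l. partial j f (clip l (\<lambda>j. g j x)) * g' j x)) (at (x i))"
        by simp
    qed
  qed
  then show "\<exists>g'\<in>Collect (smooth_term k U).
     \<forall>x\<in>U. ((\<lambda>s. g (x(i := s))) has_real_derivative g' x) (at (x i))"
    unfolding Bex_def mem_Collect_eq .
qed (use assms in auto)

lemma smooth_on_const: "openin (Euclidean_space k) U \<Longrightarrow> smooth_on k U (\<lambda>x. a)"
  by (intro smooth_term_smooth_on smooth_term.const)

lemma smooth_on_mult: "smooth_on k U f \<Longrightarrow> smooth_on k U g \<Longrightarrow> smooth_on k U (\<lambda>x. f x * g x)"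
  by (blast intro: smooth_term_smooth_on[OF smooth_on_openin smooth_term.mult[OF smooth_term.base smooth_term.base]])

lemma smooth_on_diff:
  assumes "smooth_on k U f" "smooth_on k U g"
  shows "smooth_on k U (\<lambda>x. f x - g x)"
proof -
  have "smooth_on k U (\<lambda>x. f x + -1 * g x)"
    by (rule smooth_term_smooth_on[OF smooth_on_openin[OF assms(1)]])
      (rule smooth_term.add[OF smooth_term.base[OF assms(1)]
          smooth_term.mult[OF smooth_term.const smooth_term.base[OF assms(2)]]])
  then show ?thesis by simp
qed

lemma smooth_on_sum:
  "openin (Euclidean_space k) U \<Longrightarrow> (\<And>i. i < n \<Longrightarrow> smooth_on k U (f i)) \<Longrightarrow>
    smooth_on k U (\<lambda>x. \<Sum>i<(n::nat). f i x)"
  by (rule smooth_term_smooth_on, assumption, rule smooth_term_sum, rule smooth_term.base)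

lemma smooth_on_compose:
  assumes "openin (Euclidean_space k) U" "smooth_on l V f" "\<And>i. i < l \<Longrightarrow> smooth_on k U (g i)"
    "\<And>x. x \<in> U \<Longrightarrow> clip l (\<lambda>i. g i x) \<in> V"
  shows "smooth_on k U (\<lambda>x. f (clip l (\<lambda>i. g i x)))"
  by (rule smooth_term_smooth_on[OF assms(1) smooth_term.comp[OF assms(2) smooth_term.base[OF assms(3)] assms(4)]])

lemma partial_compose:
  assumes f: "smooth_on l V f" and g: "\<And>j. j < l \<Longrightarrow> smooth_on k U (g j)"
    and gV: "\<And>x. x \<in> U \<Longrightarrow> clip l (\<lambda>j. g j x) \<in> V" and x: "x \<in> U" and i: "i < k"
  shows "partial i (\<lambda>x. f (clip l (\<lambda>j. g j x))) x =
    (\<Sum>j<l. partial j f (clip l (\<lambda>j. g j x)) * partial i (g j) x)"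
proof (rule partial_eq)
  have "((\<lambda>s. f (clip l (\<lambda>j. g j (x(i := s))))) has_real_derivative
     (\<Sum>j<l. partial j f (clip l (\<lambda>j. g j (x(i := x i)))) * partial i (g j) x)) (at (x i))"
  proof (rule chain_rule[OF f])
    show "((\<lambda>s. clip l (\<lambda>j. g j (x(i := s))) j) has_real_derivative partial i (g j) x) (at (x i))"
      if "j < l" for j
      using smooth_on_has_partial[OF g[OF that] x i] that by (simp add: clip_nth)
  qed (use gV x in \<open>auto simp: clip_in_topspace\<close>)
  then show "((\<lambda>s. f (clip l (\<lambda>j. g j (x(i := s))))) has_real_derivative
     (\<Sum>j<l. partial j f (clip l (\<lambda>j. g j x)) * partial i (g j) x)) (at (x i))"
    by simp
qed

lemma partial_mult:
  assumes "smooth_on k U f" "smooth_on k U g" "x \<in> U" "i < k"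
  shows "partial i (\<lambda>x. f x * g x) x = partial i f x * g x + f x * partial i g x"
  using DERIV_mult[OF smooth_on_has_partial[OF assms(1,3,4)] smooth_on_has_partial[OF assms(2-4)]]
  by (intro partial_eq) (simp add: fun_upd_idem mult.commute)

lemma partial_diff:
  assumes "smooth_on k U f" "smooth_on k U g" "x \<in> U" "i < k"
  shows "partial i (\<lambda>x. f x - g x) x = partial i f x - partial i g x"
  by (intro partial_eq DERIV_diff smooth_on_has_partial[OF assms(1,3,4)]
      smooth_on_has_partial[OF assms(2-4)])

lemma partial_sum:
  assumes "\<And>j. j < n \<Longrightarrow> smooth_on k U (f j)" "x \<in> U" "i < k"
  shows "partial i (\<lambda>x. \<Sum>j<(n::nat). f j x) x = (\<Sum>j<n. partial i (f j) x)"
  by (intro partial_eq DERIV_sum smooth_on_has_partial[OF assms(1) assms(2,3)]) auto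

subsection \<open>Symmetry of second partial derivatives\<close>

text \<open>The mixed second difference of \<open>g\<close> over a square is the first difference of a first difference,
  so that the mean value theorem applies twice.  It is symmetric in the two variables, which
  makes the two mixed derivatives agree in the limit.\<close>

lemma second_difference_mvt:
  fixes g :: "real \<Rightarrow> real \<Rightarrow> real"
  assumes "h > 0"
    and g1: "\<And>a b. \<bar>a - a0\<bar> \<le> h \<Longrightarrow> \<bar>b - b0\<bar> \<le> h \<Longrightarrow> ((\<lambda>a. g a b) has_real_derivative g1 a b) (at a)"
    and g12: "\<And>a b. \<bar>a - a0\<bar> \<le> h \<Longrightarrow> \<bar>b - b0\<bar> \<le> h \<Longrightarrow> ((\<lambda>b. g1 a b) has_real_derivative g12 a b) (at b)"
  shows "\<exists>a b. \<bar>a - a0\<bar> \<le> h \<and> \<bar>b - b0\<bar> \<le> h \<and>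
    g (a0 + h) (b0 + h) - g (a0 + h) b0 - g a0 (b0 + h) + g a0 b0 = h * h * g12 a b"
proof -
  define \<phi> where "\<phi> a = g a (b0 + h) - g a b0" for a
  have "(\<phi> has_real_derivative g1 a (b0 + h) - g1 a b0) (at a)" if "a0 \<le> a" "a \<le> a0 + h" for a
    unfolding \<phi>_def using that \<open>h > 0\<close> by (intro DERIV_diff g1) auto
  then obtain a where a: "a0 < a" "a < a0 + h" "\<phi> (a0 + h) - \<phi> a0 = h * (g1 a (b0 + h) - g1 a b0)"
    using MVT2[of a0 "a0 + h" \<phi> "\<lambda>a. g1 a (b0 + h) - g1 a b0"] \<open>h > 0\<close> by auto
  have "((\<lambda>b. g1 a b) has_real_derivative g12 a b) (at b)" if "b0 \<le> b" "b \<le> b0 + h" for b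
    using that a by (intro g12) auto
  then obtain b where b: "b0 < b" "b < b0 + h" "g1 a (b0 + h) - g1 a b0 = h * g12 a b"
    using MVT2[of b0 "b0 + h" "g1 a" "g12 a"] \<open>h > 0\<close> by auto
  show ?thesis using a b by (intro exI[of _ a] exI[of _ b]) (auto simp: \<phi>_def)
qed

lemma partial_commute:
  assumes f: "smooth_on n U f" and x: "x \<in> U" and k: "k < n" and l: "l < n"
  shows "partial k (partial l f) x = partial l (partial k f) x"
proof (cases "k = l")
  case False
  note U = smooth_on_openin[OF f]
  have xE: "x \<in> topspace (Euclidean_space n)" using U x openin_subset by blast
  let ?p = "\<lambda>a b. x(k := a, l := b)"
  have close: "\<bar>partial k (partial l f) x - partial l (partial k f) x\<bar> < 2 * e" if e: "e > 0" for e
  proof -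
    obtain \<delta>1 where \<delta>1: "\<delta>1 > 0" "cube n x \<delta>1 \<subseteq> U"
      "\<And>y. y \<in> cube n x \<delta>1 \<Longrightarrow> \<bar>partial k (partial l f) y - partial k (partial l f) x\<bar> < e"
      using continuous_on_cubeE[OF U smooth_on_continuous_on x e]
        smooth_on_partial[OF smooth_on_partial[OF f l] k] by blast
    obtain \<delta>2 where \<delta>2: "\<delta>2 > 0" "cube n x \<delta>2 \<subseteq> U"
      "\<And>y. y \<in> cube n x \<delta>2 \<Longrightarrow> \<bar>partial l (partial k f) y - partial l (partial k f) x\<bar> < e"
      using continuous_on_cubeE[OF U smooth_on_continuous_on x e]
        smooth_on_partial[OF smooth_on_partial[OF f k] l] by blast
    define h where "h = min \<delta>1 \<delta>2 / 2"
    have h: "h > 0" "h < \<delta>1" "h < \<delta>2" using \<delta>1 \<delta>2 by (auto simp: h_def)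
    have cube: "?p a b \<in> cube n x (min \<delta>1 \<delta>2)" if "\<bar>a - x k\<bar> \<le> h" "\<bar>b - x l\<bar> \<le> h" for a b
      using that h k l xE \<delta>1(1) \<delta>2(1) by (auto simp: cube_def topspace_Euclidean_space)
    have cu: "?p a b \<in> cube n x \<delta>1" "?p a b \<in> cube n x \<delta>2" "?p a b \<in> U"
      if "\<bar>a - x k\<bar> \<le> h" "\<bar>b - x l\<bar> \<le> h" for a b
      using cube[OF that] cube_mono[of "min \<delta>1 \<delta>2" \<delta>1 n x] cube_mono[of "min \<delta>1 \<delta>2" \<delta>2 n x] \<delta>1(2)
      by auto
    have dk: "((\<lambda>a. F (?p a b)) has_real_derivative partial k F (?p a b)) (at a)"
      and dl: "((\<lambda>b. F (?p a b)) has_real_derivative partial l F (?p a b)) (at b)"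
      if "smooth_on n U F" "\<bar>a - x k\<bar> \<le> h" "\<bar>b - x l\<bar> \<le> h" for F a b
      using smooth_on_has_partial[OF that(1) cu(3)[OF that(2,3)] k]
        smooth_on_has_partial[OF that(1) cu(3)[OF that(2,3)] l] False
      by (simp_all add: fun_upd_twist)
    let ?\<Delta> = "f (?p (x k + h) (x l + h)) - f (?p (x k + h) (x l)) - f (?p (x k) (x l + h)) + f (?p (x k) (x l))"
    obtain a b where ab: "\<bar>a - x k\<bar> \<le> h" "\<bar>b - x l\<bar> \<le> h"
      "?\<Delta> = h * h * partial l (partial k f) (?p a b)"
      using second_difference_mvt[OF h(1), of "x k" "x l" "\<lambda>a b. f (?p a b)"
          "\<lambda>a b. partial k f (?p a b)" "\<lambda>a b. partial l (partial k f) (?p a b)"]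
        dk[OF f] dl[OF smooth_on_partial[OF f k]] by blast
    have "\<exists>b a. \<bar>b - x l\<bar> \<le> h \<and> \<bar>a - x k\<bar> \<le> h \<and>
      f (?p (x k + h) (x l + h)) - f (?p (x k) (x l + h)) - f (?p (x k + h) (x l)) + f (?p (x k) (x l))
      = h * h * partial k (partial l f) (?p a b)"
      using dl[OF f] dk[OF smooth_on_partial[OF f l]]
      by (intro second_difference_mvt[OF h(1), of "x l" "x k" "\<lambda>b a. f (?p a b)"
          "\<lambda>b a. partial l f (?p a b)" "\<lambda>b a. partial k (partial l f) (?p a b)"]) auto
    then obtain a' b' where ab': "\<bar>b' - x l\<bar> \<le> h" "\<bar>a' - x k\<bar> \<le> h"
      "f (?p (x k + h) (x l + h)) - f (?p (x k) (x l + h)) - f (?p (x k + h) (x l)) + f (?p (x k) (x l))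
      = h * h * partial k (partial l f) (?p a' b')"
      by blast
    have "h * h * partial l (partial k f) (?p a b) = h * h * partial k (partial l f) (?p a' b')"
      using ab(3) ab'(3) by linarith
    then have "partial l (partial k f) (?p a b) = partial k (partial l f) (?p a' b')"
      using h by simp
    then show ?thesis
      using \<delta>1(3)[OF cu(1)[OF ab'(2,1)]] \<delta>2(3)[OF cu(2)[OF ab(1,2)]] by linarith
  qed
  show ?thesis
    using close[of "\<bar>partial k (partial l f) x - partial l (partial k f) x\<bar> / 2"] by force
qed auto

section \<open>Integration along a coordinate\<close>

lemma integral_along_segment:
  fixes \<phi> g :: "real \<Rightarrow> real"
  assumes "\<And>\<tau>. \<tau> \<in> closed_segment a b \<Longrightarrow> (\<phi> has_real_derivative g \<tau>) (at \<tau>)"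
  shows "(b - a) * integral {0..1} (\<lambda>t. g (a + t * (b - a))) = \<phi> b - \<phi> a"
proof -
  have "((\<lambda>t. g (a + t * (b - a)) * (b - a)) has_integral \<phi> (a + 1 * (b - a)) - \<phi> (a + 0 * (b - a))) {0..1}"
  proof (rule fundamental_theorem_of_calculus)
    fix t :: real assume t: "t \<in> {0..1}"
    have "a + t * (b - a) = (1 - t) * a + t * b" by (simp add: algebra_simps)
    then have "a + t * (b - a) \<in> closed_segment a b"
      using t unfolding closed_segment_def by auto
    then have "(\<phi> has_real_derivative g (a + t * (b - a))) (at (a + t * (b - a)))"
      by (rule assms)
    moreover have "((\<lambda>t. a + t * (b - a)) has_real_derivative (b - a)) (at t)"
      by (auto intro!: derivative_eq_intros)
    ultimately have "((\<lambda>t. \<phi> (a + t * (b - a))) has_real_derivative g (a + t * (b - a)) * (b - a)) (at t)"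
      by (rule DERIV_chain2)
    then show "((\<lambda>t. \<phi> (a + t * (b - a))) has_vector_derivative g (a + t * (b - a)) * (b - a)) (at t within {0..1})"
      unfolding has_real_derivative_iff_has_vector_derivative
      by (rule has_vector_derivative_at_within)
  qed simp
  then have "integral {0..1} (\<lambda>t. g (a + t * (b - a)) * (b - a)) =
      \<phi> (a + 1 * (b - a)) - \<phi> (a + 0 * (b - a))"
    by (rule integral_unique)
  then show ?thesis by (simp add: mult.commute)
qed

text \<open>The integral of \<open>f\<close> over the \<open>i\<close>-th variable from \<open>c i\<close> to \<open>x i\<close>, rescaled to the unit
  interval so that neither an orientation nor a moving limit of integration has to be considered.\<close>

definition coord_integral ::
    "(nat \<Rightarrow> real) \<Rightarrow> nat \<Rightarrow> ((nat \<Rightarrow> real) \<Rightarrow> real) \<Rightarrow> (nat \<Rightarrow> real) \<Rightarrow> real" where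
  "coord_integral c i f x =
     (x i - c i) * integral {0..1} (\<lambda>t. f (x(i := c i + t * (x i - c i))))"

lemma cube_fun_upd:
  assumes "x \<in> cube m c \<delta>" "i < m" "\<bar>t - c i\<bar> < \<delta>"
  shows "x(i := t) \<in> cube m c \<delta>"
  using assms by (auto simp: cube_def)

lemma cube_rescale:
  assumes x: "x \<in> cube m c \<delta>" and i: "i < m" and t: "t \<in> {0..1}"
  shows "x(i := c i + t * (x i - c i)) \<in> cube m c \<delta>"
proof -
  have "\<bar>t * (x i - c i)\<bar> \<le> 1 * \<bar>x i - c i\<bar>"
    unfolding abs_mult using t by (intro mult_right_mono) auto
  then show ?thesis using x i by (intro cube_fun_upd) (auto simp: cube_def)
qed

lemma continuous_on_fun_upd:
  fixes f :: "nat \<Rightarrow> 'a::topological_space \<Rightarrow> real"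
  assumes "\<And>j. continuous_on S (f j)" "continuous_on S g"
  shows "continuous_on S (\<lambda>x. (\<lambda>j. f j x)(i := g x))"
proof (rule continuous_on_coordinatewise_then_product)
  show "continuous_on S (\<lambda>x. ((\<lambda>j. f j x)(i := g x)) k)" for k
    using assms by (cases "k = i") auto
qed

lemma continuous_on_coord: "continuous_on S (\<lambda>x :: nat \<Rightarrow> real. x i)"
  by (rule continuous_on_subset[OF continuous_on_product_coordinates subset_UNIV])

lemma continuous_on_rescaled:
  fixes f :: "(nat \<Rightarrow> real) \<Rightarrow> real"
  assumes f: "continuous_on (cube m c \<delta>) f" and i: "i < m"
  shows "continuous_on (cube m c \<delta> \<times> {0..1}) (\<lambda>(x, t). f (x(i := c i + t * (x i - c i))))"
  unfolding case_prod_beta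
proof (rule continuous_on_compose2[OF f])
  have coord: "continuous_on S (\<lambda>z. fst z j)" for S :: "((nat \<Rightarrow> real) \<times> real) set" and j
    by (rule continuous_on_product_then_coordinatewise) (intro continuous_intros)
  show "continuous_on (cube m c \<delta> \<times> {0..1}) (\<lambda>z. (fst z)(i := c i + snd z * (fst z i - c i)))"
    by (intro continuous_on_fun_upd coord continuous_intros)
qed (use cube_rescale[OF _ i] in auto)

lemma continuous_on_coord_integral:
  assumes f: "continuous_on (cube m c \<delta>) f" and i: "i < m"
  shows "continuous_on (cube m c \<delta>) (coord_integral c i f)"
proof -
  have "continuous_on (cube m c \<delta>)
      (\<lambda>x. integral (cbox 0 1) (\<lambda>t. f (x(i := c i + t * (x i - c i)))))"
    using continuous_on_rescaled[OF f i] by (intro integral_continuous_on_param) simp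
  then show ?thesis
    unfolding coord_integral_def by (intro continuous_intros continuous_on_coord) simp
qed

lemma coord_integral_eq:
  assumes x: "x \<in> cube m c \<delta>" and i: "i < m" and \<delta>: "\<delta> > 0"
    and \<phi>: "\<And>z. z \<in> cube m c \<delta> \<Longrightarrow> ((\<lambda>t. \<phi> (z(i := t))) has_real_derivative f z) (at (z i))"
  shows "coord_integral c i f x = \<phi> x - \<phi> (x(i := c i))"
proof -
  have "(x i - c i) * integral {0..1} (\<lambda>t. (\<lambda>\<tau>. f (x(i := \<tau>))) (c i + t * (x i - c i))) =
      \<phi> (x(i := x i)) - \<phi> (x(i := c i))"
  proof (rule integral_along_segment)
    fix \<tau> assume \<tau>: "\<tau> \<in> closed_segment (c i) (x i)"
    have "\<bar>\<tau> - c i\<bar> < \<delta>"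
      using \<tau> x i by (auto simp: closed_segment_eq_real_ivl cube_def split: if_splits)
    then show "((\<lambda>t. \<phi> (x(i := t))) has_real_derivative f (x(i := \<tau>))) (at \<tau>)"
      using \<phi>[OF cube_fun_upd[OF x i], of \<tau>] by simp
  qed
  then show ?thesis by (simp add: coord_integral_def)
qed

text \<open>Near \<open>x\<close>, the integral is a difference of two values of a primitive of the restriction of \<open>f\<close> to
  the line through \<open>x\<close>.\<close>

lemma coord_integral_partial_self:
  fixes f :: "(nat \<Rightarrow> real) \<Rightarrow> real"
  assumes f: "continuous_on (cube m c \<delta>) f" and x: "x \<in> cube m c \<delta>" and i: "i < m"
  shows "((\<lambda>s. coord_integral c i f (x(i := s))) has_real_derivative f x) (at (x i))"
proof -
  let ?g = "\<lambda>s. f (x(i := s))"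
  have xi: "\<bar>x i - c i\<bar> < \<delta>" using x i by (auto simp: cube_def)
  define \<rho> where "\<rho> = (\<bar>x i - c i\<bar> + \<delta>) / 2"
  have \<rho>: "\<bar>x i - c i\<bar> < \<rho>" "\<rho> < \<delta>" "\<rho> > 0" using xi by (auto simp: \<rho>_def)
  let ?J = "{c i - \<rho>..c i + \<rho>}"
  have contg: "continuous_on ?J ?g"
  proof (rule continuous_on_compose2[OF f])
    show "continuous_on ?J (\<lambda>s. x(i := s))"
      by (intro continuous_on_fun_upd continuous_intros)
    show "(\<lambda>s. x(i := s)) ` ?J \<subseteq> cube m c \<delta>"
      using \<rho> by (auto intro!: cube_fun_upd[OF x i])
  qed
  define \<phi> where "\<phi> s = integral {c i - \<rho>..s} ?g" for s
  have \<phi>: "(\<phi> has_real_derivative ?g s) (at s)" if s: "\<bar>s - c i\<bar> < \<rho>" for s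
  proof -
    have "s \<in> ?J" using s by auto
    then have "(\<phi> has_real_derivative ?g s) (at s within ?J)"
      unfolding \<phi>_def has_real_derivative_iff_has_vector_derivative
      by (intro integral_has_vector_derivative contg)
    moreover have "at s within ?J = at s" using s by (intro at_within_interior) auto
    ultimately show ?thesis by (simp only:)
  qed
  have eq: "coord_integral c i f (x(i := s)) = \<phi> s - \<phi> (c i)" if s: "\<bar>s - c i\<bar> < \<rho>" for s
  proof -
    have "(s - c i) * integral {0..1} (\<lambda>t. ?g (c i + t * (s - c i))) = \<phi> s - \<phi> (c i)"
    proof (rule integral_along_segment)
      fix \<tau> assume "\<tau> \<in> closed_segment (c i) s"
      then have "\<bar>\<tau> - c i\<bar> < \<rho>"
        using s by (auto simp: closed_segment_eq_real_ivl split: if_splits)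
      then show "(\<phi> has_real_derivative ?g \<tau>) (at \<tau>)" by (rule \<phi>)
    qed
    then show ?thesis by (simp add: coord_integral_def)
  qed
  have "((\<lambda>s. \<phi> s - \<phi> (c i)) has_real_derivative ?g (x i) - 0) (at (x i))"
    by (rule DERIV_diff[OF \<phi>[OF \<rho>(1)] DERIV_const])
  moreover have "\<forall>\<^sub>F s in nhds (x i). coord_integral c i f (x(i := s)) = \<phi> s - \<phi> (c i)"
  proof -
    have "\<forall>\<^sub>F s in nhds (x i). s \<in> {c i - \<rho><..<c i + \<rho>}"
    proof (rule eventually_nhds_in_open)
      show "x i \<in> {c i - \<rho><..<c i + \<rho>}" using \<rho>(1) by simp linarith
    qed simp
    then show ?thesis by eventually_elim (rule eq, simp add: abs_less_iff)
  qed
  ultimately show ?thesis by (simp add: DERIV_cong_ev)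
qed

lemma coord_integral_partial_other:
  fixes f :: "(nat \<Rightarrow> real) \<Rightarrow> real"
  assumes f: "continuous_on (cube m c \<delta>) f" and f': "continuous_on (cube m c \<delta>) f'"
    and der: "\<And>z. z \<in> cube m c \<delta> \<Longrightarrow> ((\<lambda>t. f (z(j := t))) has_real_derivative f' z) (at (z j))"
    and x: "x \<in> cube m c \<delta>" and i: "i < m" and j: "j < m" "j \<noteq> i"
  shows "((\<lambda>s. coord_integral c i f (x(j := s))) has_real_derivative coord_integral c i f' x) (at (x j))"
proof -
  define J where "J = {c j - \<delta><..<c j + \<delta>}"
  have xj: "x j \<in> J" using x j by (auto simp: cube_def J_def abs_less_iff)
  have in_cube: "x(j := s) \<in> cube m c \<delta>" if "s \<in> J" for s
    using that by (intro cube_fun_upd[OF x j(1)]) (auto simp: J_def abs_less_iff)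
  let ?r = "\<lambda>s t. x(j := s, i := c i + t * (x i - c i))"
  have r_in: "?r s t \<in> cube m c \<delta>" if "s \<in> J" "t \<in> {0..1}" for s t
    using cube_rescale[OF in_cube[OF that(1)] i that(2)] j by simp
  have atJ: "at (x j) within J = at (x j)"
    using xj by (rule at_within_open) (simp add: J_def)
  have "((\<lambda>s. integral (cbox 0 1) (\<lambda>t. f (?r s t))) has_real_derivative
     integral (cbox 0 1) (\<lambda>t. f' (?r (x j) t))) (at (x j) within J)"
  proof (rule leibniz_rule_field_derivative)
    fix s t assume s: "s \<in> J" and t: "t \<in> cbox (0::real) 1"
    have rj: "?r s t j = s" "(?r s t)(j := u) = ?r u t" for u using j by auto
    have "?r s t \<in> cube m c \<delta>" using t by (intro r_in[OF s]) simp
    from der[OF this] show "((\<lambda>s. f (?r s t)) has_real_derivative f' (?r s t)) (at s within J)"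
      unfolding rj by (rule has_field_derivative_at_within)
  next
    fix s assume s: "s \<in> J"
    have "continuous_on {0..1} (\<lambda>t. f (?r s t))"
    proof (rule continuous_on_compose2[OF f])
      show "continuous_on {0..1} (\<lambda>t. ?r s t)"
        by (intro continuous_on_fun_upd continuous_intros)
      show "(\<lambda>t. ?r s t) ` {0..1} \<subseteq> cube m c \<delta>"
        by (rule image_subsetI) (rule r_in[OF s])
    qed
    then show "(\<lambda>t. f (?r s t)) integrable_on cbox 0 1"
      by (simp add: integrable_continuous_interval)
  next
    show "continuous_on (J \<times> cbox 0 1) (\<lambda>(s, t). f' (?r s t))"
      unfolding case_prod_beta
    proof (rule continuous_on_compose2[OF f'])
      have "continuous_on (J \<times> cbox 0 1) (\<lambda>z. (x(j := fst z)) k)" for k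
        by (cases "k = j") (auto intro!: continuous_intros)
      then show "continuous_on (J \<times> cbox 0 1) (\<lambda>z. ?r (fst z) (snd z))"
        by (intro continuous_on_fun_upd continuous_intros)
      show "(\<lambda>z. ?r (fst z) (snd z)) ` (J \<times> cbox 0 1) \<subseteq> cube m c \<delta>"
        by (rule image_subsetI, rule r_in) auto
    qed
  qed (use xj in \<open>auto simp: J_def convex_real_interval\<close>)
  then have "((\<lambda>s. integral {0..1} (\<lambda>t. f (?r s t))) has_real_derivative
     integral {0..1} (\<lambda>t. f' (?r (x j) t))) (at (x j))"
    unfolding atJ box_real .
  then have "((\<lambda>s. (x i - c i) * integral {0..1} (\<lambda>t. f (?r s t))) has_real_derivative
     (x i - c i) * integral {0..1} (\<lambda>t. f' (?r (x j) t))) (at (x j))"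
    by (rule DERIV_cmult)
  then show ?thesis
    unfolding coord_integral_def using j by simp
qed

section \<open>Closure properties of known functions\<close>

lemma known_sum_lessThan:
  assumes "openin (Euclidean_space k) U" "\<And>i. i < n \<Longrightarrow> known D k U (f i)"
  shows "known D k U (\<lambda>x. \<Sum>i<(n::nat). f i x)"
  using assms(2)
proof (induction n)
  case 0
  show ?case using known.const[OF assms(1), of D 0] by simp
next
  case (Suc n)
  have "known D k U (\<lambda>x. (\<Sum>i<n. f i x) + f n x)"
    by (intro known.sum Suc.IH Suc.prems) auto
  then show ?case by simp
qed

lemma known_diff:
  assumes "openin (Euclidean_space k) U" "known D k U f" "known D k U g"
  shows "known D k U (\<lambda>x. f x - g x)"
proof -
  have "known D k U (\<lambda>x. f x + -1 * g x)"
    by (intro known.sum known.product known.const assms)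
  then show ?thesis by simp
qed

section \<open>Potentials by quadratures\<close>

text \<open>The Poincare lemma on a cube, for forms in the first \<open>s\<close> variables with the remaining
  variables as parameters.  The potential is the sum of the integrals along the edges of a path
  that changes one coordinate at a time; closedness makes the later integrals contribute to the
  derivatives in the earlier directions just what is missing there.\<close>

lemma potential_by_quadratures:
  fixes \<omega> :: "nat \<Rightarrow> (nat \<Rightarrow> real) \<Rightarrow> real"
  assumes c: "c \<in> topspace (Euclidean_space m)" and \<delta>: "\<delta> > 0" and "s \<le> m"
    and "\<And>k. k < s \<Longrightarrow> smooth_on m (cube m c \<delta>) (\<omega> k)"
    and "\<And>k. k < s \<Longrightarrow> known D m (cube m c \<delta>) (\<omega> k)"
    and "\<And>j k x. j < s \<Longrightarrow> k < s \<Longrightarrow> x \<in> cube m c \<delta> \<Longrightarrow> partial j (\<omega> k) x = partial k (\<omega> j) x"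
  shows "\<exists>W. known D m (cube m c \<delta>) W \<and> continuous_on (cube m c \<delta>) W \<and>
    (\<forall>k<s. \<forall>x\<in>cube m c \<delta>. ((\<lambda>t. W (x(k := t))) has_real_derivative \<omega> k x) (at (x k)))"
  using assms(3-6)
proof (induction s)
  case 0
  show ?case by (intro exI[of _ "\<lambda>x. 0"]) (auto intro: known.const openin_cube)
next
  case (Suc s)
  let ?U = "cube m c \<delta>"
  note smooth = Suc.prems(2) and closed = Suc.prems(4)
  have s: "s < m" using Suc.prems(1) by simp
  obtain V where V: "known D m ?U V" "continuous_on ?U V"
    "\<And>k x. k < s \<Longrightarrow> x \<in> ?U \<Longrightarrow> ((\<lambda>t. V (x(k := t))) has_real_derivative \<omega> k x) (at (x k))"
  proof -
    have "\<exists>W. known D m ?U W \<and> continuous_on ?U W \<and>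
      (\<forall>k<s. \<forall>x\<in>?U. ((\<lambda>t. W (x(k := t))) has_real_derivative \<omega> k x) (at (x k)))"
      by (rule Suc.IH) (use Suc.prems in auto)
    then show ?thesis using that by blast
  qed
  let ?F = "coord_integral c s (\<omega> s)"
  have cont: "continuous_on ?U (\<omega> s)" using smooth by (intro smooth_on_continuous_on) auto
  have base: "x(s := c s) \<in> ?U" if "x \<in> ?U" for x
    using \<delta> by (intro cube_fun_upd[OF that s]) auto
  have clip_base: "clip m (\<lambda>i. if i = s then c s else x i) = x(s := c s)" if "x \<in> ?U" for x
    using that s by (auto simp: clip_def cube_def)
  show ?case
  proof (intro exI[of _ "\<lambda>x. V (x(s := c s)) + ?F x"] conjI allI impI ballI)
    have "known D m ?U (\<lambda>x. V (clip m (\<lambda>i. if i = s then c s else x i)))"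
    proof (rule known.substitution[OF V(1) openin_cube])
      show "known D m ?U (\<lambda>x. if i = s then c s else x i)" if "i < m" for i
        using that by (cases "i = s") (auto intro: known.const known.coord openin_cube)
    qed (use clip_base base in simp)
    then have "known D m ?U (\<lambda>x. V (x(s := c s)))"
      by (rule known.equal) (simp add: clip_base)
    moreover have "known D m ?U ?F"
    proof (rule known.integrate)
      show "known D m ?U (\<omega> s)" using Suc.prems(3) by simp
      show "((\<lambda>t. ?F (x(s := t))) has_real_derivative \<omega> s x) (at (x s))" if "x \<in> ?U" for x
        by (rule coord_integral_partial_self[OF cont that s])
      show "x(s := t) \<in> ?U" if "x \<in> ?U" "t \<in> closed_segment (c s) (x s)" for x t
        using that s
        by (intro cube_fun_upd[OF that(1) s])
          (auto simp: closed_segment_eq_real_ivl cube_def split: if_splits)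
    qed (use s in \<open>auto simp: coord_integral_def\<close>)
    ultimately show "known D m ?U (\<lambda>x. V (x(s := c s)) + ?F x)" by (rule known.sum)
    have "continuous_on ?U (\<lambda>x. V (x(s := c s)))"
    proof (rule continuous_on_compose2[OF V(2)])
      show "continuous_on ?U (\<lambda>x. x(s := c s))"
        by (intro continuous_on_fun_upd continuous_on_coord continuous_on_const)
    qed (use base in blast)
    then show "continuous_on ?U (\<lambda>x. V (x(s := c s)) + ?F x)"
      by (intro continuous_on_add continuous_on_coord_integral[OF cont s])
    fix k x assume k: "k < Suc s" and x: "x \<in> ?U"
    show "((\<lambda>t. V ((x(k := t))(s := c s)) + ?F (x(k := t))) has_real_derivative \<omega> k x) (at (x k))"
    proof (cases "k = s")
      case True
      then show ?thesis
        using DERIV_add[OF DERIV_const coord_integral_partial_self[OF cont x s]] by simp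
    next
      case False
      then have ks: "k < s" "k < m" using k s by auto
      have "((\<lambda>t. V ((x(s := c s))(k := t))) has_real_derivative \<omega> k (x(s := c s))) (at ((x(s := c s)) k))"
        by (rule V(3)[OF ks(1) base[OF x]])
      then have 1: "((\<lambda>t. V ((x(k := t))(s := c s))) has_real_derivative \<omega> k (x(s := c s))) (at (x k))"
        using False by (simp add: fun_upd_twist)
      have sm: "smooth_on m ?U (partial s (\<omega> k))"
        using smooth k s by (intro smooth_on_partial) auto
      have "((\<lambda>t. ?F (x(k := t))) has_real_derivative coord_integral c s (partial s (\<omega> k)) x) (at (x k))"
      proof (rule coord_integral_partial_other[OF cont smooth_on_continuous_on[OF sm] _ x s ks(2) False])
        show "((\<lambda>t. \<omega> s (z(k := t))) has_real_derivative partial s (\<omega> k) z) (at (z k))"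
          if "z \<in> ?U" for z
          using smooth_on_has_partial[OF smooth[OF lessI] that ks(2)]
          unfolding closed[OF k lessI that] .
      qed
      moreover have "coord_integral c s (partial s (\<omega> k)) x = \<omega> k x - \<omega> k (x(s := c s))"
        by (rule coord_integral_eq[OF x s \<delta> smooth_on_has_partial[OF smooth[OF k] _ s]])
      ultimately have "((\<lambda>t. ?F (x(k := t))) has_real_derivative \<omega> k x - \<omega> k (x(s := c s))) (at (x k))"
        by (simp only:)
      from DERIV_add[OF 1 this] show ?thesis by simp
    qed
  qed
qed

section \<open>Nondegeneracy of contact forms\<close>

definition null_vector :: "nat \<Rightarrow> (nat \<Rightarrow> real) \<Rightarrow> nat \<Rightarrow> (nat list \<Rightarrow> real) \<Rightarrow> bool" where
  "null_vector m v p \<alpha> \<longleftrightarrow> (\<forall>is a. length is = p \<longrightarrow> set is \<subseteq> {..<m} \<longrightarrow> a < p \<longrightarrow>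
     (\<Sum>i<m. v i * \<alpha> (is[a := i])) = 0)"

lemma permute_list_update:
  assumes \<pi>: "\<pi> permutes {..<length xs}" and b: "b < length xs"
  shows "permute_list \<pi> (xs[\<pi> b := x]) = (permute_list \<pi> xs)[b := x]"
proof (rule nth_equalityI)
  fix i assume "i < length (permute_list \<pi> (xs[\<pi> b := x]))"
  then have i: "i < length xs" by simp
  have "\<pi> i < length xs" using permutes_in_image[OF \<pi>] i by auto
  moreover have "\<pi> i = \<pi> b \<longleftrightarrow> i = b" using permutes_inj[OF \<pi>] by (auto dest: injD)
  ultimately show "permute_list \<pi> (xs[\<pi> b := x]) ! i = (permute_list \<pi> xs)[b := x] ! i"
    using \<pi> i by (cases "i = b") (simp_all add: permute_list_nth)
qed simp

text \<open>In each summand of the wedge product, the entry that is replaced goes to exactly one of the two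
  factors, and that factor vanishes after the summation over the entry.\<close>

lemma null_vector_wedge:
  assumes \<alpha>: "null_vector m v p \<alpha>" and \<beta>: "null_vector m v q \<beta>"
  shows "null_vector m v (p + q) (wedge p q \<alpha> \<beta>)"
  unfolding null_vector_def
proof (intro allI impI)
  fix "is" :: "nat list" and a
  assume len: "length is = p + q" and set: "set is \<subseteq> {..<m}" and a: "a < p + q"
  let ?t = "\<lambda>\<pi> is. \<alpha> (take p (permute_list \<pi> is)) * \<beta> (drop p (permute_list \<pi> is))"
  have zero: "(\<Sum>i<m. v i * ?t \<pi> (is[a := i])) = 0" if \<pi>: "\<pi> permutes {..<p + q}" for \<pi>
  proof -
    define b where "b = inv_into UNIV \<pi> a"
    have b: "b < p + q" and pb: "\<pi> b = a"
      using permutes_in_image[OF permutes_inv[OF \<pi>], of a] a permutes_inverses(1)[OF \<pi>]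
      by (auto simp: b_def)
    define ys where "ys = permute_list \<pi> is"
    have upd: "permute_list \<pi> (is[a := i]) = ys[b := i]" for i
      using permute_list_update[of \<pi> "is" b i] \<pi> b len by (simp add: pb ys_def)
    have ys: "length ys = p + q" "set ys \<subseteq> {..<m}"
      using set \<pi> len by (simp_all add: ys_def)
    have take_drop: "set (take p ys) \<subseteq> {..<m}" "set (drop p ys) \<subseteq> {..<m}"
      using ys(2) set_take_subset[of p ys] set_drop_subset[of p ys] by auto
    show ?thesis
    proof (cases "b < p")
      case True
      have "(\<Sum>i<m. v i * \<alpha> ((take p ys)[b := i])) = 0"
        using \<alpha> ys(1) take_drop(1) True unfolding null_vector_def by simp
      then have "(\<Sum>i<m. v i * \<alpha> ((take p ys)[b := i])) * \<beta> (drop p ys) = 0" by simp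
      then show ?thesis
        unfolding upd sum_distrib_right using True
        by (simp add: take_update_swap mult.assoc)
    next
      case False
      have "(\<Sum>i<m. v i * \<beta> ((drop p ys)[b - p := i])) = 0"
        using \<beta> ys(1) take_drop(2) b False unfolding null_vector_def by simp
      then have "(\<Sum>i<m. v i * \<beta> ((drop p ys)[b - p := i])) * \<alpha> (take p ys) = 0" by simp
      then show ?thesis
        unfolding upd sum_distrib_right using False
        by (simp add: drop_update_swap mult.assoc mult.commute mult.left_commute)
    qed
  qed
  have "(\<Sum>i<m. v i * wedge p q \<alpha> \<beta> (is[a := i])) =
    (\<Sum>i<m. \<Sum>\<pi> | \<pi> permutes {..<p + q}. of_int (sign \<pi>) * (v i * ?t \<pi> (is[a := i]))) / (fact p * fact q)"
    unfolding wedge_def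
    by (simp add: sum_divide_distrib sum_distrib_left mult.assoc mult.left_commute)
  also have "\<dots> = (\<Sum>\<pi> | \<pi> permutes {..<p + q}. of_int (sign \<pi>) * (\<Sum>i<m. v i * ?t \<pi> (is[a := i]))) / (fact p * fact q)"
    by (subst sum.swap) (simp add: sum_distrib_left)
  also have "\<dots> = 0" using zero by simp
  finally show "(\<Sum>i<m. v i * wedge p q \<alpha> \<beta> (is[a := i])) = 0" .
qed

lemma null_vector_wedge_power:
  assumes "null_vector m v p \<alpha>"
  shows "null_vector m v (n * p) (wedge_power p \<alpha> n)"
proof (induction n)
  case 0
  show ?case by (simp add: null_vector_def)
next
  case (Suc n)
  show ?case using null_vector_wedge[OF assms Suc.IH] by simp
qed

text \<open>Composing the permutations with the exchange of the two equal entries changes their signs and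
  nothing else in the sum, so the sum equals its negative.\<close>

lemma wedge_repeated_index:
  assumes len: "length is = p + q" and ab: "a < p + q" "b < p + q" "a \<noteq> b" "is ! a = is ! b"
  shows "wedge p q \<alpha> \<beta> is = 0"
proof -
  let ?n = "{..<p + q}"
  let ?\<tau> = "Transposition.transpose a b"
  let ?t = "\<lambda>\<pi>. of_int (sign \<pi>) *
    \<alpha> (take p (permute_list \<pi> is)) * \<beta> (drop p (permute_list \<pi> is))"
  have \<tau>: "?\<tau> permutes ?n" using ab by (intro permutes_swap_id) auto
  have "(\<Sum>\<pi> | \<pi> permutes ?n. ?t \<pi>) = (\<Sum>\<pi> | \<pi> permutes ?n. ?t (?\<tau> \<circ> \<pi>))"
    by (rule setum_permutations_compose_left[OF \<tau>])
  also have "\<dots> = (\<Sum>\<pi> | \<pi> permutes ?n. - ?t \<pi>)"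
  proof (rule sum.cong[OF refl])
    fix \<pi> assume "\<pi> \<in> {\<pi>. \<pi> permutes ?n}"
    then have \<pi>: "\<pi> permutes ?n" by simp
    have "is ! ?\<tau> j = is ! j" for j using ab(4) by (simp add: Transposition.transpose_def)
    then have "permute_list (?\<tau> \<circ> \<pi>) is = permute_list \<pi> is"
      by (simp add: permute_list_def)
    moreover have "sign (?\<tau> \<circ> \<pi>) = - sign \<pi>"
      using \<pi> \<tau> ab(3) by (subst sign_compose) (auto simp: sign_swap_id permutation_permutes)
    ultimately show "?t (?\<tau> \<circ> \<pi>) = - ?t \<pi>" by simp
  qed
  finally have "(\<Sum>\<pi> | \<pi> permutes ?n. ?t \<pi>) = 0" by (simp add: sum_negf)
  then show ?thesis unfolding wedge_def by simp
qed

text \<open>The volume form kills \<open>v\<close> in each of its arguments.  Its only nonzero components have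
  pairwise distinct indices; so replacing the one index \<open>k\<close> by \<open>v\<close> leaves just the term with
  \<open>v k\<close>.\<close>

lemma contact_nondegenerate:
  assumes "contact_manifold M \<eta>" and c: "c \<in> atlas M" and p: "p \<in> fst c"
    and d\<eta>: "\<And>j. j < mdim M \<Longrightarrow> (\<Sum>i<mdim M. v i * ext_deriv \<eta> c p i j) = 0"
    and \<eta>: "(\<Sum>i<mdim M. v i * \<eta> c p i) = 0"
    and k: "k < mdim M"
  shows "v k = 0"
proof -
  obtain n "is" where m: "mdim M = 2 * n + 1" and "is": "length is = 2 * n + 1" "set is \<subseteq> {..<2 * n + 1}"
    and vol: "contact_volume n \<eta> c p is \<noteq> 0"
    using assms(1) c p unfolding contact_manifold_def by blast
  let ?m = "mdim M"
  let ?vol = "contact_volume n \<eta> c p"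
  have "null_vector ?m v 2 (\<lambda>is. ext_deriv \<eta> c p (is ! 0) (is ! 1))"
    unfolding null_vector_def
  proof (intro allI impI)
    fix "is" :: "nat list" and a :: nat
    assume len: "length is = 2" and set: "set is \<subseteq> {..<?m}" and a: "a < 2"
    obtain i j where ij: "is = [i, j]"
      using len by (auto simp: numeral_2_eq_2 length_Suc_conv)
    then have "i < ?m" "j < ?m" using set by auto
    have anti: "ext_deriv \<eta> c p i l = - ext_deriv \<eta> c p l i" for l by (simp add: ext_deriv_def)
    consider "a = 0" | "a = 1" using a by linarith
    then show "(\<Sum>l<?m. v l * ext_deriv \<eta> c p (is[a := l] ! 0) (is[a := l] ! 1)) = 0"
    proof cases
      case 1
      then show ?thesis using d\<eta>[OF \<open>j < ?m\<close>] by (simp add: ij)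
    next
      case 2
      then show ?thesis using d\<eta>[OF \<open>i < ?m\<close>] by (simp add: ij anti sum_negf)
    qed
  qed
  then have "null_vector ?m v (n * 2) (wedge_power 2 (\<lambda>is. ext_deriv \<eta> c p (is ! 0) (is ! 1)) n)"
    by (rule null_vector_wedge_power)
  moreover have "null_vector ?m v 1 (\<lambda>is. \<eta> c p (is ! 0))"
    using \<eta> unfolding null_vector_def by simp
  ultimately have null: "null_vector ?m v (2 * n + 1) ?vol"
    unfolding contact_volume_def mult.commute[of n 2] by (rule null_vector_wedge)
  have rep: "?vol js = 0" if "length js = 2 * n + 1" "\<not> distinct js" for js
    using that unfolding contact_volume_def distinct_conv_nth
    by (auto intro: wedge_repeated_index)
  have dist: "distinct is" using rep "is"(1) vol by blast
  then have "set is = {..<?m}"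
    using "is" m by (intro card_subset_eq) (auto simp: distinct_card)
  then obtain a where a: "a < length is" "is ! a = k"
    using k by (metis in_set_conv_nth lessThan_iff)
  have "(\<Sum>i<?m. v i * ?vol (is[a := i])) = 0"
    using null a(1) "is" m unfolding null_vector_def by auto
  moreover have "v i * ?vol (is[a := i]) = (if i = k then v k * ?vol is else 0)" if "i < ?m" for i
  proof (cases "i = k")
    case True
    then have "is[a := i] = is" using a(2) list_update_id by metis
    then show ?thesis using True by simp
  next
    case False
    have "i \<in> set is" using \<open>set is = {..<?m}\<close> that by simp
    then obtain b where b: "b < length is" "is ! b = i" by (auto simp: in_set_conv_nth)
    then have "a \<noteq> b" using False a by blast
    moreover have "is[a := i] ! a = is[a := i] ! b"
      using a(1) b \<open>a \<noteq> b\<close> by simp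
    ultimately have "\<not> distinct (is[a := i])"
      using a(1) b(1) nth_eq_iff_index_eq by (metis length_list_update)
    then show ?thesis using rep False "is"(1) by simp
  qed
  ultimately have "v k * ?vol is = 0" using k by simp
  then show ?thesis using vol by simp
qed

section \<open>Left inverses of injective matrices\<close>

text \<open>Induction on the number of the forms \<open>b j\<close>: if \<open>e\<close> does not vanish on the common kernel \<open>K\<close> of all
  but the last, subtracting a multiple of the last makes it vanish at one vector of \<open>K\<close> outside
  the last kernel, hence on all of \<open>K\<close>.\<close>

lemma linear_form_in_span:
  fixes b :: "nat \<Rightarrow> nat \<Rightarrow> real"
  assumes "\<And>v. (\<And>j. j < r \<Longrightarrow> (\<Sum>k<s. b j k * v k) = 0) \<Longrightarrow> (\<Sum>k<s. e k * v k) = 0"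
  shows "\<exists>a. \<forall>k<s. e k = (\<Sum>j<r. a j * b j k)"
  using assms
proof (induction r arbitrary: e)
  case 0
  have "e k = 0" if "k < s" for k
    using 0[of "\<lambda>l. if l = k then 1 else 0"] that by (simp add: if_distrib cong: if_cong)
  then show ?case by simp
next
  case (Suc r)
  let ?ap = "\<lambda>f v. \<Sum>k<s. f k * (v k :: real)"
  show ?case
  proof (cases "\<forall>v. (\<forall>j<r. ?ap (b j) v = 0) \<longrightarrow> ?ap e v = 0")
    case True
    then obtain a where "\<forall>k<s. e k = (\<Sum>j<r. a j * b j k)" using Suc.IH[of e] by blast
    then show ?thesis by (intro exI[of _ "a(r := 0)"]) simp
  next
    case False
    then obtain v where v: "\<And>j. j < r \<Longrightarrow> ?ap (b j) v = 0" "?ap e v \<noteq> 0" by blast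
    then have bv: "?ap (b r) v \<noteq> 0" using Suc.prems[of v] less_Suc_eq by metis
    define t where "t = ?ap e v / ?ap (b r) v"
    have "?ap (\<lambda>k. e k - t * b r k) w = 0" if w: "\<And>j. j < r \<Longrightarrow> ?ap (b j) w = 0" for w
    proof -
      define u where "u = ?ap (b r) w / ?ap (b r) v"
      have lin: "?ap f (\<lambda>k. w k - u * v k) = ?ap f w - u * ?ap f v" for f
        by (simp add: right_diff_distrib sum_subtractf sum_distrib_left mult.left_commute)
      have "?ap (b j) (\<lambda>k. w k - u * v k) = 0" if "j < Suc r" for j
        using that w[of j] v(1)[of j] bv unfolding lin by (cases "j = r") (auto simp: u_def)
      then have "?ap e w - u * ?ap e v = 0" using Suc.prems lin by metis
      moreover have "?ap (\<lambda>k. e k - t * b r k) w = ?ap e w - t * ?ap (b r) w"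
        by (simp add: left_diff_distrib sum_subtractf sum_distrib_left mult.assoc)
      moreover have "t * ?ap (b r) w = u * ?ap e v" by (simp add: t_def u_def)
      ultimately show ?thesis by simp
    qed
    then obtain a where "\<forall>k<s. e k - t * b r k = (\<Sum>j<r. a j * b j k)"
      using Suc.IH[of "\<lambda>k. e k - t * b r k"] by blast
    then have "\<forall>k<s. e k = (\<Sum>j<Suc r. (a(r := t)) j * b j k)" by (auto simp: algebra_simps)
    then show ?thesis by blast
  qed
qed

lemma injective_matrix_left_inverse:
  fixes b :: "nat \<Rightarrow> nat \<Rightarrow> real"
  assumes "\<And>v k. (\<And>j. j < r \<Longrightarrow> (\<Sum>k<s. b j k * v k) = 0) \<Longrightarrow> k < s \<Longrightarrow> v k = 0"
  obtains a where "\<And>i k. i < s \<Longrightarrow> k < s \<Longrightarrow> (\<Sum>j<r. a i j * b j k) = (if k = i then 1 else 0)"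
proof -
  have "\<exists>a. \<forall>k<s. (if k = i then 1 else 0) = (\<Sum>j<r. a j * b j k)" if i: "i < s" for i
  proof (rule linear_form_in_span)
    fix v assume "\<And>j. j < r \<Longrightarrow> (\<Sum>k<s. b j k * v k) = 0"
    then have "v i = 0" using assms i by blast
    moreover have "(\<Sum>k<s. (if k = i then 1 else 0) * v k) = (\<Sum>k<s. if k = i then v i else 0)"
      by (rule sum.cong) auto
    ultimately show "(\<Sum>k<s. (if k = i then 1 else 0) * v k) = 0" by simp
  qed
  then obtain a where "\<And>i. i < s \<Longrightarrow> \<forall>k<s. (if k = i then 1 else 0) = (\<Sum>j<r. a i j * b j k)"
    by metis
  then show ?thesis by (intro that[of a]) auto
qed

section \<open>Rectifying coordinates\<close>

text \<open>Entries within \<open>1 / (2 (s + 1))\<close> of those of the identity make the difference from the identity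
  at most a half in the operator norm for the sum norm.\<close>

lemma near_identity_matrix_bound:
  fixes A :: "nat \<Rightarrow> nat \<Rightarrow> real" and w :: "nat \<Rightarrow> real"
  assumes "\<And>i k. i < s \<Longrightarrow> k < s \<Longrightarrow> \<bar>A i k - (if k = i then 1 else 0)\<bar> \<le> 1 / (2 * (real s + 1))"
  shows "(\<Sum>k<s. \<bar>w k\<bar>) \<le> 2 * (\<Sum>i<s. \<bar>\<Sum>k<s. A i k * w k\<bar>)"
proof -
  let ?\<kappa> = "1 / (2 * (real s + 1))"
  let ?n = "\<Sum>k<s. \<bar>w k\<bar>"
  have "\<bar>w i\<bar> \<le> \<bar>\<Sum>k<s. A i k * w k\<bar> + ?\<kappa> * ?n" if i: "i < s" for i
  proof -
    have "(\<Sum>k<s. A i k * w k) - (\<Sum>k<s. (A i k - (if k = i then 1 else 0)) * w k)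
        = (\<Sum>k<s. if k = i then w i else 0)"
      unfolding sum_subtractf[symmetric] by (rule sum.cong) (auto simp: algebra_simps)
    then have "w i = (\<Sum>k<s. A i k * w k) - (\<Sum>k<s. (A i k - (if k = i then 1 else 0)) * w k)"
      using i by simp
    moreover have "\<bar>\<Sum>k<s. (A i k - (if k = i then 1 else 0)) * w k\<bar> \<le> (\<Sum>k<s. ?\<kappa> * \<bar>w k\<bar>)"
    proof (rule order_trans[OF sum_abs], rule sum_mono)
      show "\<bar>(A i k - (if k = i then 1 else 0)) * w k\<bar> \<le> ?\<kappa> * \<bar>w k\<bar>" if "k \<in> {..<s}" for k
        unfolding abs_mult by (rule mult_right_mono[OF assms[OF i]]) (use that in auto)
    qed
    ultimately show ?thesis by (simp add: sum_distrib_left)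
  qed
  then have "?n \<le> (\<Sum>i<s. \<bar>\<Sum>k<s. A i k * w k\<bar> + ?\<kappa> * ?n)"
    by (intro sum_mono) auto
  also have "\<dots> = (\<Sum>i<s. \<bar>\<Sum>k<s. A i k * w k\<bar>) + real s * ?\<kappa> * ?n"
    by (simp add: sum.distrib)
  also have "real s * ?\<kappa> * ?n \<le> 1 / 2 * ?n"
    by (intro mult_right_mono sum_nonneg) (auto simp: field_simps)
  finally show ?thesis by simp
qed

text \<open>A map that fixes the coordinates from \<open>s\<close> on and whose partial derivatives in the first \<open>s\<close>
  directions are close to those of the identity.  The fixed coordinates act as parameters:
  injectivity is decided by the derivatives in the first \<open>s\<close> directions.\<close>

locale near_identity_map =
  fixes m s :: nat and U :: "(nat \<Rightarrow> real) set" and c :: "nat \<Rightarrow> real" and \<delta> :: real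
    and G :: "(nat \<Rightarrow> real) \<Rightarrow> nat \<Rightarrow> real" and \<psi> :: "nat \<Rightarrow> nat \<Rightarrow> (nat \<Rightarrow> real) \<Rightarrow> real"
  assumes sm: "s \<le> m" and U: "U = cube m c \<delta>"
    and G_parameter: "\<And>i x. i \<ge> s \<Longrightarrow> G x i = x i"
    and G_continuous: "\<And>i. i < s \<Longrightarrow> continuous_on U (\<lambda>x. G x i)"
    and G_partial: "\<And>i k x. i < s \<Longrightarrow> k < s \<Longrightarrow> x \<in> U \<Longrightarrow>
      ((\<lambda>t. G (x(k := t)) i) has_real_derivative \<psi> i k x) (at (x k))"
    and \<psi>_continuous: "\<And>i k. i < s \<Longrightarrow> k < s \<Longrightarrow> continuous_on U (\<psi> i k)"
    and \<psi>_near_identity: "\<And>i k x. i < s \<Longrightarrow> k < s \<Longrightarrow> x \<in> U \<Longrightarrow>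
      \<bar>\<psi> i k x - (if k = i then 1 else 0)\<bar> \<le> 1 / (2 * (real s + 1))"
begin

lemma open_U: "openin (Euclidean_space m) U"
  by (simp add: U openin_cube)

lemma U_subset: "U \<subseteq> topspace (Euclidean_space m)"
  by (simp add: U cube_subset_topspace)

lemma inj_on_G: "inj_on G U"
proof (rule inj_onI)
  fix x y assume x: "x \<in> U" and y: "y \<in> U" and eq: "G x = G y"
  have par: "x j = y j" if "j \<ge> s" for j using G_parameter[OF that] eq by metis
  have "\<exists>\<zeta>. (\<forall>k<s. \<forall>j. \<zeta> k j \<in> closed_segment (x j) (y j)) \<and>
     G y i - G x i = (\<Sum>k<s. \<psi> i k (\<zeta> k) * (y k - x k))" if i: "i < s" for i
  proof (rule coordinatewise_mvt[OF par])
    fix z k assume z: "\<And>j. z j \<in> closed_segment (x j) (y j)" and k: "k < s"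
    have "z \<in> U" using cube_segment x y z unfolding U by blast
    then show "((\<lambda>t. G (z(k := t)) i) has_real_derivative \<psi> i k z) (at (z k))"
      by (rule G_partial[OF i k])
  qed
  then obtain \<zeta> where \<zeta>: "\<And>i k j. i < s \<Longrightarrow> k < s \<Longrightarrow> \<zeta> i k j \<in> closed_segment (x j) (y j)"
     "\<And>i. i < s \<Longrightarrow> G y i - G x i = (\<Sum>k<s. \<psi> i k (\<zeta> i k) * (y k - x k))"
    by metis
  have in_U: "\<zeta> i k \<in> U" if "i < s" "k < s" for i k
    using cube_segment[OF x[unfolded U] y[unfolded U] \<zeta>(1)[OF that]] by (simp add: U)
  have "(\<Sum>k<s. \<bar>y k - x k\<bar>) \<le> 2 * (\<Sum>i<s. \<bar>\<Sum>k<s. \<psi> i k (\<zeta> i k) * (y k - x k)\<bar>)"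
    using \<psi>_near_identity in_U by (intro near_identity_matrix_bound) blast
  also have "\<dots> = 0" using \<zeta>(2) eq by simp
  finally have "(\<Sum>k<s. \<bar>y k - x k\<bar>) = 0"
    by (intro antisym sum_nonneg) auto
  then have "y k = x k" if "k < s" for k using that by (simp add: sum_nonneg_eq_0_iff)
  then show "x = y" using par by (metis ext not_less)
qed

lemma G_continuous_all: "continuous_on U (\<lambda>x. G x i)"
  using G_continuous G_parameter continuous_on_coord by (cases "i < s") auto

lemma G_in_topspace: "x \<in> U \<Longrightarrow> G x \<in> topspace (Euclidean_space m)"
  using U_subset G_parameter sm by (auto simp: topspace_Euclidean_space)

lemma continuous_map_G:
  "continuous_map (subtopology (Euclidean_space m) U) (Euclidean_space m) G"
  using G_continuous_all G_in_topspace
  by (auto simp: continuous_map_into_Euclidean_space[OF U_subset])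

text \<open>Invariance of domain plays the role of the inverse function theorem: continuity and injectivity of
  \<open>G\<close> give an open image and a continuous inverse.\<close>

lemma open_image_G: "openin (Euclidean_space m) (G ` U)"
  using invariance_of_domain_Euclidean_space[OF open_U continuous_map_G inj_on_G] .

definition K where "K = inv_into U G"

lemma K_in: "y \<in> G ` U \<Longrightarrow> K y \<in> U" and G_K: "y \<in> G ` U \<Longrightarrow> G (K y) = y"
  by (auto simp: K_def inv_into_into f_inv_into_f)

lemma K_G: "x \<in> U \<Longrightarrow> K (G x) = x"
  by (simp add: K_def inj_on_G)

lemma continuous_map_K:
  "continuous_map (subtopology (Euclidean_space m) (G ` U)) (subtopology (Euclidean_space m) U) K"
proof -
  have top: "topspace (subtopology (Euclidean_space m) U) = U" using U_subset by auto
  have "embedding_map (subtopology (Euclidean_space m) U) (Euclidean_space m) G"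
    by (rule invariance_of_domain_Euclidean_space_embedding_map[OF open_U continuous_map_G inj_on_G])
  then have "homeomorphic_map (subtopology (Euclidean_space m) U) (subtopology (Euclidean_space m) (G ` U)) G"
    unfolding embedding_map_def top .
  then obtain K' where K': "homeomorphic_maps (subtopology (Euclidean_space m) U)
      (subtopology (Euclidean_space m) (G ` U)) G K'"
    using homeomorphic_map_maps by blast
  have "K' y = K y" if "y \<in> topspace (subtopology (Euclidean_space m) (G ` U))" for y
  proof -
    have "y \<in> G ` U" using that by simp
    then obtain x where x: "x \<in> U" "y = G x" by blast
    have "K' (G x) = x" using K' x(1) unfolding homeomorphic_maps_def top by blast
    then show ?thesis using x K_G by simp
  qed
  then show ?thesis
    using K' unfolding homeomorphic_maps_def by (blast intro: continuous_map_eq)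
qed

lemma G_immersion:
  assumes x: "x \<in> U" and v: "\<And>j. j < m \<Longrightarrow> (\<Sum>i<m. partial i (\<lambda>x. G x j) x * v i) = 0"
  shows "\<forall>i<m. v i = 0"
proof -
  have high: "v j = 0" if j: "s \<le> j" "j < m" for j
  proof -
    have "partial i (\<lambda>x. G x j) x = (if i = j then 1 else 0)" for i
      using G_parameter[OF j(1)] by (intro partial_eq) auto
    then have "(\<Sum>i<m. partial i (\<lambda>x. G x j) x * v i) = (\<Sum>i<m. if i = j then v j else 0)"
      by (intro sum.cong) auto
    then show ?thesis using v[OF j(2)] j(2) by simp
  qed
  have "(\<Sum>k<s. \<psi> j k x * v k) = 0" if j: "j < s" for j
  proof -
    have "(\<Sum>i<m. partial i (\<lambda>x. G x j) x * v i) = (\<Sum>i<s. partial i (\<lambda>x. G x j) x * v i)"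
      using sm high by (intro sum.mono_neutral_right) auto
    also have "\<dots> = (\<Sum>k<s. \<psi> j k x * v k)"
      using partial_eq[OF G_partial[OF j _ x]] by (intro sum.cong) auto
    finally show ?thesis using v[of j] j sm by simp
  qed
  then have "(\<Sum>k<s. \<bar>v k\<bar>) \<le> 2 * (\<Sum>i<s. 0)"
    using near_identity_matrix_bound[of s "\<lambda>i k. \<psi> i k x" v] \<psi>_near_identity x by simp
  then have "(\<Sum>k<s. \<bar>v k\<bar>) = 0"
    by (intro antisym sum_nonneg) auto
  then have "v k = 0" if "k < s" for k using that by (simp add: sum_nonneg_eq_0_iff)
  then show ?thesis using high not_less by blast
qed

text \<open>If \<open>G\<close> moves along a straight line in the first \<open>s\<close> coordinates with the velocity that \<open>Y\<close>
  has in the coordinates \<open>G\<close>, then the point moves with velocity \<open>Y\<close>.  The mean value theorem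
  expresses the difference quotients of \<open>G\<close> along the curve by those of the point, with a matrix that
  tends to the Jacobian of \<open>G\<close>; as this matrix stays near the identity, the difference quotients of
  the point converge.\<close>

lemma derivative_of_curve:
  assumes J: "open J" "t \<in> J" and y: "\<And>\<tau>. \<tau> \<in> J \<Longrightarrow> y \<tau> \<in> U"
    and y_cont: "\<And>k. k < m \<Longrightarrow> ((\<lambda>\<tau>. y \<tau> k) \<longlongrightarrow> y t k) (at t)"
    and G_y: "\<And>\<tau> i. \<tau> \<in> J \<Longrightarrow> i < s \<Longrightarrow> G (y \<tau>) i - G (y t) i = (\<tau> - t) * C i"
    and y_parameter: "\<And>\<tau> i. \<tau> \<in> J \<Longrightarrow> i \<ge> s \<Longrightarrow> y \<tau> i = y t i"
    and Y: "\<And>i. i < s \<Longrightarrow> (\<Sum>k<s. \<psi> i k (y t) * Y k) = C i"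
    and i: "i < s"
  shows "((\<lambda>\<tau>. y \<tau> i) has_real_derivative Y i) (at t)"
proof -
  have J_ev: "\<forall>\<^sub>F \<tau> in at t. \<tau> \<in> J \<and> \<tau> \<noteq> t"
    using eventually_at_topological J by blast
  have yt: "y t \<in> U" using y J by blast
  define Q where "Q i \<zeta> \<longleftrightarrow>
      (\<forall>k<s. ((\<lambda>\<tau>. \<psi> i k (\<zeta> \<tau> k)) \<longlongrightarrow> \<psi> i k (y t)) (at t)) \<and> (\<forall>\<^sub>F \<tau> in at t.
      (\<forall>k<s. \<forall>j. \<zeta> \<tau> k j \<in> closed_segment (y t j) (y \<tau> j)) \<and>
      G (y \<tau>) i - G (y t) i = (\<Sum>k<s. \<psi> i k (\<zeta> \<tau> k) * (y \<tau> k - y t k)))" for i \<zeta>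
  have "\<exists>\<zeta>. Q i \<zeta>" if i: "i < s" for i
    unfolding Q_def
  proof (rule increment_coefficients[OF open_U yt G_partial[OF i] \<psi>_continuous[OF i] _ y_cont])
    show "\<forall>\<^sub>F \<tau> in at t. y \<tau> \<in> topspace (Euclidean_space m)"
      using J_ev by eventually_elim (use y U_subset in blast)
    show "\<forall>\<^sub>F \<tau> in at t. \<forall>j\<ge>s. y \<tau> j = y t j"
      using J_ev by eventually_elim (use y_parameter in blast)
  qed
  then obtain \<zeta> where "\<And>i. i < s \<Longrightarrow> Q i (\<zeta> i)" by metis
  then have \<zeta>: "\<And>i k. i < s \<Longrightarrow> k < s \<Longrightarrow> ((\<lambda>\<tau>. \<psi> i k (\<zeta> i \<tau> k)) \<longlongrightarrow> \<psi> i k (y t)) (at t)"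
    "\<And>i. i < s \<Longrightarrow> \<forall>\<^sub>F \<tau> in at t.
      (\<forall>k<s. \<forall>j. \<zeta> i \<tau> k j \<in> closed_segment (y t j) (y \<tau> j)) \<and>
      G (y \<tau>) i - G (y t) i = (\<Sum>k<s. \<psi> i k (\<zeta> i \<tau> k) * (y \<tau> k - y t k))"
    unfolding Q_def by auto
  have all: "\<forall>\<^sub>F \<tau> in at t. \<forall>i\<in>{..<s}.
      (\<forall>k<s. \<forall>j. \<zeta> i \<tau> k j \<in> closed_segment (y t j) (y \<tau> j)) \<and>
      G (y \<tau>) i - G (y t) i = (\<Sum>k<s. \<psi> i k (\<zeta> i \<tau> k) * (y \<tau> k - y t k))"
    using \<zeta>(2) by (intro eventually_ball_finite) auto
  let ?w = "\<lambda>\<tau> k. (y \<tau> k - y t k) / (\<tau> - t) - Y k"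
  let ?e = "\<lambda>\<tau>. 2 * (\<Sum>i<s. \<bar>\<Sum>k<s. (\<psi> i k (y t) - \<psi> i k (\<zeta> i \<tau> k)) * Y k\<bar>)"
  have bound: "\<forall>\<^sub>F \<tau> in at t. norm (?w \<tau> i) \<le> ?e \<tau>"
    using all J_ev
  proof eventually_elim
    case (elim \<tau>)
    have \<tau>: "\<tau> \<in> J" "\<tau> \<noteq> t" using elim by auto
    have in_U: "\<zeta> i \<tau> k \<in> U" if "i < s" "k < s" for i k
      using cube_segment[OF yt[unfolded U] y[OF \<tau>(1), unfolded U], of "\<zeta> i \<tau> k"] elim(1) that
      by (simp add: U)
    have "(\<Sum>k<s. \<psi> i k (\<zeta> i \<tau> k) * ?w \<tau> k) = (\<Sum>k<s. (\<psi> i k (y t) - \<psi> i k (\<zeta> i \<tau> k)) * Y k)"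
      if i: "i < s" for i
    proof -
      have "(\<Sum>k<s. \<psi> i k (\<zeta> i \<tau> k) * ((y \<tau> k - y t k) / (\<tau> - t)))
          = (\<Sum>k<s. \<psi> i k (\<zeta> i \<tau> k) * (y \<tau> k - y t k)) / (\<tau> - t)"
        by (simp add: sum_divide_distrib)
      also have "\<dots> = (G (y \<tau>) i - G (y t) i) / (\<tau> - t)" using elim(1) i by simp
      also have "\<dots> = (\<Sum>k<s. \<psi> i k (y t) * Y k)" using G_y[OF \<tau>(1) i] \<tau>(2) Y[OF i] by simp
      finally show ?thesis by (simp add: right_diff_distrib left_diff_distrib sum_subtractf)
    qed
    then have "(\<Sum>k<s. \<bar>?w \<tau> k\<bar>) \<le> ?e \<tau>"
      using near_identity_matrix_bound[of s "\<lambda>i k. \<psi> i k (\<zeta> i \<tau> k)" "?w \<tau>"]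
        \<psi>_near_identity in_U by simp
    moreover have "\<bar>?w \<tau> i\<bar> \<le> (\<Sum>k<s. \<bar>?w \<tau> k\<bar>)"
      using i by (intro member_le_sum) auto
    ultimately show ?case by (simp only: real_norm_def)
  qed
  have "(?e \<longlongrightarrow> 2 * (\<Sum>i<s. \<bar>\<Sum>k<s. (\<psi> i k (y t) - \<psi> i k (y t)) * Y k\<bar>)) (at t)"
    using \<zeta>(1) by (intro tendsto_intros) auto
  then have "(?e \<longlongrightarrow> 0) (at t)" by simp
  with bound have "((\<lambda>\<tau>. ?w \<tau> i) \<longlongrightarrow> 0) (at t)" by (rule Lim_null_comparison)
  then show ?thesis unfolding has_field_derivative_iff by (subst Lim_null)
qed

end

lemma continuous_map_Euclidean_space_of_coords:
  assumes "S \<subseteq> topspace (Euclidean_space k)" "\<And>i. i < l \<Longrightarrow> continuous_on S (\<lambda>x. f x i)"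
    and "\<And>x. x \<in> S \<Longrightarrow> f x \<in> topspace (Euclidean_space l)"
  shows "continuous_map (subtopology (Euclidean_space k) S) (Euclidean_space l) f"
  unfolding continuous_map_into_Euclidean_space[OF assms(1)]
proof (intro conjI allI image_subsetI assms(3))
  fix i
  show "continuous_on S (\<lambda>x. f x i)"
  proof (cases "i < l")
    case False
    then have "f x i = 0" if "x \<in> S" for x
      using assms(3)[OF that] by (simp add: topspace_Euclidean_space)
    then show ?thesis by (simp cong: continuous_on_cong)
  qed (rule assms(2))
qed

lemma cube_Suc_iff:
  assumes "x \<in> topspace (Euclidean_space m)"
  shows "z \<in> cube (m + 1) x \<rho> \<longleftrightarrow> z \<in> topspace (Euclidean_space (m + 1)) \<and> clip m z \<in> cube m x \<rho> \<and> \<bar>z m\<bar> < \<rho>"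
proof -
  have "x m = 0" using assms by (simp add: topspace_Euclidean_space)
  then show ?thesis
    by (auto simp: cube_def clip_def topspace_Euclidean_space less_Suc_eq)
qed

lemma uniform_cube:
  assumes U: "openin (Euclidean_space m) U" and x: "x \<in> U" and \<delta>: "\<delta> > 0"
    and near: "\<And>i k. i < s \<Longrightarrow> k < s \<Longrightarrow> continuous_on U (\<psi> i k)" and e: "e > 0"
  obtains \<delta>' where "\<delta>' > 0" "\<delta>' \<le> \<delta>"
    "\<And>i k y. i < (s::nat) \<Longrightarrow> k < (s::nat) \<Longrightarrow> y \<in> cube m x \<delta>' \<Longrightarrow> \<bar>\<psi> i k y - \<psi> i k x :: real\<bar> < e"
proof -
  have "\<exists>d>0. \<forall>y\<in>cube m x d. \<bar>\<psi> i k y - \<psi> i k x\<bar> < e" if "i < s" "k < s" for i k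
    using continuous_on_cubeE[OF U near[OF that] x e] by metis
  then obtain d where d: "\<And>i k. i < s \<Longrightarrow> k < s \<Longrightarrow> d i k > 0"
    "\<And>i k y. i < s \<Longrightarrow> k < s \<Longrightarrow> y \<in> cube m x (d i k) \<Longrightarrow> \<bar>\<psi> i k y - \<psi> i k x\<bar> < e"
    by metis
  let ?S = "insert \<delta> ((\<lambda>(i, k). d i k) ` ({..<s} \<times> {..<s}))"
  show ?thesis
  proof (rule that[of "Min ?S"])
    show "Min ?S > 0" using \<delta> d(1) by auto
    show "Min ?S \<le> \<delta>" by simp
    fix i k y assume ik: "i < s" "k < s" and y: "y \<in> cube m x (Min ?S)"
    have "Min ?S \<le> d i k" using ik by (intro Min_le) auto
    then have "y \<in> cube m x (d i k)" using y cube_mono by blast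
    then show "\<bar>\<psi> i k y - \<psi> i k x\<bar> < e" by (rule d(2)[OF ik])
  qed
qed

text \<open>Suppose that functions \<open>f j\<close> change at rates \<open>c j\<close> along the vector field \<open>Y\<close> on the first
  \<open>s\<close> coordinates, that these rates depend on the parameters alone, and that the \<open>f j\<close> together
  immerse the first \<open>s\<close> coordinates.  Then \<open>s\<close> combinations of them with constant coefficients
  form, with the parameters, coordinates in which \<open>Y\<close> is constant on each parameter slice; inverting
  these coordinates gives the flow.  A left inverse of the Jacobian at the centre provides
  the coefficients.\<close>

lemma flow_by_rectification:
  fixes f c :: "nat \<Rightarrow> (nat \<Rightarrow> real) \<Rightarrow> real"
  assumes sm: "s \<le> m" and x0: "x0 \<in> topspace (Euclidean_space m)" and \<delta>: "\<delta> > 0"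
    and f_cont: "\<And>j. j < r \<Longrightarrow> continuous_on (cube m x0 \<delta>) (f j)"
    and f_known: "\<And>j. j < r \<Longrightarrow> known D m (cube m x0 \<delta>) (f j)"
    and f_partial: "\<And>j k x. j < r \<Longrightarrow> k < s \<Longrightarrow> x \<in> cube m x0 \<delta> \<Longrightarrow>
      ((\<lambda>t. f j (x(k := t))) has_real_derivative \<phi> j k x) (at (x k))"
    and \<phi>_cont: "\<And>j k. j < r \<Longrightarrow> k < s \<Longrightarrow> continuous_on (cube m x0 \<delta>) (\<phi> j k)"
    and inj: "\<And>v k. (\<And>j. j < r \<Longrightarrow> (\<Sum>k<s. \<phi> j k x0 * v k) = 0) \<Longrightarrow> k < s \<Longrightarrow> v k = 0"
    and c_cont: "\<And>j. j < r \<Longrightarrow> continuous_on (cube m x0 \<delta>) (c j)"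
    and c_known: "\<And>j. j < r \<Longrightarrow> known D m (cube m x0 \<delta>) (c j)"
    and c_parameter: "\<And>j x y. j < r \<Longrightarrow> x \<in> cube m x0 \<delta> \<Longrightarrow> y \<in> cube m x0 \<delta> \<Longrightarrow>
      (\<And>i. i \<ge> s \<Longrightarrow> x i = y i) \<Longrightarrow> c j x = c j y"
    and Y: "\<And>j x. j < r \<Longrightarrow> x \<in> cube m x0 \<delta> \<Longrightarrow> (\<Sum>k<s. \<phi> j k x * Y k x) = c j x"
  obtains \<rho> u where "\<rho> > 0" "\<rho> \<le> \<delta>"
    "\<And>x t. x \<in> cube m x0 \<rho> \<Longrightarrow> \<bar>t\<bar> < \<rho> \<Longrightarrow> u x t \<in> cube m x0 \<delta>"
    "\<And>x. x \<in> cube m x0 \<rho> \<Longrightarrow> u x 0 = x"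
    "\<And>x t i. x \<in> cube m x0 \<rho> \<Longrightarrow> \<bar>t\<bar> < \<rho> \<Longrightarrow> i < s \<Longrightarrow>
       ((\<lambda>t. u x t i) has_real_derivative Y i (u x t)) (at t)"
    "\<And>x t i. x \<in> cube m x0 \<rho> \<Longrightarrow> \<bar>t\<bar> < \<rho> \<Longrightarrow> i \<ge> s \<Longrightarrow> u x t i = x i"
    "\<And>i. i < m \<Longrightarrow> known D (m + 1) (cube (m + 1) x0 \<rho>) (\<lambda>z. u (clip m z) (z m) i)"
proof -
  \<comment> \<open>normalizes the combinations \<open>G\<close> below to have the identity as Jacobian in the first \<open>s\<close>
    directions at \<open>x0\<close>\<close>
  obtain a where a: "\<And>i k. i < s \<Longrightarrow> k < s \<Longrightarrow> (\<Sum>j<r. a i j * \<phi> j k x0) = (if k = i then 1 else 0)"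
  proof (rule injective_matrix_left_inverse[where b = "\<lambda>j k. \<phi> j k x0" and r = r and s = s])
    show "v k = 0" if "\<And>j. j < r \<Longrightarrow> (\<Sum>k<s. \<phi> j k x0 * v k) = 0" "k < s" for v k
      by (rule inj[OF that])
  qed (rule that)
  define \<psi> where "\<psi> i k x = (\<Sum>j<r. a i j * \<phi> j k x)" for i k x
  define G where "G x i = (if i < s then \<Sum>j<r. a i j * f j x else x i)" for x i
  have \<psi>_cont: "continuous_on (cube m x0 \<delta>) (\<psi> i k)" if "k < s" for i k
    unfolding \<psi>_def by (intro continuous_on_sum continuous_on_mult continuous_on_const \<phi>_cont that) auto
  have "0 < 1 / (2 * (real s + 1))" by simp
  then obtain \<delta>1 where \<delta>1: "\<delta>1 > 0" "\<delta>1 \<le> \<delta>" and \<psi>_near: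
    "\<And>i k y. i < s \<Longrightarrow> k < s \<Longrightarrow> y \<in> cube m x0 \<delta>1 \<Longrightarrow> \<bar>\<psi> i k y - \<psi> i k x0\<bar> < 1 / (2 * (real s + 1))"
    using uniform_cube[OF openin_cube centre_in_cube[OF x0 \<delta>] \<delta>, of s \<psi>] \<psi>_cont by metis
  define U where "U = cube m x0 \<delta>1"
  have U_\<delta>: "U \<subseteq> cube m x0 \<delta>" unfolding U_def by (rule cube_mono[OF \<delta>1(2)])
  have x0U: "x0 \<in> U" unfolding U_def by (rule centre_in_cube[OF x0 \<delta>1(1)])
  interpret near_identity_map m s U x0 \<delta>1 G \<psi>
  proof
    show "s \<le> m" "U = cube m x0 \<delta>1" by (fact sm U_def)+
    show "G x i = x i" if "i \<ge> s" for i x using that by (simp add: G_def)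
    show "continuous_on U (\<lambda>x. G x i)" if "i < s" for i
      using that unfolding G_def
      by (auto intro!: continuous_intros continuous_on_subset[OF f_cont U_\<delta>])
    show "((\<lambda>t. G (x(k := t)) i) has_real_derivative \<psi> i k x) (at (x k))"
      if i: "i < s" and k: "k < s" and x: "x \<in> U" for i k x
    proof -
      have "((\<lambda>t. \<Sum>j<r. a i j * f j (x(k := t))) has_real_derivative \<psi> i k x) (at (x k))"
        unfolding \<psi>_def using x U_\<delta> by (intro DERIV_sum DERIV_cmult f_partial k) auto
      then show ?thesis using i by (simp only: G_def if_True)
    qed
    show "continuous_on U (\<psi> i k)" if "i < s" "k < s" for i k
      by (rule continuous_on_subset[OF \<psi>_cont[OF that(2)] U_\<delta>])
    show "\<bar>\<psi> i k x - (if k = i then 1 else 0)\<bar> \<le> 1 / (2 * (real s + 1))"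
      if "i < s" "k < s" "x \<in> U" for i k x
    proof -
      have "\<psi> i k x0 = (if k = i then 1 else 0)" unfolding \<psi>_def by (rule a[OF that(1,2)])
      then show ?thesis using \<psi>_near[OF that(1,2), of x] that(3) unfolding U_def by linarith
    qed
  qed
  define C where "C x i = (if i < s then \<Sum>j<r. a i j * c j x else 0)" for x i
  have C_cont: "continuous_on U (\<lambda>x. C x i)" for i
    by (cases "i < s")
      (auto simp: C_def intro!: continuous_intros continuous_on_subset[OF c_cont U_\<delta>])
  have C_known: "known D m U (\<lambda>x. C x i)" for i
  proof (cases "i < s")
    case True
    have "known D m U (\<lambda>x. \<Sum>j<r. a i j * c j x)"
      by (intro known_sum_lessThan[OF open_U] known.product known.const[OF open_U]
          known.restriction[OF c_known open_U U_\<delta>])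
    then show ?thesis using True by (simp add: C_def)
  qed (use known.const[OF open_U] in \<open>simp add: C_def\<close>)
  have G_known: "known D m U (\<lambda>x. G x i)" if "i < m" for i
  proof (cases "i < s")
    case True
    have "known D m U (\<lambda>x. \<Sum>j<r. a i j * f j x)"
      by (intro known_sum_lessThan[OF open_U] known.product known.const[OF open_U]
          known.restriction[OF f_known open_U U_\<delta>])
    then show ?thesis using True by (simp add: G_def)
  qed (use known.coord[OF open_U that] in \<open>simp add: G_def\<close>)
  define h where "h z = (\<lambda>i. G (clip m z) i + z m * C (clip m z) i)" for z
  have h_top: "h z \<in> topspace (Euclidean_space m)" for z
    using sm by (auto simp: h_def G_def C_def clip_def topspace_Euclidean_space)
  let ?E1 = "Euclidean_space (m + 1)"
  define B where "B = cube (m + 1) x0 \<delta>1"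
  have B_top: "B \<subseteq> topspace ?E1" unfolding B_def by (rule cube_subset_topspace)
  have B_open: "openin ?E1 B" unfolding B_def by (rule openin_cube)
  have clip_B: "clip m z \<in> U" if "z \<in> B" for z
    using that unfolding B_def U_def cube_Suc_iff[OF x0] by simp
  have clip_cont: "continuous_on S (\<lambda>z :: nat \<Rightarrow> real. clip m z)" for S
    by (rule continuous_on_clip) (rule continuous_on_coord)
  have "continuous_map (subtopology ?E1 B) (Euclidean_space m) h"
  proof (rule continuous_map_Euclidean_space_of_coords[OF B_top _ h_top])
    fix i assume "i < m"
    show "continuous_on B (\<lambda>z. h z i)"
      unfolding h_def
      by (intro continuous_on_add continuous_on_mult continuous_on_coord
          continuous_on_compose2[OF G_continuous_all clip_cont]
          continuous_on_compose2[OF C_cont clip_cont]) (use clip_B in auto)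
  qed
  note h_cont = this
  \<comment> \<open>for initial points near \<open>x0\<close> and small times, the straight line stays in the image of \<open>G\<close>\<close>
  have "openin (subtopology ?E1 B) {z \<in> topspace (subtopology ?E1 B). h z \<in> G ` U}"
    by (rule openin_continuous_map_preimage[OF h_cont open_image_G])
  moreover have "topspace (subtopology ?E1 B) = B" using B_top by auto
  ultimately have open_pre: "openin ?E1 {z \<in> B. h z \<in> G ` U}"
    using openin_trans_full[OF _ B_open] by (simp only:)
  have x0m: "x0 m = 0" "clip m x0 = x0" "x0 \<in> topspace ?E1"
    using x0 clip_ident by (auto simp: topspace_Euclidean_space)
  have "h x0 = G x0" using x0m by (simp add: h_def)
  then have "x0 \<in> {z \<in> B. h z \<in> G ` U}"
    using x0U centre_in_cube[OF x0m(3) \<delta>1(1)] by (simp add: B_def)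
  then obtain \<rho>0 where \<rho>0: "\<rho>0 > 0" "cube (m + 1) x0 \<rho>0 \<subseteq> {z \<in> B. h z \<in> G ` U}"
    by (rule openin_cubeE[OF open_pre])
  define \<rho> where "\<rho> = min \<rho>0 \<delta>1"
  define Z where "Z = cube (m + 1) x0 \<rho>"
  have \<rho>: "\<rho> > 0" "\<rho> \<le> \<delta>1" using \<rho>0(1) \<delta>1(1) by (auto simp: \<rho>_def)
  have "Z \<subseteq> cube (m + 1) x0 \<rho>0" unfolding Z_def by (rule cube_mono) (simp add: \<rho>_def)
  then have Z: "Z \<subseteq> B" "\<And>z. z \<in> Z \<Longrightarrow> h z \<in> G ` U" using \<rho>0(2) by auto
  have Z_open: "openin ?E1 Z" unfolding Z_def by (rule openin_cube)
  define u where "u x t = K (\<lambda>i. G x i + t * C x i)" for x t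
  have u_h: "u (clip m z) (z m) = K (h z)" for z by (simp add: u_def h_def)
  \<comment> \<open>the point of \<open>Z\<close> that stands for the initial position \<open>x\<close> and the time \<open>t\<close>\<close>
  define pt where "pt x t = x(m := t)" for x :: "nat \<Rightarrow> real" and t
  have pt: "pt x t \<in> Z" "clip m (pt x t) = x" "pt x t m = t"
    if "x \<in> cube m x0 \<rho>" "\<bar>t\<bar> < \<rho>" for x t
  proof -
    show 1: "clip m (pt x t) = x" "pt x t m = t"
      using that by (auto simp: pt_def clip_def cube_def)
    have "pt x t \<in> topspace ?E1" using that by (auto simp: pt_def cube_def topspace_Euclidean_space)
    then show "pt x t \<in> Z" using 1 that unfolding Z_def cube_Suc_iff[OF x0] by simp
  qed
  have cube_U: "x \<in> U" if "x \<in> cube m x0 \<rho>" for x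
    using that cube_mono[OF \<rho>(2)] by (auto simp: U_def)
  have u_in: "u x t \<in> U" and G_u: "G (u x t) i = G x i + t * C x i"
    if "x \<in> cube m x0 \<rho>" "\<bar>t\<bar> < \<rho>" for x t i
  proof -
    have "(\<lambda>i. G x i + t * C x i) = h (pt x t)" using pt[OF that] by (simp add: h_def)
    then have *: "(\<lambda>i. G x i + t * C x i) \<in> G ` U" using Z(2) pt(1)[OF that] by simp
    show "u x t \<in> U" unfolding u_def by (rule K_in[OF *])
    show "G (u x t) i = G x i + t * C x i" unfolding u_def G_K[OF *] ..
  qed
  have u_par: "u x t i = x i" if "x \<in> cube m x0 \<rho>" "\<bar>t\<bar> < \<rho>" "i \<ge> s" for x t i
    using G_u[OF that(1,2), of i] that(3) by (simp add: G_def C_def)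
  have Kh_cont: "continuous_map (subtopology ?E1 Z) (subtopology (Euclidean_space m) U) (\<lambda>z. K (h z))"
  proof -
    have "continuous_map (subtopology ?E1 Z) (Euclidean_space m) h"
      by (rule continuous_map_from_subtopology_mono[OF h_cont Z(1)])
    then have "continuous_map (subtopology ?E1 Z) (subtopology (Euclidean_space m) (G ` U)) h"
      using Z(2) by (auto simp: continuous_map_in_subtopology)
    from continuous_map_compose[OF this continuous_map_K] show ?thesis by (simp add: o_def)
  qed
  show thesis
  proof (rule that[of \<rho> u])
    show "\<rho> > 0" "\<rho> \<le> \<delta>" using \<rho> \<delta>1 by auto
    show "u x t \<in> cube m x0 \<delta>" if "x \<in> cube m x0 \<rho>" "\<bar>t\<bar> < \<rho>" for x t
      using u_in[OF that] U_\<delta> by blast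
    show "u x 0 = x" if "x \<in> cube m x0 \<rho>" for x
      using K_G[OF cube_U[OF that]] by (simp add: u_def)
    show "u x t i = x i" if "x \<in> cube m x0 \<rho>" "\<bar>t\<bar> < \<rho>" "i \<ge> s" for x t i
      by (rule u_par[OF that])
    show "((\<lambda>t. u x t i) has_real_derivative Y i (u x t)) (at t)"
      if x: "x \<in> cube m x0 \<rho>" and t: "\<bar>t\<bar> < \<rho>" and i: "i < s" for x t i
    proof (rule derivative_of_curve[where J = "{-\<rho><..<\<rho>}" and C = "C x" and Y = "\<lambda>k. Y k (u x t)"])
      have J: "\<tau> \<in> {-\<rho><..<\<rho>} \<longleftrightarrow> \<bar>\<tau>\<bar> < \<rho>" for \<tau> by auto
      show "open {-\<rho><..<\<rho>}" "t \<in> {-\<rho><..<\<rho>}" using t by auto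
      show "u x \<tau> \<in> U" if "\<tau> \<in> {-\<rho><..<\<rho>}" for \<tau> using u_in[OF x] that J by blast
      show "u x \<tau> i = u x t i" if "\<tau> \<in> {-\<rho><..<\<rho>}" "i \<ge> s" for \<tau> i
        using u_par[OF x] that J t by metis
      show "G (u x \<tau>) i - G (u x t) i = (\<tau> - t) * C x i" if "\<tau> \<in> {-\<rho><..<\<rho>}" "i < s" for \<tau> i
      proof -
        have "\<bar>\<tau>\<bar> < \<rho>" using that J by blast
        then show ?thesis unfolding G_u[OF x t] G_u[OF x \<open>\<bar>\<tau>\<bar> < \<rho>\<close>] by (simp add: algebra_simps)
      qed
      show "(\<Sum>k<s. \<psi> i k (u x t) * Y k (u x t)) = C x i" if i: "i < s" for i
      proof -
        have ut: "u x t \<in> cube m x0 \<delta>" and xd: "x \<in> cube m x0 \<delta>"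
          using u_in[OF x t] cube_U[OF x] U_\<delta> by auto
        have "(\<Sum>k<s. \<psi> i k (u x t) * Y k (u x t)) = (\<Sum>j<r. a i j * (\<Sum>k<s. \<phi> j k (u x t) * Y k (u x t)))"
          unfolding \<psi>_def sum_distrib_right sum_distrib_left mult.assoc by (rule sum.swap)
        also have "\<dots> = (\<Sum>j<r. a i j * c j x)"
        proof (intro sum.cong refl arg_cong2[where f = "(*)"])
          fix j assume "j \<in> {..<r}"
          then have "(\<Sum>k<s. \<phi> j k (u x t) * Y k (u x t)) = c j (u x t)" using Y ut by simp
          also have "\<dots> = c j x"
            using c_parameter[OF _ ut xd] u_par[OF x t] \<open>j \<in> {..<r}\<close> by simp
          finally show "(\<Sum>k<s. \<phi> j k (u x t) * Y k (u x t)) = c j x" .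
        qed
        finally show ?thesis using i by (simp add: C_def)
      qed
      show "((\<lambda>\<tau>. u x \<tau> k) \<longlongrightarrow> u x t k) (at t)" if "k < m" for k
      proof -
        have "continuous_map (subtopology ?E1 Z) (Euclidean_space m) (\<lambda>z. K (h z))"
          using Kh_cont by (simp add: continuous_map_in_subtopology)
        then have Kh: "continuous_on Z (\<lambda>z. K (h z) k)"
          unfolding continuous_map_into_Euclidean_space[OF openin_subset[OF Z_open]]
          by (elim conjE) (rule spec)
        have "continuous_on {-\<rho><..<\<rho>} (\<lambda>\<tau>. pt x \<tau>)"
          unfolding pt_def by (intro continuous_on_fun_upd continuous_on_const continuous_on_id)
        then have "continuous_on {-\<rho><..<\<rho>} (\<lambda>\<tau>. K (h (pt x \<tau>)) k)"
        proof (rule continuous_on_compose2[OF Kh])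
          show "pt x ` {-\<rho><..<\<rho>} \<subseteq> Z" by (rule image_subsetI) (rule pt(1)[OF x], simp only: J)
        qed
        then have "continuous_on {-\<rho><..<\<rho>} (\<lambda>\<tau>. u x \<tau> k)"
        proof (rule continuous_on_eq)
          show "K (h (pt x \<tau>)) k = u x \<tau> k" if "\<tau> \<in> {-\<rho><..<\<rho>}" for \<tau>
          using u_h[of "pt x \<tau>"] unfolding pt(2,3)[OF x that[unfolded J]] by simp
        qed
        then have "isCont (\<lambda>\<tau>. u x \<tau> k) t"
          by (rule continuous_on_interior) (use t in \<open>simp add: J[unfolded greaterThanLessThan_iff]\<close>)
        then show ?thesis by (simp add: isCont_def)
      qed
      show "i < s" by (fact i)
    qed
    show "known D (m + 1) (cube (m + 1) x0 \<rho>) (\<lambda>z. u (clip m z) (z m) i)" if i: "i < m" for i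
      unfolding u_h Z_def[symmetric]
    proof (rule known.solve[OF open_U G_known _ _ Z_open _ Kh_cont _ i, where h = "\<lambda>j z. h z j"])
      have "clip m (G x) = G x" if "x \<in> U" for x
        by (rule clip_ident[OF G_in_topspace[OF that]])
      then show "inj_on (\<lambda>x. clip m (\<lambda>j. G x j)) U"
        using inj_on_G by (simp add: inj_on_def)
      show "\<forall>i<m. v i = 0" if "x \<in> U" "\<And>j. j < m \<Longrightarrow> (\<Sum>i<m. partial i (\<lambda>x. G x j) x * v i) = 0"
        for x v by (rule G_immersion[OF that])
      show "G (K (h z)) j = h z j" if "z \<in> Z" for z j
        using G_K[OF Z(2)[OF that]] by simp
      fix j assume j: "j < m"
      have sub: "known D (m + 1) Z (\<lambda>z. F (clip m z))" if "known D m U F" for F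
      proof -
        have "known D (m + 1) Z (\<lambda>z. F (clip m (\<lambda>i. z i)))"
          using Z(1) clip_B
          by (intro known.substitution[OF that Z_open] known.coord[OF Z_open]) auto
        then show ?thesis .
      qed
      show "known D (m + 1) Z (\<lambda>z. h z j)"
        unfolding h_def
        by (intro known.sum known.product sub G_known j C_known known.coord[OF Z_open]) simp
    qed
  qed
qed

section \<open>The Hamilton-Jacobi equation in coordinates\<close>

text \<open>\<open>S\<close> represents the complete solution, in coordinates of which the first \<open>s\<close> are those of the
  base and the others those of the parameter space, and \<open>T\<close> is its inverse.  On the parameter
  slices, \<open>Y\<close> represents the vector field \<open>X\<close>, as the Hamilton-Jacobi equation says that \<open>X\<close> is
  tangent to their images.\<close>

locale HJ_coordinates =
  fixes D :: "local_function set" and m s :: nat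
    and A B C :: "(nat \<Rightarrow> real) set"
    and S T \<eta> :: "nat \<Rightarrow> (nat \<Rightarrow> real) \<Rightarrow> real" and H :: "(nat \<Rightarrow> real) \<Rightarrow> real"
    and X :: "(nat \<Rightarrow> real) \<Rightarrow> nat \<Rightarrow> real" and Y :: "nat \<Rightarrow> (nat \<Rightarrow> real) \<Rightarrow> real"
  assumes sm: "s \<le> m"
    and S_smooth: "\<And>i. i < m \<Longrightarrow> smooth_on m B (S i)"
    and S_known: "\<And>i. i < m \<Longrightarrow> known D m B (S i)"
    and T_smooth: "\<And>i. i < m \<Longrightarrow> smooth_on m C (T i)"
    and S_in: "\<And>x. x \<in> B \<Longrightarrow> clip m (\<lambda>i. S i x) \<in> C"
    and T_in: "\<And>y. y \<in> C \<Longrightarrow> clip m (\<lambda>i. T i y) \<in> B"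
    and T_S: "\<And>x. x \<in> B \<Longrightarrow> clip m (\<lambda>i. T i (clip m (\<lambda>i. S i x))) = x"
    and S_T: "\<And>y. y \<in> C \<Longrightarrow> clip m (\<lambda>i. S i (clip m (\<lambda>i. T i y))) = y"
    and B_open: "openin (Euclidean_space m) B" and C_open: "openin (Euclidean_space m) C"
    and A_open: "openin (Euclidean_space m) A" and C_A: "C \<subseteq> A"
    and \<eta>_smooth: "\<And>i. i < m \<Longrightarrow> smooth_on m A (\<eta> i)"
    and \<eta>_known: "\<And>i. i < m \<Longrightarrow> known D m A (\<eta> i)"
    and H_smooth: "smooth_on m A H"
    and H_known: "known D m A H"
    and HJE: "\<And>x i. x \<in> B \<Longrightarrow> i < m \<Longrightarrow>
      X (clip m (\<lambda>i. S i x)) i = (\<Sum>k<s. partial k (S i) x * Y k x)"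
    and isotropic: "\<And>x k l. x \<in> B \<Longrightarrow> k < s \<Longrightarrow> l < s \<Longrightarrow>
      (\<Sum>i<m. \<Sum>j<m. (partial i (\<eta> j) (clip m (\<lambda>i. S i x)) - partial j (\<eta> i) (clip m (\<lambda>i. S i x)))
         * partial k (S i) x * partial l (S j) x) = 0"
    and contraction: "\<And>y j. y \<in> A \<Longrightarrow> j < m \<Longrightarrow>
      (\<Sum>i<m. X y i * (partial i (\<eta> j) y - partial j (\<eta> i) y)) = - partial j H y"
    and pairing: "\<And>y. y \<in> A \<Longrightarrow> (\<Sum>i<m. \<eta> i y * X y i) = H y"
    and nondegenerate: "\<And>y v k. y \<in> A \<Longrightarrow>
      (\<And>j. j < m \<Longrightarrow> (\<Sum>i<m. v i * (partial i (\<eta> j) y - partial j (\<eta> i) y)) = 0) \<Longrightarrow>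
      (\<Sum>i<m. v i * \<eta> i y) = 0 \<Longrightarrow> k < m \<Longrightarrow> v k = 0"
begin

abbreviation Sv where "Sv x \<equiv> clip m (\<lambda>i. S i x)"
abbreviation Tv where "Tv y \<equiv> clip m (\<lambda>i. T i y)"

definition d\<eta> where "d\<eta> i j y = partial i (\<eta> j) y - partial j (\<eta> i) y"

text \<open>\<open>\<theta>\<close> and \<open>h\<close> are the pull-backs of \<open>\<eta>\<close> and \<open>H\<close> along \<open>S\<close>.\<close>

definition \<theta> where "\<theta> k x = (\<Sum>i<m. \<eta> i (Sv x) * partial k (S i) x)"
definition d\<theta> where "d\<theta> k l x = partial k (\<theta> l) x - partial l (\<theta> k) x"
definition h where "h x = H (Sv x)"

lemma S_in_A: "x \<in> B \<Longrightarrow> Sv x \<in> A"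
  using S_in C_A by blast

lemma smooth_pullback: "smooth_on m A f \<Longrightarrow> smooth_on m B (\<lambda>x. f (Sv x))"
  by (rule smooth_on_compose[OF B_open _ S_smooth S_in_A])

lemma known_pullback: "known D m A f \<Longrightarrow> known D m B (\<lambda>x. f (Sv x))"
  by (rule known.substitution[OF _ B_open S_known S_in_A])

lemma \<theta>_smooth: "k < m \<Longrightarrow> smooth_on m B (\<theta> k)"
  unfolding \<theta>_def
  by (rule smooth_on_sum[OF B_open smooth_on_mult[OF smooth_pullback[OF \<eta>_smooth] smooth_on_partial[OF S_smooth]]])

lemma \<theta>_known: "k < m \<Longrightarrow> known D m B (\<theta> k)"
  unfolding \<theta>_def
  by (rule known_sum_lessThan[OF B_open known.product[OF known_pullback[OF \<eta>_known]
          known.differentiation[OF S_known]]])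

lemma d\<theta>_smooth: "k < m \<Longrightarrow> l < m \<Longrightarrow> smooth_on m B (d\<theta> k l)"
  unfolding d\<theta>_def by (rule smooth_on_diff[OF smooth_on_partial[OF \<theta>_smooth] smooth_on_partial[OF \<theta>_smooth]])

lemma d\<theta>_known: "k < m \<Longrightarrow> l < m \<Longrightarrow> known D m B (d\<theta> k l)"
  unfolding d\<theta>_def
  by (rule known_diff[OF B_open known.differentiation[OF \<theta>_known] known.differentiation[OF \<theta>_known]])

lemma h_smooth: "smooth_on m B h"
  unfolding h_def by (rule smooth_pullback[OF H_smooth])

lemma h_known: "known D m B h"
  unfolding h_def by (rule known_pullback[OF H_known])

lemma partial_\<theta>:
  assumes x: "x \<in> B" and k: "k < m" and l: "l < m"
  shows "partial k (\<theta> l) x = (\<Sum>i<m. \<Sum>j<m. partial j (\<eta> i) (Sv x) * partial k (S j) x * partial l (S i) x)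
    + (\<Sum>i<m. \<eta> i (Sv x) * partial k (partial l (S i)) x)"
proof -
  have sm: "smooth_on m B (\<lambda>x. \<eta> i (Sv x))" "smooth_on m B (partial l (S i))" if "i < m" for i
    using smooth_pullback[OF \<eta>_smooth[OF that]] smooth_on_partial[OF S_smooth[OF that] l] by auto
  have "partial k (\<theta> l) x = (\<Sum>i<m. partial k (\<lambda>x. \<eta> i (Sv x) * partial l (S i) x) x)"
    unfolding \<theta>_def by (rule partial_sum[OF smooth_on_mult[OF sm] x k])
  also have "\<dots> = (\<Sum>i<m. partial k (\<lambda>x. \<eta> i (Sv x)) x * partial l (S i) x
      + \<eta> i (Sv x) * partial k (partial l (S i)) x)"
    by (rule sum.cong[OF refl], rule partial_mult[OF sm x k]) auto
  also have "\<dots> = (\<Sum>i<m. (\<Sum>j<m. partial j (\<eta> i) (Sv x) * partial k (S j) x) * partial l (S i) x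
      + \<eta> i (Sv x) * partial k (partial l (S i)) x)"
  proof (rule sum.cong[OF refl])
    fix i assume "i \<in> {..<m}"
    then have "partial k (\<lambda>x. \<eta> i (Sv x)) x = (\<Sum>j<m. partial j (\<eta> i) (Sv x) * partial k (S j) x)"
      by (intro partial_compose[OF \<eta>_smooth S_smooth S_in_A x k]) auto
    then show "partial k (\<lambda>x. \<eta> i (Sv x)) x * partial l (S i) x
        + \<eta> i (Sv x) * partial k (partial l (S i)) x =
      (\<Sum>j<m. partial j (\<eta> i) (Sv x) * partial k (S j) x) * partial l (S i) x
        + \<eta> i (Sv x) * partial k (partial l (S i)) x" by simp
  qed
  finally show ?thesis by (simp add: sum.distrib sum_distrib_right)
qed

text \<open>Pull-back commutes with the exterior derivative: the second partial derivatives of \<open>S\<close>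
  cancel by symmetry.\<close>

lemma d\<theta>_eq:
  assumes x: "x \<in> B" and k: "k < m" and l: "l < m"
  shows "d\<theta> k l x = (\<Sum>i<m. \<Sum>j<m. d\<eta> i j (Sv x) * partial k (S i) x * partial l (S j) x)"
proof -
  let ?Sk = "\<lambda>i. partial k (S i) x" and ?Sl = "\<lambda>i. partial l (S i) x"
  let ?\<eta> = "\<lambda>j i. partial j (\<eta> i) (Sv x)"
  have "(\<Sum>i<m. \<eta> i (Sv x) * partial k (partial l (S i)) x) =
        (\<Sum>i<m. \<eta> i (Sv x) * partial l (partial k (S i)) x)"
    using partial_commute[OF S_smooth x k l] by (intro sum.cong) auto
  then have "d\<theta> k l x = (\<Sum>i<m. \<Sum>j<m. ?\<eta> j i * ?Sk j * ?Sl i) - (\<Sum>i<m. \<Sum>j<m. ?\<eta> j i * ?Sl j * ?Sk i)"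
    unfolding d\<theta>_def partial_\<theta>[OF x k l] partial_\<theta>[OF x l k] by simp
  also have "(\<Sum>i<m. \<Sum>j<m. ?\<eta> j i * ?Sk j * ?Sl i) = (\<Sum>i<m. \<Sum>j<m. ?\<eta> i j * ?Sk i * ?Sl j)"
    by (rule sum.swap)
  also have "\<dots> - (\<Sum>i<m. \<Sum>j<m. ?\<eta> j i * ?Sl j * ?Sk i) =
      (\<Sum>i<m. \<Sum>j<m. (?\<eta> i j - ?\<eta> j i) * ?Sk i * ?Sl j)"
    unfolding sum_subtractf[symmetric] by (intro sum.cong refl) (simp add: algebra_simps)
  finally show ?thesis unfolding d\<eta>_def .
qed

lemma d\<theta>_contraction:
  assumes x: "x \<in> B" and l: "l < m"
  shows "(\<Sum>k<s. v k * d\<theta> k l x) =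
    (\<Sum>j<m. (\<Sum>i<m. (\<Sum>k<s. partial k (S i) x * v k) * d\<eta> i j (Sv x)) * partial l (S j) x)"
proof -
  have "(\<Sum>k<s. v k * d\<theta> k l x) =
    (\<Sum>k<s. \<Sum>i<m. \<Sum>j<m. partial k (S i) x * v k * d\<eta> i j (Sv x) * partial l (S j) x)"
    using d\<theta>_eq[OF x _ l] sm by (intro sum.cong refl) (simp add: sum_distrib_left algebra_simps)
  also have "\<dots> = (\<Sum>i<m. \<Sum>k<s. \<Sum>j<m. partial k (S i) x * v k * d\<eta> i j (Sv x) * partial l (S j) x)"
    by (rule sum.swap)
  also have "\<dots> = (\<Sum>i<m. \<Sum>j<m. \<Sum>k<s. partial k (S i) x * v k * d\<eta> i j (Sv x) * partial l (S j) x)"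
    by (intro sum.cong refl sum.swap)
  also have "\<dots> = (\<Sum>j<m. \<Sum>i<m. \<Sum>k<s. partial k (S i) x * v k * d\<eta> i j (Sv x) * partial l (S j) x)"
    by (rule sum.swap)
  also have "\<dots> = (\<Sum>j<m. (\<Sum>i<m. (\<Sum>k<s. partial k (S i) x * v k) * d\<eta> i j (Sv x)) * partial l (S j) x)"
    by (simp add: sum_distrib_right)
  finally show ?thesis .
qed

lemma d\<theta>_isotropic: "x \<in> B \<Longrightarrow> k < s \<Longrightarrow> l < s \<Longrightarrow> d\<theta> k l x = 0"
  using d\<theta>_eq isotropic sm unfolding d\<eta>_def by simp

text \<open>Pulled back along \<open>S\<close>, the two equations that define a contact field whose Hamiltonian is constant
  along the Reeb field.\<close>

lemma Y_d\<theta>: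
  assumes x: "x \<in> B" and l: "l < m"
  shows "(\<Sum>k<s. d\<theta> k l x * Y k x) = - partial l h x"
proof -
  have "(\<Sum>k<s. d\<theta> k l x * Y k x) = (\<Sum>k<s. Y k x * d\<theta> k l x)"
    by (simp add: mult.commute)
  also have "\<dots> = (\<Sum>j<m. (\<Sum>i<m. X (Sv x) i * d\<eta> i j (Sv x)) * partial l (S j) x)"
    unfolding d\<theta>_contraction[OF x l] using HJE[OF x] by (intro sum.cong refl arg_cong2[where f = "(*)"]) auto
  also have "\<dots> = (\<Sum>j<m. - partial j H (Sv x) * partial l (S j) x)"
    using contraction[OF S_in_A[OF x]] unfolding d\<eta>_def by (intro sum.cong refl) simp
  also have "\<dots> = - partial l h x"
    using partial_compose[where g = S, OF H_smooth S_smooth S_in_A x l]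
    unfolding h_def by (simp add: sum_negf)
  finally show ?thesis .
qed

lemma Y_\<theta>:
  assumes x: "x \<in> B"
  shows "(\<Sum>k<s. \<theta> k x * Y k x) = h x"
proof -
  have "(\<Sum>k<s. \<theta> k x * Y k x) = (\<Sum>k<s. \<Sum>i<m. \<eta> i (Sv x) * (partial k (S i) x * Y k x))"
    unfolding \<theta>_def by (simp add: sum_distrib_right mult.assoc)
  also have "\<dots> = (\<Sum>i<m. \<eta> i (Sv x) * (\<Sum>k<s. partial k (S i) x * Y k x))"
    by (subst sum.swap) (simp add: sum_distrib_left)
  also have "\<dots> = (\<Sum>i<m. \<eta> i (Sv x) * X (Sv x) i)"
    using HJE[OF x] by (intro sum.cong) auto
  finally show ?thesis using pairing[OF S_in_A[OF x]] by (simp add: h_def)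
qed

lemma partial_T_S:
  assumes x: "x \<in> B" and k: "k < m" and l: "l < m"
  shows "(\<Sum>i<m. partial i (T l) (Sv x) * partial k (S i) x) = (if k = l then 1 else 0)"
proof -
  have "(\<Sum>i<m. partial i (T l) (Sv x) * partial k (S i) x) = partial k (\<lambda>x. T l (Sv x)) x"
    by (rule partial_compose[OF T_smooth[OF l] S_smooth S_in x k, symmetric])
  also have "\<dots> = partial k (\<lambda>x. x l) x"
    using T_S l by (intro partial_cong[OF B_open x k]) (metis clip_nth)
  also have "\<dots> = (if k = l then 1 else 0)"
    by (intro partial_eq) auto
  finally show ?thesis .
qed

lemma partial_S_T:
  assumes y: "y \<in> C" and k: "k < m" and l: "l < m"
  shows "(\<Sum>i<m. partial i (S l) (Tv y) * partial k (T i) y) = (if k = l then 1 else 0)"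
proof -
  have "(\<Sum>i<m. partial i (S l) (Tv y) * partial k (T i) y) = partial k (\<lambda>y. S l (Tv y)) y"
    by (rule partial_compose[OF S_smooth[OF l] T_smooth T_in y k, symmetric])
  also have "\<dots> = partial k (\<lambda>y. y l) y"
    using S_T l by (intro partial_cong[OF C_open y k]) (metis clip_nth)
  also have "\<dots> = (if k = l then 1 else 0)"
    by (intro partial_eq) auto
  finally show ?thesis .
qed

lemma S_immersion:
  assumes x: "x \<in> B" and l: "l < m" and v: "\<And>i. i < m \<Longrightarrow> (\<Sum>k<m. partial k (S i) x * v k) = 0"
  shows "v l = 0"
proof -
  have "v l = (\<Sum>k<m. if k = l then v l else 0)" using l by simp
  also have "\<dots> = (\<Sum>k<m. (\<Sum>i<m. partial i (T l) (Sv x) * partial k (S i) x) * v k)"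
    using partial_T_S[OF x _ l] by (intro sum.cong) auto
  also have "\<dots> = (\<Sum>i<m. partial i (T l) (Sv x) * (\<Sum>k<m. partial k (S i) x * v k))"
    unfolding sum_distrib_left sum_distrib_right mult.assoc by (rule sum.swap)
  also have "\<dots> = 0" using v by simp
  finally show ?thesis .
qed

lemma S_submersion:
  assumes x: "x \<in> B" and k: "k < m" and \<mu>: "\<And>l. l < m \<Longrightarrow> (\<Sum>j<m. \<mu> j * partial l (S j) x) = 0"
  shows "\<mu> k = 0"
proof -
  have y: "Sv x \<in> C" "Tv (Sv x) = x" using S_in T_S x by auto
  have "\<mu> k = (\<Sum>j<m. if k = j then \<mu> k else 0)" using k by simp
  also have "\<dots> = (\<Sum>j<m. \<mu> j * (\<Sum>l<m. partial l (S j) x * partial k (T l) (Sv x)))"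
    using partial_S_T[OF y(1) k] unfolding y(2) by (intro sum.cong) auto
  also have "\<dots> = (\<Sum>l<m. (\<Sum>j<m. \<mu> j * partial l (S j) x) * partial k (T l) (Sv x))"
    unfolding sum_distrib_left sum_distrib_right mult.assoc by (rule sum.swap)
  also have "\<dots> = 0" using \<mu> by simp
  finally show ?thesis .
qed

text \<open>The form \<open>\<theta>\<close> and the contractions of \<open>d\<theta>\<close> with the parameter directions separate the
  tangent vectors of a slice: contraction with the directions of the slice vanishes by isotropy, so
  a vector on which all these forms vanish is in the kernels of both \<open>\<eta>\<close> and \<open>d\<eta>\<close>.\<close>

lemma slice_forms_separate:
  assumes x: "x \<in> B" and \<theta>: "(\<Sum>k<s. \<theta> k x * v k) = 0"
    and d\<theta>: "\<And>l. s \<le> l \<Longrightarrow> l < m \<Longrightarrow> (\<Sum>k<s. d\<theta> k l x * v k) = 0" and l: "l < s"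
  shows "v l = 0"
proof -
  define V where "V i = (\<Sum>k<s. partial k (S i) x * v k)" for i
  have "(\<Sum>j<m. (\<Sum>i<m. V i * d\<eta> i j (Sv x)) * partial l (S j) x) = 0" if l: "l < m" for l
  proof -
    have "(\<Sum>k<s. v k * d\<theta> k l x) = 0"
      using d\<theta>[of l] d\<theta>_isotropic[OF x _, of _ l] l
      by (cases "l < s") (simp_all add: mult.commute)
    then show ?thesis unfolding V_def d\<theta>_contraction[OF x l] .
  qed
  then have "(\<Sum>i<m. V i * d\<eta> i j (Sv x)) = 0" if "j < m" for j
    by (rule S_submersion[OF x that, where \<mu> = "\<lambda>j. \<Sum>i<m. V i * d\<eta> i j (Sv x)"])
  moreover have "(\<Sum>i<m. V i * \<eta> i (Sv x)) = (\<Sum>k<s. \<theta> k x * v k)"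
    unfolding V_def \<theta>_def sum_distrib_right
    by (subst sum.swap) (intro sum.cong refl, simp add: algebra_simps)
  ultimately have V: "V i = 0" if "i < m" for i
    using nondegenerate[OF S_in_A[OF x], of V i] \<theta> that unfolding d\<eta>_def by simp
  define w where "w k = (if k < s then v k else 0)" for k
  have "(\<Sum>k<m. partial k (S i) x * w k) = V i" for i
    unfolding V_def w_def using sm by (intro sum.mono_neutral_cong_right) auto
  then have "w l = 0" using S_immersion[OF x, of l w] V l sm by simp
  then show ?thesis using l by (simp add: w_def)
qed

text \<open>By isotropy, \<open>Y_d\<theta>\<close> says that \<open>h\<close> has no derivative along the slices.\<close>

lemma h_parameter:
  assumes cube: "cube m c \<delta> \<subseteq> B" and x: "x \<in> cube m c \<delta>" and y: "y \<in> cube m c \<delta>"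
    and par: "\<And>i. i \<ge> s \<Longrightarrow> x i = y i"
  shows "h x = h y"
proof -
  have "\<exists>\<zeta>. (\<forall>k<s. \<forall>j. \<zeta> k j \<in> closed_segment (x j) (y j)) \<and>
     h y - h x = (\<Sum>k<s. (\<lambda>k z. 0) k (\<zeta> k) * (y k - x k))"
  proof (rule coordinatewise_mvt[OF par])
    fix z k assume z: "\<And>j. z j \<in> closed_segment (x j) (y j)" and k: "k < s"
    have zB: "z \<in> B" using cube_segment[OF x y z] cube by blast
    have "partial k h z = 0"
      using Y_d\<theta>[OF zB, of k] d\<theta>_isotropic[OF zB _ k] k sm by simp
    then show "((\<lambda>t. h (z(k := t))) has_real_derivative 0) (at (z k))"
      using smooth_on_has_partial[OF h_smooth zB, of k] k sm by (simp only:)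
  qed
  then show ?thesis by auto
qed

lemma partial_h_parameter:
  assumes cube: "cube m c \<delta> \<subseteq> B" and x: "x \<in> cube m c \<delta>" and y: "y \<in> cube m c \<delta>"
    and par: "\<And>i. i \<ge> s \<Longrightarrow> x i = y i" and l: "s \<le> l" "l < m"
  shows "partial l h x = partial l h y"
proof -
  have "\<forall>\<^sub>F t in nhds (x l). x(l := t) \<in> cube m c \<delta>"
    by (rule eventually_fun_upd_in[OF openin_cube x l(2)])
  moreover have "\<forall>\<^sub>F t in nhds (x l). y(l := t) \<in> cube m c \<delta>"
    unfolding par[OF l(1)] by (rule eventually_fun_upd_in[OF openin_cube y l(2)])
  ultimately have "\<forall>\<^sub>F t in nhds (x l). h (x(l := t)) = h (y(l := t))"
  proof eventually_elim
    case (elim t)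
    show ?case by (rule h_parameter[OF cube elim]) (simp add: par)
  qed
  then show ?thesis unfolding partial_def using par[OF l(1)] by (intro deriv_cong_ev) auto
qed

lemma S_image_open:
  assumes V: "openin (Euclidean_space m) V" "V \<subseteq> B"
  shows "openin (Euclidean_space m) {y \<in> C. Tv y \<in> V}"
    and "continuous_map (subtopology (Euclidean_space m) {y \<in> C. Tv y \<in> V}) (subtopology (Euclidean_space m) V) (\<lambda>y. Tv y)"
proof -
  have C_top: "C \<subseteq> topspace (Euclidean_space m)" by (rule openin_subset[OF C_open])
  have cont: "continuous_map (subtopology (Euclidean_space m) C) (Euclidean_space m) (\<lambda>y. Tv y)"
  proof (rule continuous_map_Euclidean_space_of_coords[OF C_top _ clip_in_topspace])
    fix i assume "i < m"
    then show "continuous_on C (\<lambda>y. Tv y i)"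
      using smooth_on_continuous_on[OF T_smooth] by (simp add: clip_nth)
  qed
  have "openin (subtopology (Euclidean_space m) C) {y \<in> topspace (subtopology (Euclidean_space m) C). Tv y \<in> V}"
    by (rule openin_continuous_map_preimage[OF cont V(1)])
  moreover have "topspace (subtopology (Euclidean_space m) C) = C" using C_top by auto
  ultimately show "openin (Euclidean_space m) {y \<in> C. Tv y \<in> V}"
    using openin_trans_full[OF _ C_open] by (simp only:)
  have "continuous_map (subtopology (Euclidean_space m) {y \<in> C. Tv y \<in> V}) (Euclidean_space m) (\<lambda>y. Tv y)"
    by (rule continuous_map_from_subtopology_mono[OF cont]) auto
  then show "continuous_map (subtopology (Euclidean_space m) {y \<in> C. Tv y \<in> V}) (subtopology (Euclidean_space m) V) (\<lambda>y. Tv y)"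
    by (auto simp: continuous_map_in_subtopology)
qed

lemma T_known:
  assumes V: "openin (Euclidean_space m) V" "V \<subseteq> B" and i: "i < m"
  shows "known D m {y \<in> C. Tv y \<in> V} (T i)"
proof -
  let ?V' = "{y \<in> C. Tv y \<in> V}"
  have "known D m ?V' (\<lambda>y. Tv y i)"
  proof (rule known.solve[OF V(1) known.restriction[OF S_known V] _ _ S_image_open(1)[OF V] _
        S_image_open(2)[OF V] _ i, where h = "\<lambda>j y. y j"])
    show "inj_on (\<lambda>x. Sv x) V"
      by (rule inj_on_inverseI[where g = "\<lambda>y. Tv y"]) (use T_S V(2) in blast)
    show "\<forall>i<m. v i = 0" if "x \<in> V" "\<And>j. j < m \<Longrightarrow> (\<Sum>i<m. partial i (S j) x * v i) = 0" for x v
      using S_immersion[of x _ v] that V(2) by blast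
    show "known D m ?V' (\<lambda>y. y j)" if "j < m" for j
      by (rule known.coord[OF S_image_open(1)[OF V] that])
    show "S j (Tv y) = y j" if "y \<in> ?V'" "j < m" for y j
      using S_T[of y] that by (metis (mono_tags, lifting) clip_nth mem_Collect_eq)
  qed
  then show ?thesis by (rule known.equal) (simp add: clip_nth i)
qed

text \<open>The forms that are integrated along the slices, namely \<open>\<theta>\<close> and the contractions of \<open>d\<theta>\<close> with the
  parameter directions, and the rates at which \<open>Y\<close> changes their potentials.\<close>

definition quadrature_form :: "nat \<Rightarrow> nat \<Rightarrow> (nat \<Rightarrow> real) \<Rightarrow> real" where
  "quadrature_form j k = (case j of 0 \<Rightarrow> \<theta> k | Suc a \<Rightarrow> d\<theta> k (s + a))"

definition rate :: "nat \<Rightarrow> (nat \<Rightarrow> real) \<Rightarrow> real" where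
  "rate j = (case j of 0 \<Rightarrow> h | Suc a \<Rightarrow> (\<lambda>x. 0 - partial (s + a) h x))"

abbreviation "n_forms \<equiv> Suc (m - s)"

lemma quadrature_form_smooth: "j < n_forms \<Longrightarrow> k < s \<Longrightarrow> smooth_on m B (quadrature_form j k)"
  using sm \<theta>_smooth d\<theta>_smooth by (auto simp: quadrature_form_def split: nat.split)

lemma quadrature_form_known: "j < n_forms \<Longrightarrow> k < s \<Longrightarrow> known D m B (quadrature_form j k)"
  using sm \<theta>_known d\<theta>_known by (auto simp: quadrature_form_def split: nat.split)

lemma rate_smooth: "j < n_forms \<Longrightarrow> smooth_on m B (rate j)"
  using sm h_smooth smooth_on_diff[OF smooth_on_const[OF B_open] smooth_on_partial[OF h_smooth]]
  by (auto simp: rate_def simp del: diff_0 split: nat.split)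

lemma rate_known: "j < n_forms \<Longrightarrow> known D m B (rate j)"
  using sm h_known known_diff[OF B_open known.const[OF B_open] known.differentiation[OF h_known]]
  by (auto simp: rate_def simp del: diff_0 split: nat.split)

lemma rate_eq: "j < n_forms \<Longrightarrow> x \<in> B \<Longrightarrow> (\<Sum>k<s. quadrature_form j k x * Y k x) = rate j x"
  using Y_\<theta> Y_d\<theta> by (cases j) (simp_all add: quadrature_form_def rate_def)

text \<open>On the slices these forms are closed: the first because \<open>d\<theta>\<close> vanishes there, and the contractions
  because, by \<open>d d\<theta> = 0\<close>, their exterior derivative along the slices is up to sign the derivative
  of \<open>d\<theta>\<close> along a parameter, and so vanishes too.\<close>

lemma quadrature_form_closed:
  assumes j: "j < n_forms" and k: "k < s" and l: "l < s" and x: "x \<in> B"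
  shows "partial k (quadrature_form j l) x = partial l (quadrature_form j k) x"
proof (cases j)
  case 0
  then show ?thesis using d\<theta>_isotropic[OF x k l] by (simp add: quadrature_form_def d\<theta>_def)
next
  case (Suc a)
  define b where "b = s + a"
  have b: "b < m" using j Suc by (simp add: b_def)
  have km: "k < m" "l < m" using k l sm by auto
  note p = smooth_on_partial[OF \<theta>_smooth]
  have 0: "partial b (\<lambda>y. partial k (\<theta> l) y - partial l (\<theta> k) y) x = 0"
  proof -
    have "partial b (\<lambda>y. partial k (\<theta> l) y - partial l (\<theta> k) y) x = partial b (\<lambda>y. 0) x"
      using d\<theta>_isotropic[OF _ k l] unfolding d\<theta>_def by (rule partial_cong[OF B_open x b])
    also have "\<dots> = 0" by (rule partial_eq) simp
    finally show ?thesis .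
  qed
  have "partial k (d\<theta> l b) x - partial l (d\<theta> k b) x =
    (partial k (partial l (\<theta> b)) x - partial k (partial b (\<theta> l)) x) -
    (partial l (partial k (\<theta> b)) x - partial l (partial b (\<theta> k)) x)"
    unfolding d\<theta>_def
    by (simp add: partial_diff[OF p[OF b km(2)] p[OF km(2) b] x km(1)]
        partial_diff[OF p[OF b km(1)] p[OF km(1) b] x km(2)])
  also have "\<dots> = partial l (partial b (\<theta> k)) x - partial k (partial b (\<theta> l)) x"
    using partial_commute[OF \<theta>_smooth[OF b] x km] by simp
  also have "\<dots> = - (partial b (partial k (\<theta> l)) x - partial b (partial l (\<theta> k)) x)"
    using partial_commute[OF \<theta>_smooth[OF km(1)] x b km(2)]
      partial_commute[OF \<theta>_smooth[OF km(2)] x b km(1)] by simp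
  also have "\<dots> = 0"
    using 0 partial_diff[OF p[OF km(2) km(1)] p[OF km(1) km(2)] x b] by simp
  finally show ?thesis using Suc by (simp add: quadrature_form_def b_def)
qed

lemma slice_flow:
  assumes x0: "x0 \<in> B"
  obtains \<rho> u where "\<rho> > 0" "cube m x0 \<rho> \<subseteq> B"
    "\<And>x t. x \<in> cube m x0 \<rho> \<Longrightarrow> \<bar>t\<bar> < \<rho> \<Longrightarrow> u x t \<in> B"
    "\<And>x. x \<in> cube m x0 \<rho> \<Longrightarrow> u x 0 = x"
    "\<And>x t i. x \<in> cube m x0 \<rho> \<Longrightarrow> \<bar>t\<bar> < \<rho> \<Longrightarrow> i < m \<Longrightarrow>
       ((\<lambda>t. u x t i) has_real_derivative (if i < s then Y i (u x t) else 0)) (at t)"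
    "\<And>i. i < m \<Longrightarrow> known D (m + 1) (cube (m + 1) x0 \<rho>) (\<lambda>z. u (clip m z) (z m) i)"
proof -
  have x0E: "x0 \<in> topspace (Euclidean_space m)" using B_open x0 openin_subset by blast
  obtain \<delta> where \<delta>: "\<delta> > 0" "cube m x0 \<delta> \<subseteq> B" by (rule openin_cubeE[OF B_open x0])
  let ?U = "cube m x0 \<delta>"
  have "\<exists>W. known D m ?U W \<and> continuous_on ?U W \<and>
    (\<forall>k<s. \<forall>x\<in>?U. ((\<lambda>t. W (x(k := t))) has_real_derivative quadrature_form j k x) (at (x k)))"
    if j: "j < n_forms" for j
  proof (rule potential_by_quadratures[OF x0E \<delta>(1) sm])
    show "smooth_on m ?U (quadrature_form j k)" if "k < s" for k
      by (rule smooth_on_subset[OF quadrature_form_smooth[OF j that] openin_cube \<delta>(2)])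
    show "known D m ?U (quadrature_form j k)" if "k < s" for k
      by (rule known.restriction[OF quadrature_form_known[OF j that] openin_cube \<delta>(2)])
    show "partial k (quadrature_form j l) x = partial l (quadrature_form j k) x"
      if "k < s" "l < s" "x \<in> ?U" for k l x
      using quadrature_form_closed[OF j that(1,2)] that(3) \<delta>(2) by blast
  qed
  then obtain f where f: "\<And>j. j < n_forms \<Longrightarrow> known D m ?U (f j)"
    "\<And>j. j < n_forms \<Longrightarrow> continuous_on ?U (f j)"
    "\<And>j k x. j < n_forms \<Longrightarrow> k < s \<Longrightarrow> x \<in> ?U \<Longrightarrow>
      ((\<lambda>t. f j (x(k := t))) has_real_derivative quadrature_form j k x) (at (x k))"
    by metis
  have U_B: "x \<in> B" if "x \<in> ?U" for x using that \<delta>(2) by blast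
  show thesis
  proof (rule flow_by_rectification[OF sm x0E \<delta>(1), where r = n_forms and f = f and D = D
        and \<phi> = quadrature_form and c = rate and Y = Y])
    show "continuous_on ?U (quadrature_form j k)" if "j < n_forms" "k < s" for j k
      by (rule continuous_on_subset[OF smooth_on_continuous_on[OF quadrature_form_smooth[OF that]] \<delta>(2)])
    show "v k = 0" if v: "\<And>j. j < n_forms \<Longrightarrow> (\<Sum>k<s. quadrature_form j k x0 * v k) = 0" and "k < s"
      for v k
    proof (rule slice_forms_separate[OF x0 _ _ \<open>k < s\<close>])
      show "(\<Sum>k<s. \<theta> k x0 * v k) = 0" using v[of 0] by (simp add: quadrature_form_def)
      show "(\<Sum>k<s. d\<theta> k l x0 * v k) = 0" if "s \<le> l" "l < m" for l
        using v[of "Suc (l - s)"] that by (simp add: quadrature_form_def)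
    qed
    show "continuous_on ?U (rate j)" if "j < n_forms" for j
      by (rule continuous_on_subset[OF smooth_on_continuous_on[OF rate_smooth[OF that]] \<delta>(2)])
    show "known D m ?U (rate j)" if "j < n_forms" for j
      by (rule known.restriction[OF rate_known[OF that] openin_cube \<delta>(2)])
    show "rate j x = rate j y"
      if "j < n_forms" "x \<in> ?U" "y \<in> ?U" "\<And>i. i \<ge> s \<Longrightarrow> x i = y i" for j x y
      using h_parameter[OF \<delta>(2) that(2-4)] partial_h_parameter[OF \<delta>(2) that(2-4)] that(1)
      by (cases j) (simp_all add: rate_def)
    show "(\<Sum>k<s. quadrature_form j k x * Y k x) = rate j x" if "j < n_forms" "x \<in> ?U" for j x
      by (rule rate_eq[OF that(1) U_B[OF that(2)]])
    show "continuous_on ?U (f j)" "known D m ?U (f j)" if "j < n_forms" for j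
      by (rule f[OF that])+
    show "((\<lambda>t. f j (x(k := t))) has_real_derivative quadrature_form j k x) (at (x k))"
      if "j < n_forms" "k < s" "x \<in> ?U" for j k x
      by (rule f(3)[OF that])
  next
    fix \<rho> u assume u: "\<rho> > 0" "\<rho> \<le> \<delta>"
    "\<And>x t. x \<in> cube m x0 \<rho> \<Longrightarrow> \<bar>t\<bar> < \<rho> \<Longrightarrow> u x t \<in> ?U"
    "\<And>x. x \<in> cube m x0 \<rho> \<Longrightarrow> u x 0 = x"
    "\<And>x t i. x \<in> cube m x0 \<rho> \<Longrightarrow> \<bar>t\<bar> < \<rho> \<Longrightarrow> i < s \<Longrightarrow>
       ((\<lambda>t. u x t i) has_real_derivative Y i (u x t)) (at t)"
    "\<And>x t i. x \<in> cube m x0 \<rho> \<Longrightarrow> \<bar>t\<bar> < \<rho> \<Longrightarrow> i \<ge> s \<Longrightarrow> u x t i = x i"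
    "\<And>i. i < m \<Longrightarrow> known D (m + 1) (cube (m + 1) x0 \<rho>) (\<lambda>z. u (clip m z) (z m) i)"
    show thesis
    proof (rule that[of \<rho> u])
      show "\<rho> > 0" by (rule u(1))
      show "cube m x0 \<rho> \<subseteq> B" using cube_mono[OF u(2)] \<delta>(2) by blast
      show "u x t \<in> B" if "x \<in> cube m x0 \<rho>" "\<bar>t\<bar> < \<rho>" for x t
        by (rule U_B[OF u(3)[OF that]])
      show "u x 0 = x" if "x \<in> cube m x0 \<rho>" for x by (rule u(4)[OF that])
      show "known D (m + 1) (cube (m + 1) x0 \<rho>) (\<lambda>z. u (clip m z) (z m) i)" if "i < m" for i
        by (rule u(7)[OF that])
      fix x t i assume x: "x \<in> cube m x0 \<rho>" and t: "\<bar>t\<bar> < \<rho>" and i: "i < m"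
      show "((\<lambda>t. u x t i) has_real_derivative (if i < s then Y i (u x t) else 0)) (at t)"
      proof (cases "i < s")
        case True
        then show ?thesis using u(5)[OF x t True] by simp
      next
        case False
        have "\<forall>\<^sub>F \<tau> in nhds t. \<tau> \<in> {-\<rho><..<\<rho>}"
          using t by (intro eventually_nhds_in_open) auto
        then have "\<forall>\<^sub>F \<tau> in nhds t. u x \<tau> i = x i"
          by eventually_elim (use u(6)[OF x] False in auto)
        then have "((\<lambda>t. u x t i) has_real_derivative 0) (at t) \<longleftrightarrow> ((\<lambda>t. x i) has_real_derivative 0) (at t)"
          by (intro DERIV_cong_ev) auto
        then show ?thesis using False by simp
      qed
    qed
  qed
qed

text \<open>The flow of \<open>X\<close> is the flow on the slices conjugated by \<open>S\<close>.\<close>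

lemma flow_known:
  assumes x0: "x0 \<in> B"
  obtains \<epsilon> V F where "\<epsilon> > 0" "openin (Euclidean_space m) V" "Sv x0 \<in> V" "V \<subseteq> C"
    "\<And>i. i < m \<Longrightarrow> known D (m + 1)
      {z \<in> topspace (Euclidean_space (m + 1)). clip m z \<in> V \<and> \<bar>z m\<bar> < \<epsilon>} (F i)"
    "\<And>y t. y \<in> V \<Longrightarrow> \<bar>t\<bar> < \<epsilon> \<Longrightarrow> clip m (\<lambda>i. F i (y(m := t))) \<in> C"
    "\<And>y. y \<in> V \<Longrightarrow> clip m (\<lambda>i. F i (y(m := 0))) = y"
    "\<And>y t i. y \<in> V \<Longrightarrow> \<bar>t\<bar> < \<epsilon> \<Longrightarrow> i < m \<Longrightarrow> ((\<lambda>t. F i (y(m := t))) has_real_derivative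
      X (clip m (\<lambda>i. F i (y(m := t)))) i) (at t)"
proof -
  have x0E: "x0 \<in> topspace (Euclidean_space m)" using B_open x0 openin_subset by blast
  obtain \<rho> u where \<rho>: "\<rho> > 0" "cube m x0 \<rho> \<subseteq> B" and
    u_in: "\<And>x t. x \<in> cube m x0 \<rho> \<Longrightarrow> \<bar>t\<bar> < \<rho> \<Longrightarrow> u x t \<in> B" and
    u_0: "\<And>x. x \<in> cube m x0 \<rho> \<Longrightarrow> u x 0 = x" and
    u_deriv: "\<And>x t i. x \<in> cube m x0 \<rho> \<Longrightarrow> \<bar>t\<bar> < \<rho> \<Longrightarrow> i < m \<Longrightarrow>
       ((\<lambda>t. u x t i) has_real_derivative (if i < s then Y i (u x t) else 0)) (at t)" and
    u_known: "\<And>i. i < m \<Longrightarrow> known D (m + 1) (cube (m + 1) x0 \<rho>) (\<lambda>z. u (clip m z) (z m) i)"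
    by (rule slice_flow[OF x0]) blast
  define V where "V = {y \<in> C. Tv y \<in> cube m x0 \<rho>}"
  define F where "F i z = S i (u (Tv (clip m z)) (z m))" for i z
  let ?E1 = "Euclidean_space (m + 1)"
  let ?Z = "{z \<in> topspace ?E1. clip m z \<in> V \<and> \<bar>z m\<bar> < \<rho>}"
  have V_open: "openin (Euclidean_space m) V"
    unfolding V_def by (rule S_image_open(1)[OF openin_cube \<rho>(2)])
  have V_top: "y \<in> topspace (Euclidean_space m)" if "y \<in> V" for y
    using openin_subset[OF V_open] that by blast
  have T_V: "Tv y \<in> cube m x0 \<rho>" if "y \<in> V" for y using that by (simp add: V_def)
  have S_T_V: "Sv (Tv y) = y" if "y \<in> V" for y using that S_T by (simp add: V_def)
  have u_clip: "clip m (u x t) = u x t" if "x \<in> cube m x0 \<rho>" "\<bar>t\<bar> < \<rho>" for x t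
    using u_in[OF that] openin_subset[OF B_open] by (intro clip_ident) blast
  have Z_open: "openin ?E1 ?Z"
    unfolding openin_Euclidean_space_iff
  proof (intro conjI ballI)
    fix z assume z: "z \<in> ?Z"
    then obtain \<delta> where \<delta>: "\<delta> > 0" "cube m (clip m z) \<delta> \<subseteq> V"
      using openin_cubeE[OF V_open] by blast
    define d where "d = min \<delta> (\<rho> - \<bar>z m\<bar>)"
    have "cube (m + 1) z d \<subseteq> ?Z"
    proof
      fix w assume w: "w \<in> cube (m + 1) z d"
      have "clip m w \<in> cube m (clip m z) \<delta>"
        using w by (auto simp: cube_def clip_def d_def)
      moreover have "\<bar>w m - z m\<bar> < \<rho> - \<bar>z m\<bar>"
        using w by (auto simp: cube_def d_def)
      then have "\<bar>w m\<bar> < \<rho>" by linarith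
      ultimately show "w \<in> ?Z" using \<delta>(2) w cube_subset_topspace by blast
    qed
    moreover have "d > 0" using \<delta> z by (auto simp: d_def)
    ultimately show "\<exists>d>0. cube (m + 1) z d \<subseteq> ?Z" by blast
  qed auto
  have upd: "clip m (y(m := t)) = y" "(y(m := t)) m = t" if "y \<in> V" for y :: "nat \<Rightarrow> real" and t
    using V_top[OF that] by (auto simp: clip_def topspace_Euclidean_space)
  have F_eq: "F i (y(m := t)) = S i (u (Tv y) t)" if "y \<in> V" for i y t
    unfolding F_def upd[OF that] ..
  show thesis
  proof (rule that[of \<rho> V F])
    show "\<rho> > 0" by (rule \<rho>(1))
    show "openin (Euclidean_space m) V" by (rule V_open)
    show "Sv x0 \<in> V"
      using S_in[OF x0] T_S[OF x0] centre_in_cube[OF x0E \<rho>(1)] by (simp add: V_def)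
    show "V \<subseteq> C" by (auto simp: V_def)
    show "clip m (\<lambda>i. F i (y(m := t))) \<in> C" if "y \<in> V" "\<bar>t\<bar> < \<rho>" for y t
      unfolding F_eq[OF that(1)] by (rule S_in[OF u_in[OF T_V[OF that(1)] that(2)]])
    show "clip m (\<lambda>i. F i (y(m := 0))) = y" if "y \<in> V" for y
      unfolding F_eq[OF that] u_0[OF T_V[OF that]] by (rule S_T_V[OF that])
    show "((\<lambda>t. F i (y(m := t))) has_real_derivative X (clip m (\<lambda>i. F i (y(m := t)))) i) (at t)"
      if y: "y \<in> V" and t: "\<bar>t\<bar> < \<rho>" and i: "i < m" for y t i
    proof -
      let ?u = "u (Tv y)"
      note uB = u_in[OF T_V[OF y]]
      have ev: "\<forall>\<^sub>F \<tau> in at t. \<bar>\<tau>\<bar> < \<rho>"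
      proof -
        have "\<forall>\<^sub>F \<tau> in nhds t. \<tau> \<in> {-\<rho><..<\<rho>}"
          using t by (intro eventually_nhds_in_open) auto
        then show ?thesis unfolding eventually_at_filter by eventually_elim auto
      qed
      have "((\<lambda>t. S i (?u t)) has_real_derivative
         (\<Sum>k<m. partial k (S i) (?u t) * (if k < s then Y k (?u t) else 0))) (at t)"
      proof (rule chain_rule[where u = ?u, OF S_smooth[OF i] uB[OF t]])
        show "\<forall>\<^sub>F \<tau> in at t. ?u \<tau> \<in> topspace (Euclidean_space m)"
          using ev by eventually_elim (use uB openin_subset[OF B_open] in blast)
      qed (rule u_deriv[OF T_V[OF y] t])
      moreover have "(\<Sum>k<m. partial k (S i) (?u t) * (if k < s then Y k (?u t) else 0)) = X (Sv (?u t)) i"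
        unfolding HJE[OF uB[OF t] i] using sm by (intro sum.mono_neutral_cong_right) auto
      ultimately show ?thesis unfolding F_eq[OF y] by (simp only:)
    qed
    show "known D (m + 1) ?Z (F i)" if i: "i < m" for i
    proof -
      have z_coord: "known D (m + 1) ?Z (\<lambda>z. z j)" if "j < m + 1" for j
        by (rule known.coord[OF Z_open that])
      have T_known': "known D (m + 1) ?Z (\<lambda>z. T j (clip m z))" if "j < m" for j
      proof -
        have "known D (m + 1) ?Z (\<lambda>z. T j (clip m (\<lambda>i. z i)))"
          by (rule known.substitution[OF T_known[OF openin_cube \<rho>(2) that] Z_open z_coord])
            (auto simp: V_def)
        then show ?thesis .
      qed
      define g where "g j z = (if j < m then T j (clip m z) else z m)" for j z
      have g: "clip m (clip (m + 1) (\<lambda>j. g j z)) = Tv (clip m z)" "clip (m + 1) (\<lambda>j. g j z) m = z m" for z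
        by (auto simp: g_def clip_def)
      have u_known': "known D (m + 1) ?Z (\<lambda>z. u (Tv (clip m z)) (z m) j)" if j: "j < m" for j
      proof -
        have "known D (m + 1) ?Z (\<lambda>z. u (clip m (clip (m + 1) (\<lambda>j. g j z))) (clip (m + 1) (\<lambda>j. g j z) m) j)"
        proof (rule known.substitution[OF u_known[OF j] Z_open])
          show "known D (m + 1) ?Z (g i)" if "i < m + 1" for i
            unfolding g_def using T_known' z_coord[of m] by (cases "i < m") simp_all
          show "clip (m + 1) (\<lambda>j. g j z) \<in> cube (m + 1) x0 \<rho>" if "z \<in> ?Z" for z
            unfolding cube_Suc_iff[OF x0E] g using that T_V clip_in_topspace by blast
        qed
        then show ?thesis unfolding g .
      qed
      have "known D (m + 1) ?Z (\<lambda>z. S i (clip m (\<lambda>j. u (Tv (clip m z)) (z m) j)))"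
      proof (rule known.substitution[OF S_known[OF i] Z_open u_known'])
        show "clip m (\<lambda>j. u (Tv (clip m z)) (z m) j) \<in> B" if "z \<in> ?Z" for z
          using u_clip[OF T_V] u_in[OF T_V] that by simp
      qed
      then show ?thesis
        by (rule known.equal) (use u_clip[OF T_V] in \<open>simp add: F_def\<close>)
    qed
  qed
qed

end

section \<open>Charts\<close>

lemma chart_open: "smooth_manifold M \<Longrightarrow> c \<in> atlas M \<Longrightarrow> openin (mtop M) (fst c)"
  and chart_image_open: "smooth_manifold M \<Longrightarrow> c \<in> atlas M \<Longrightarrow>
    openin (Euclidean_space (mdim M)) (snd c ` fst c)"
  and chart_homeomorphic: "smooth_manifold M \<Longrightarrow> c \<in> atlas M \<Longrightarrow>
    homeomorphic_map (subtopology (mtop M) (fst c))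
      (subtopology (Euclidean_space (mdim M)) (snd c ` fst c)) (snd c)"
  by (auto simp: smooth_manifold_def)

lemma chart_subset: "smooth_manifold M \<Longrightarrow> c \<in> atlas M \<Longrightarrow> fst c \<subseteq> topspace (mtop M)"
  by (rule openin_subset[OF chart_open])

lemma chart_exists:
  assumes "smooth_manifold M" "p \<in> topspace (mtop M)"
  obtains c where "c \<in> atlas M" "p \<in> fst c"
  using assms unfolding smooth_manifold_def by blast

lemma chart_inj:
  assumes "smooth_manifold M" "c \<in> atlas M"
  shows "inj_on (snd c) (fst c)"
proof -
  have "topspace (subtopology (mtop M) (fst c)) = fst c"
    using chart_subset[OF assms] by auto
  then show ?thesis
    using homeomorphic_imp_injective_map[OF chart_homeomorphic[OF assms]] by simp
qed

lemma chart_in_topspace: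
  "smooth_manifold M \<Longrightarrow> c \<in> atlas M \<Longrightarrow> p \<in> fst c \<Longrightarrow> snd c p \<in> topspace (Euclidean_space (mdim M))"
  using openin_subset[OF chart_image_open] by blast

lemma param_snd: "inj_on (snd c) (fst c) \<Longrightarrow> p \<in> fst c \<Longrightarrow> param c (snd c p) = p"
  by (simp add: param_def)

lemma param_restricted:
  "inj_on (snd c) (fst c) \<Longrightarrow> p \<in> fst c \<inter> U \<Longrightarrow> param (fst c \<inter> U, snd c) (snd c p) = p"
  unfolding param_def by (auto intro!: inv_into_f_f intro: inj_on_subset)

lemma continuous_map_param:
  assumes "smooth_manifold M" "c \<in> atlas M"
  shows "continuous_map (subtopology (Euclidean_space (mdim M)) (snd c ` fst c)) (mtop M) (param c)"
proof -
  let ?X = "subtopology (mtop M) (fst c)" and ?Y = "subtopology (Euclidean_space (mdim M)) (snd c ` fst c)"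
  have top: "topspace ?X = fst c" using chart_subset[OF assms] by auto
  obtain g where g: "homeomorphic_maps ?X ?Y (snd c) g"
    using chart_homeomorphic[OF assms] homeomorphic_map_maps by blast
  have "g y = param c y" if "y \<in> topspace ?Y" for y
  proof -
    obtain p where p: "p \<in> fst c" "y = snd c p" using \<open>y \<in> topspace ?Y\<close> by auto
    have "g (snd c p) = p" using g p(1) unfolding homeomorphic_maps_def top by blast
    then show ?thesis using p param_snd[OF chart_inj[OF assms]] by simp
  qed
  moreover have "continuous_map ?Y (mtop M) g"
    using g unfolding homeomorphic_maps_def by (simp add: continuous_map_in_subtopology)
  ultimately show ?thesis by (rule continuous_map_eq[rotated])
qed

lemma open_chart_preimage:
  assumes "smooth_manifold M" "c \<in> atlas M" "openin (Euclidean_space (mdim M)) V"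
  shows "openin (mtop M) {p \<in> fst c. snd c p \<in> V}"
proof -
  have top: "topspace (subtopology (mtop M) (fst c)) = fst c"
    using chart_subset[OF assms(1,2)] by auto
  have "continuous_map (subtopology (mtop M) (fst c)) (Euclidean_space (mdim M)) (snd c)"
    using homeomorphic_imp_continuous_map[OF chart_homeomorphic[OF assms(1,2)]]
    by (simp add: continuous_map_in_subtopology)
  from openin_continuous_map_preimage[OF this assms(3)] show ?thesis
    unfolding top by (rule openin_trans_full[OF _ chart_open[OF assms(1,2)]])
qed

subsection \<open>Product charts\<close>

lemma prod_chart_inj:
  assumes d: "inj_on (snd d) (fst d)" "\<And>q. q \<in> fst d \<Longrightarrow> snd d q \<in> topspace (Euclidean_space s)"
    and e: "inj_on (snd e) (fst e)"
  shows "inj_on (snd (prod_chart s d e)) (fst (prod_chart s d e))"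
proof (rule inj_onI)
  fix a b assume ab: "a \<in> fst (prod_chart s d e)" "b \<in> fst (prod_chart s d e)"
    and eq: "snd (prod_chart s d e) a = snd (prod_chart s d e) b"
  obtain q l q' l' where [simp]: "a = (q, l)" "b = (q', l')" by (cases a, cases b)
  have in_fst: "q \<in> fst d" "q' \<in> fst d" "l \<in> fst e" "l' \<in> fst e"
    using ab by (auto simp: prod_chart_def)
  have comp: "(if i < s then snd d q i else snd e l (i - s)) = (if i < s then snd d q' i else snd e l' (i - s))" for i
    using fun_cong[OF eq, of i] by (simp add: prod_chart_def)
  have "snd d q i = snd d q' i" for i
    using comp[of i] d(2)[OF in_fst(1)] d(2)[OF in_fst(2)]
    by (cases "i < s") (auto simp: topspace_Euclidean_space)
  then have "q = q'" using d(1) in_fst by (metis ext inj_onD)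
  moreover have "snd e l i = snd e l' i" for i using comp[of "i + s"] by simp
  then have "l = l'" using e in_fst by (metis ext inj_onD)
  ultimately show "a = b" by simp
qed

lemma prod_chart_in_topspace:
  assumes "snd e l \<in> topspace (Euclidean_space r)"
  shows "snd (prod_chart s d e) (q, l) \<in> topspace (Euclidean_space (s + r))"
  using assms by (auto simp: prod_chart_def topspace_Euclidean_space)

text \<open>Changing a coordinate of the first factor moves the point that a product chart describes within its
  slice.\<close>

lemma partial_slice:
  assumes d: "inj_on (snd d) (fst d)" "openin (Euclidean_space s) (snd d ` fst d)"
    and e: "inj_on (snd e) (fst e)" and q: "q \<in> fst d" and l: "l \<in> fst e" and j: "j < s"
  shows "partial j (map_rep d c (\<lambda>q. F (q, l)) i) (snd d q) =
    partial j (map_rep (prod_chart s d e) c F i) (snd (prod_chart s d e) (q, l))"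
proof -
  let ?pc = "prod_chart s d e"
  have top: "snd d q \<in> topspace (Euclidean_space s)" if "q \<in> fst d" for q
    using that openin_subset[OF d(2)] by blast
  have inj: "inj_on (snd ?pc) (fst ?pc)" by (rule prod_chart_inj[OF d(1) top e])
  have qj: "snd ?pc (q, l) j = snd d q j" using j by (simp add: prod_chart_def)
  have "\<forall>\<^sub>F t in nhds (snd d q j). (snd d q)(j := t) \<in> snd d ` fst d"
    using q by (intro eventually_fun_upd_in[OF d(2) _ j]) blast
  then have "\<forall>\<^sub>F t in nhds (snd d q j). map_rep d c (\<lambda>q. F (q, l)) i ((snd d q)(j := t)) =
      map_rep ?pc c F i ((snd ?pc (q, l))(j := t))"
  proof eventually_elim
    case (elim t)
    then obtain q' where q': "q' \<in> fst d" "(snd d q)(j := t) = snd d q'" by blast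
    have "(snd ?pc (q, l))(j := t) = snd ?pc (q', l)"
    proof
      fix k
      show "((snd ?pc (q, l))(j := t)) k = snd ?pc (q', l) k"
        using fun_cong[OF q'(2), of k] j by (auto simp: prod_chart_def split: if_splits)
    qed
    moreover have "(q', l) \<in> fst ?pc" using q'(1) l by (simp add: prod_chart_def)
    ultimately show ?case
      unfolding map_rep_def q'(2) by (simp add: param_snd[OF inj] param_snd[OF d(1) q'(1)])
  qed
  then show ?thesis unfolding partial_def qj by (intro deriv_cong_ev) auto
qed

section \<open>Integral curves\<close>

text \<open>It suffices to check the differential equation in one chart that contains the curve, because
  the components of a vector field transform by the derivatives of the changes of charts.\<close>

lemma integral_curve_from_chart:
  assumes M: "smooth_manifold M" and c: "c \<in> atlas M" and X: "vector_field M X"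
    and J: "open J"
    and f_in: "\<And>t. t \<in> J \<Longrightarrow> clip (mdim M) (\<lambda>i. f i t) \<in> snd c ` fst c"
    and f: "\<And>t i. t \<in> J \<Longrightarrow> i < mdim M \<Longrightarrow>
      (f i has_real_derivative X c (param c (clip (mdim M) (\<lambda>i. f i t))) i) (at t)"
  shows "integral_curve M X J (\<lambda>t. param c (clip (mdim M) (\<lambda>i. f i t)))"
proof -
  let ?m = "mdim M"
  let ?f = "\<lambda>t. clip ?m (\<lambda>i. f i t)"
  let ?A = "snd c ` fst c"
  note inj = chart_inj[OF M c]
  have "continuous_on J (f i)" if "i < ?m" for i
    using f[OF _ that] by (meson DERIV_isCont continuous_at_imp_continuous_on)
  then have "continuous_on J ?f" by (rule continuous_on_clip)
  then have "continuous_map (top_of_set J) (Euclidean_space ?m) ?f"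
    unfolding Euclidean_space_eq_top_of_set continuous_map_in_subtopology
    by (auto simp: clip_def)
  then have "continuous_map (top_of_set J) (subtopology (Euclidean_space ?m) ?A) ?f"
    using f_in by (auto simp: continuous_map_in_subtopology)
  from continuous_map_compose[OF this continuous_map_param[OF M c]]
  have cont: "continuous_map (top_of_set J) (mtop M) (\<lambda>t. param c (?f t))"
    by (simp add: o_def)
  have in_c: "param c (?f t) \<in> fst c" "snd c (param c (?f t)) = ?f t" if t: "t \<in> J" for t
  proof -
    obtain p where "p \<in> fst c" "?f t = snd c p" using f_in[OF t] by blast
    then show "param c (?f t) \<in> fst c" "snd c (param c (?f t)) = ?f t"
      using param_snd[OF inj] by simp_all
  qed
  show ?thesis
    unfolding integral_curve_def
  proof (intro conjI ballI impI allI cont)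
    fix t c2 i assume t: "t \<in> J" and c2: "c2 \<in> atlas M" and in2: "param c (?f t) \<in> fst c2" and i: "i < ?m"
    have smooth: "smooth_on ?m (map_dom c c2 id) (map_rep c c2 id i)"
      using M c c2 i unfolding smooth_manifold_def by blast
    have dom: "?f t \<in> map_dom c c2 id"
      unfolding map_dom_def using in_c[OF t] in2 by (metis (mono_tags, lifting) id_apply imageI mem_Collect_eq)
    have "((\<lambda>s. map_rep c c2 id i (?f s)) has_real_derivative
      (\<Sum>k<?m. partial k (map_rep c c2 id i) (?f t) * X c (param c (?f t)) k)) (at t)"
    proof (rule chain_rule[where u = ?f, OF smooth dom])
      show "((\<lambda>s. ?f s k) has_real_derivative X c (param c (?f t)) k) (at t)" if "k < ?m" for k
        using f[OF t that] that by (simp add: clip_nth)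
    qed (simp add: clip_in_topspace)
    moreover have "(\<Sum>k<?m. partial k (map_rep c c2 id i) (?f t) * X c (param c (?f t)) k) = X c2 (param c (?f t)) i"
    proof -
      have "X c2 (param c (?f t)) i = tangent_map M c c2 id (param c (?f t)) (X c (param c (?f t))) i"
        using X c c2 in_c(1)[OF t] in2 i unfolding vector_field_def by blast
      then show ?thesis unfolding tangent_map_def in_c(2)[OF t] by simp
    qed
    ultimately show "((\<lambda>s. snd c2 (param c (?f s)) i) has_real_derivative X c2 (param c (?f t)) i) (at t)"
      by (simp add: map_rep_def)
  qed
qed

section \<open>Integrability by quadratures\<close>

lemma map_dataI: "c \<in> atlas M \<Longrightarrow> d \<in> atlas N \<Longrightarrow> i < mdim N \<Longrightarrow>
    (mdim M, map_dom c d F, map_rep c d F i) \<in> map_data M N F"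
  unfolding map_data_def by blast

lemma form_dataI: "c \<in> atlas M \<Longrightarrow> i < mdim M \<Longrightarrow>
    (mdim M, snd c ` fst c, \<lambda>x. \<eta> c (param c x) i) \<in> form_data M \<eta>"
  unfolding form_data_def by blast

lemma function_dataI: "c \<in> atlas M \<Longrightarrow>
    (mdim M, snd c ` fst c, \<lambda>x. H (param c x)) \<in> function_data M H"
  unfolding function_data_def by blast

text \<open>Around a point, choose a preimage under the complete solution and a product chart there.  Charts
  and the complete solution are cut down to open sets between which the latter is a
  diffeomorphism; in these charts, the hypotheses become those of \<open>HJ_coordinates\<close>.\<close>

lemma complete_solution_integrable:
  fixes M :: "'a manifold" and N :: "'b manifold" and L :: "'l manifold"
    and \<eta> \<xi> X :: "'a field" and P :: "'a \<Rightarrow> 'b" and \<Sigma> :: "'b \<times> 'l \<Rightarrow> 'a"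
  assumes contact: "contact_manifold M \<eta>" and N: "smooth_manifold N"
    and H: "smooth_function M H"
    and \<xi>H: "\<forall>c\<in>atlas M. \<forall>p\<in>fst c. pairing (mdim M) (differential H c p) (\<xi> c p) = 0"
    and X: "contact_field M \<eta> \<xi> H X"
    and complete: "complete_solution M N P X L \<Sigma>" and iso: "pseudo_isotropic M N \<eta> L \<Sigma>"
  shows "integrable_by_quadratures M X (HJ_data M \<eta> H N P L \<Sigma>)"
  unfolding integrable_by_quadratures_def
proof (intro ballI)
  fix c p assume c: "c \<in> atlas M" and p: "p \<in> fst c"
  let ?D = "HJ_data M \<eta> H N P L \<Sigma>"
  define m where "m = mdim M"
  define s where "s = mdim N"
  have M: "smooth_manifold M" and \<eta>: "one_form M \<eta>" and m_pos: "0 < m"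
    using contact by (auto simp: contact_manifold_def m_def)
  have L: "smooth_manifold L" and dims: "mdim L + mdim N = mdim M"
    and loc: "local_diffeomorphism (prod_manifold N L) M \<Sigma>"
    and onto: "\<Sigma> ` topspace (mtop (prod_manifold N L)) = topspace (mtop M)"
    and HJE: "\<And>l. l \<in> topspace (mtop L) \<Longrightarrow> solves_HJE M N P X (\<lambda>q. \<Sigma> (q, l))"
    using complete by (auto simp: complete_solution_def)
  have dimNL: "mdim (prod_manifold N L) = m" "s + mdim L = m"
    using dims by (auto simp: prod_manifold_def m_def s_def)
  note inj_c = chart_inj[OF M c]
  have "p \<in> \<Sigma> ` topspace (mtop (prod_manifold N L))" using p chart_subset[OF M c] onto by blast
  then obtain q0 l0 where q0: "q0 \<in> topspace (mtop N)" and l0: "l0 \<in> topspace (mtop L)"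
    and p_eq: "p = \<Sigma> (q0, l0)"
    by (auto simp: prod_manifold_def)
  obtain d where d: "d \<in> atlas N" "q0 \<in> fst d" by (rule chart_exists[OF N q0])
  obtain e where e: "e \<in> atlas L" "l0 \<in> fst e" by (rule chart_exists[OF L l0])
  note inj_d = chart_inj[OF N d(1)] and inj_e = chart_inj[OF L e(1)]
  define pc where "pc = prod_chart s d e"
  have pc: "pc \<in> atlas (prod_manifold N L)"
    using d(1) e(1) unfolding prod_manifold_def pc_def s_def manifold.simps by blast
  have fst_pc: "fst pc = fst d \<times> fst e" by (simp add: pc_def prod_chart_def)
  have inj_pc: "inj_on (snd pc) (fst pc)"
    unfolding pc_def using chart_in_topspace[OF N d(1)]
    by (intro prod_chart_inj inj_d inj_e) (simp add: s_def)
  have pc_top: "clip m (snd pc w) = snd pc w" if w: "w \<in> fst pc" for w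
  proof (rule clip_ident)
    obtain q l where "w = (q, l)" "l \<in> fst e" using w fst_pc by auto
    then show "snd pc w \<in> topspace (Euclidean_space m)"
      using prod_chart_in_topspace[OF chart_in_topspace[OF L e(1)], of l s d q] dimNL(2)
      by (simp add: pc_def)
  qed
  have c_top: "clip m (snd c q) = snd c q" if "q \<in> fst c" for q
    using clip_ident[OF chart_in_topspace[OF M c that]] by (simp add: m_def)
  have w0: "(q0, l0) \<in> topspace (mtop (prod_manifold N L))"
    using q0 l0 by (simp add: prod_manifold_def)
  obtain W where W: "openin (mtop (prod_manifold N L)) W" "(q0, l0) \<in> W" "openin (mtop M) (\<Sigma> ` W)"
    "diffeomorphism (open_submanifold (prod_manifold N L) W) (open_submanifold M (\<Sigma> ` W)) \<Sigma>"
    using loc w0 unfolding local_diffeomorphism_def by blast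
  obtain G where G: "smooth_map (open_submanifold M (\<Sigma> ` W)) (open_submanifold (prod_manifold N L) W) G"
    and G_\<Sigma>: "\<And>w. w \<in> W \<Longrightarrow> G (\<Sigma> w) = w" and \<Sigma>_G: "\<And>q. q \<in> \<Sigma> ` W \<Longrightarrow> \<Sigma> (G q) = q"
  proof -
    have "topspace (mtop (open_submanifold (prod_manifold N L) W)) = W"
      and "topspace (mtop (open_submanifold M (\<Sigma> ` W))) = \<Sigma> ` W"
      using openin_subset[OF W(1)] openin_subset[OF W(3)]
      by (simp_all add: open_submanifold_def inf.absorb2)
    note tops = this
    show ?thesis using W(4) that unfolding diffeomorphism_def tops by blast
  qed
  define c' where "c' = (fst c \<inter> \<Sigma> ` W, snd c)"
  define pc' where "pc' = (fst pc \<inter> W, snd pc)"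
  have c': "c' \<in> atlas (open_submanifold M (\<Sigma> ` W))"
    using c by (auto simp: open_submanifold_def c'_def)
  have pc': "pc' \<in> atlas (open_submanifold (prod_manifold N L) W)"
    using pc by (auto simp: open_submanifold_def pc'_def)
  define A where "A = snd c ` fst c"
  define B where "B = map_dom pc' c' \<Sigma>"
  define C where "C = map_dom c' pc' G"
  define S where "S = map_rep pc c \<Sigma>"
  define T where "T = map_rep c' pc' G"
  define \<eta>c where "\<eta>c i x = \<eta> c (param c x) i" for i x
  define Hc where "Hc x = H (param c x)" for x
  define Xc where "Xc x i = X c (param c x) i" for x i
  define Y where "Y k x = tangent_map M c d P (\<Sigma> (param pc x)) (X c (\<Sigma> (param pc x))) k" for k x
  have BE: "\<exists>w. w \<in> fst pc \<inter> W \<and> \<Sigma> w \<in> fst c \<and> x = snd pc w" if "x \<in> B" for x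
    using that by (auto simp: B_def map_dom_def c'_def pc'_def)
  have BI: "snd pc w \<in> B" if "w \<in> fst pc \<inter> W" "\<Sigma> w \<in> fst c" for w
    using that by (auto simp: B_def map_dom_def c'_def pc'_def)
  have CE: "\<exists>q. q \<in> fst c \<inter> \<Sigma> ` W \<and> G q \<in> fst pc \<inter> W \<and> y = snd c q" if "y \<in> C" for y
    using that by (auto simp: C_def map_dom_def c'_def pc'_def)
  have CI: "snd c q \<in> C" if "q \<in> fst c \<inter> \<Sigma> ` W" "G q \<in> fst pc \<inter> W" for q
    using that by (auto simp: C_def map_dom_def c'_def pc'_def)
  have S_eq: "clip m (\<lambda>i. S i (snd pc w)) = snd c (\<Sigma> w)" if "w \<in> fst pc" "\<Sigma> w \<in> fst c" for w
    using c_top[OF that(2)] param_snd[OF inj_pc that(1)] by (simp add: S_def map_rep_def[abs_def])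
  have T_eq: "clip m (\<lambda>i. T i (snd c q)) = snd pc (G q)" if "q \<in> fst c \<inter> \<Sigma> ` W" "G q \<in> fst pc" for q
    using pc_top[OF that(2)] param_restricted[OF inj_c that(1)]
    by (simp add: T_def map_rep_def[abs_def] c'_def pc'_def)
  have B_dom: "B \<subseteq> map_dom pc c \<Sigma>"
    by (auto simp: B_def map_dom_def c'_def pc'_def)
  have dim_sub: "mdim (open_submanifold M (\<Sigma> ` W)) = m" "mdim (open_submanifold (prod_manifold N L) W) = m"
    using dimNL by (simp_all add: open_submanifold_def m_def)
  \<comment> \<open>smoothness of any one component includes that the domain is open, and \<open>m\<close> is odd, hence positive\<close>
  have B_open: "openin (Euclidean_space m) B"
  proof -
    have "smooth_on m (map_dom pc' c' \<Sigma>) (map_rep pc' c' \<Sigma> 0)"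
      using W(4) pc' c' m_pos dim_sub unfolding diffeomorphism_def smooth_map_def by metis
    then show ?thesis unfolding B_def by (rule smooth_on_openin)
  qed
  have T_smooth: "smooth_on m C (T i)" if "i < m" for i
    using G pc' c' that dim_sub unfolding smooth_map_def C_def T_def by metis
  have S_smooth: "smooth_on m B (S i)" if "i < m" for i
  proof -
    have "smooth_on m (map_dom pc c \<Sigma>) (S i)"
      using loc pc c that dimNL unfolding local_diffeomorphism_def smooth_map_def S_def m_def by metis
    then show ?thesis by (rule smooth_on_subset[OF _ B_open B_dom])
  qed
  have S_known: "known ?D m B (S i)" if "i < m" for i
  proof -
    have "(m, map_dom pc c \<Sigma>, S i) \<in> map_data (prod_manifold N L) M \<Sigma>"
      using map_dataI[OF pc c, of i \<Sigma>] that unfolding S_def dimNL(1) m_def by blast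
    then have "known ?D m (map_dom pc c \<Sigma>) (S i)"
      by (intro known.datum) (simp add: HJ_data_def)
    then show ?thesis by (rule known.restriction[OF _ B_open B_dom])
  qed
  have \<eta>_known: "known ?D m A (\<eta>c i)" if "i < m" for i
  proof (rule known.datum)
    show "(m, A, \<eta>c i) \<in> ?D"
      using form_dataI[OF c, of i \<eta>] that unfolding HJ_data_def A_def m_def \<eta>c_def[abs_def] by blast
  qed
  have H_known: "known ?D m A Hc"
  proof (rule known.datum)
    show "(m, A, Hc) \<in> ?D"
      using function_dataI[OF c, of H] unfolding HJ_data_def A_def m_def Hc_def[abs_def] by blast
  qed
  have partial_S: "partial k (map_rep d c (\<lambda>q. \<Sigma> (q, l)) i) (snd d q) = partial k (S i) (snd pc (q, l))"
    if "q \<in> fst d" "l \<in> fst e" "k < s" for k i q l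
    unfolding S_def pc_def
    by (rule partial_slice[OF inj_d _ inj_e that]) (use chart_image_open[OF N d(1)] in \<open>simp add: s_def\<close>)
  have ext: "partial i (\<eta>c j) (snd c q) - partial j (\<eta>c i) (snd c q) = ext_deriv \<eta> c q i j" for i j q
    by (simp add: ext_deriv_def \<eta>c_def[abs_def])
  have AE: "\<exists>q. q \<in> fst c \<and> y = snd c q" if "y \<in> A" for y using that by (auto simp: A_def)
  interpret HJ_coordinates ?D m s A B C S T \<eta>c Hc Xc Y
  proof
    show "s \<le> m" using dimNL by simp
    show "openin (Euclidean_space m) B" by (rule B_open)
    show "openin (Euclidean_space m) C" using T_smooth[OF m_pos] by (rule smooth_on_openin)
    show "openin (Euclidean_space m) A"
      unfolding A_def m_def by (rule chart_image_open[OF M c])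
    show "C \<subseteq> A" using CE by (fastforce simp: A_def)
    show "smooth_on m A (\<eta>c i)" if "i < m" for i
      using \<eta> c that unfolding one_form_def A_def \<eta>c_def[abs_def] m_def by blast
    show "smooth_on m A Hc"
      using H c unfolding smooth_function_def A_def Hc_def[abs_def] m_def by blast
    show "clip m (\<lambda>i. S i x) \<in> C" "clip m (\<lambda>i. T i (clip m (\<lambda>i. S i x))) = x" if x: "x \<in> B" for x
    proof -
      obtain w where w: "w \<in> fst pc \<inter> W" "\<Sigma> w \<in> fst c" "x = snd pc w" using BE[OF x] by blast
      have Gw: "G (\<Sigma> w) = w" "\<Sigma> w \<in> fst c \<inter> \<Sigma> ` W" using w G_\<Sigma> by auto
      have Sw: "clip m (\<lambda>i. S i x) = snd c (\<Sigma> w)" using S_eq[of w] w by simp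
      show "clip m (\<lambda>i. S i x) \<in> C" unfolding Sw using Gw w by (intro CI) auto
      show "clip m (\<lambda>i. T i (clip m (\<lambda>i. S i x))) = x"
        unfolding Sw using T_eq[OF Gw(2)] Gw w by simp
    qed
    show "clip m (\<lambda>i. T i y) \<in> B" "clip m (\<lambda>i. S i (clip m (\<lambda>i. T i y))) = y" if y: "y \<in> C" for y
    proof -
      obtain q where q: "q \<in> fst c \<inter> \<Sigma> ` W" "G q \<in> fst pc \<inter> W" "y = snd c q" using CE[OF y] by blast
      have Tq: "clip m (\<lambda>i. T i y) = snd pc (G q)" using T_eq[OF q(1)] q by simp
      have \<Sigma>q: "\<Sigma> (G q) = q" "\<Sigma> (G q) \<in> fst c" using \<Sigma>_G q by auto
      show "clip m (\<lambda>i. T i y) \<in> B" unfolding Tq using q \<Sigma>q by (intro BI) auto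
      show "clip m (\<lambda>i. S i (clip m (\<lambda>i. T i y))) = y"
        unfolding Tq using S_eq[of "G q"] q \<Sigma>q by simp
    qed
    show "Xc (clip m (\<lambda>i. S i x)) i = (\<Sum>k<s. partial k (S i) x * Y k x)"
      if x: "x \<in> B" and i: "i < m" for x i
    proof -
      obtain q l where w: "(q, l) \<in> fst pc \<inter> W" "\<Sigma> (q, l) \<in> fst c" "x = snd pc (q, l)"
        using BE[OF x] by (metis surj_pair)
      have ql: "q \<in> fst d" "l \<in> fst e" using w(1) fst_pc by auto
      have "Xc (clip m (\<lambda>i. S i x)) i = X c (\<Sigma> (q, l)) i"
        using S_eq[of "(q, l)"] w param_snd[OF inj_c w(2)] by (simp add: Xc_def)
      also have "\<dots> = tangent_map N d c (\<lambda>q. \<Sigma> (q, l)) q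
          (tangent_map M c d P (\<Sigma> (q, l)) (X c (\<Sigma> (q, l)))) i"
      proof -
        have "l \<in> topspace (mtop L)" using chart_subset[OF L e(1)] ql(2) by blast
        then have "\<forall>i<mdim M. tangent_map N d c (\<lambda>q. \<Sigma> (q, l)) q
            (tangent_map M c d P (\<Sigma> (q, l)) (X c (\<Sigma> (q, l)))) i = X c (\<Sigma> (q, l)) i"
          using HJE[of l] ql(1) c d(1) w(2) unfolding solves_HJE_def by blast
        then show ?thesis using i by (simp add: m_def)
      qed
      also have "\<dots> = (\<Sum>k<s. partial k (S i) x * Y k x)"
        unfolding tangent_map_def[of N] s_def[symmetric]
        using partial_S[OF ql] w param_snd[OF inj_pc] by (intro sum.cong) (auto simp: Y_def)
      finally show ?thesis .
    qed
    show "(\<Sum>i<m. \<Sum>j<m. (partial i (\<eta>c j) (clip m (\<lambda>i. S i x)) - partial j (\<eta>c i) (clip m (\<lambda>i. S i x)))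
         * partial k (S i) x * partial k' (S j) x) = 0" if x: "x \<in> B" and k: "k < s" "k' < s" for x k k'
    proof -
      obtain q l where w: "(q, l) \<in> fst pc \<inter> W" "\<Sigma> (q, l) \<in> fst c" "x = snd pc (q, l)"
        using BE[OF x] by (metis surj_pair)
      have ql: "q \<in> fst d" "l \<in> fst e" using w(1) fst_pc by auto
      have unit: "tangent_map N d c (\<lambda>q. \<Sigma> (q, l)) q (\<lambda>i. if i = k then 1 else 0) i = partial k (S i) x"
        if "k < s" for k i
      proof -
        have "tangent_map N d c (\<lambda>q. \<Sigma> (q, l)) q (\<lambda>i. if i = k then 1 else 0) i =
          (\<Sum>j<s. if j = k then partial k (map_rep d c (\<lambda>q. \<Sigma> (q, l)) i) (snd d q) else 0)"
          unfolding tangent_map_def s_def[symmetric] by (intro sum.cong) auto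
        then show ?thesis using that partial_S[OF ql that] w(3) by simp
      qed
      have "(\<Sum>i<m. \<Sum>j<m. ext_deriv \<eta> c (\<Sigma> (q, l)) i j *
          tangent_map N d c (\<lambda>q. \<Sigma> (q, l)) q (\<lambda>i. if i = k then 1 else 0) i *
          tangent_map N d c (\<lambda>q. \<Sigma> (q, l)) q (\<lambda>i. if i = k' then 1 else 0) j) = 0"
        using iso chart_subset[OF L e(1)] ql c d(1) w(2)
        unfolding pseudo_isotropic_def m_def by blast
      then show ?thesis
        using S_eq[of "(q, l)"] w by (simp add: unit[OF k(1)] unit[OF k(2)] ext)
    qed
    fix y assume "y \<in> A"
    then obtain q where q: "q \<in> fst c" "y = snd c q" using AE by blast
    have py: "param c y = q" using param_snd[OF inj_c q(1)] q(2) by simp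
    show "(\<Sum>i<m. Xc y i * (partial i (\<eta>c j) y - partial j (\<eta>c i) y)) = - partial j Hc y" if "j < m" for j
    proof -
      have "contraction m (X c q) (ext_deriv \<eta> c q) j =
          - differential H c q j + pairing m (differential H c q) (\<xi> c q) * \<eta> c q j"
        using X c q(1) that unfolding contact_field_def m_def by blast
      moreover have "pairing m (differential H c q) (\<xi> c q) = 0" using \<xi>H c q(1) by (simp add: m_def)
      ultimately have "contraction m (X c q) (ext_deriv \<eta> c q) j = - differential H c q j" by simp
      then show ?thesis
        unfolding contraction_def differential_def Xc_def py unfolding q(2) ext Hc_def[abs_def] .
    qed
    show "(\<Sum>i<m. \<eta>c i y * Xc y i) = Hc y"
      using X c q(1) unfolding contact_field_def pairing_def Xc_def \<eta>c_def Hc_def py m_def by blast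
    show "v k = 0" if v: "\<And>j. j < m \<Longrightarrow> (\<Sum>i<m. v i * (partial i (\<eta>c j) y - partial j (\<eta>c i) y)) = 0"
      "(\<Sum>i<m. v i * \<eta>c i y) = 0" "k < m" for v k
    proof (rule contact_nondegenerate[OF contact c q(1)])
      show "(\<Sum>i<mdim M. v i * ext_deriv \<eta> c q i j) = 0" if "j < mdim M" for j
        using v(1)[of j] that unfolding q(2) ext m_def by simp
      show "(\<Sum>i<mdim M. v i * \<eta> c q i) = 0" using v(2) unfolding \<eta>c_def py m_def .
      show "k < mdim M" using v(3) by (simp add: m_def)
    qed
  qed (fact S_smooth S_known T_smooth \<eta>_known H_known)+
  define x0 where "x0 = snd pc (q0, l0)"
  have w0': "(q0, l0) \<in> fst pc \<inter> W" using d e W(2) fst_pc by auto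
  have x0: "x0 \<in> B" unfolding x0_def using p p_eq by (intro BI[OF w0']) simp
  have Sx0: "clip m (\<lambda>i. S i x0) = snd c p"
    unfolding x0_def using S_eq[of "(q0, l0)"] w0' p p_eq by simp
  obtain \<epsilon> V F where \<epsilon>: "\<epsilon> > 0" and V: "openin (Euclidean_space m) V" "clip m (\<lambda>i. S i x0) \<in> V" "V \<subseteq> C"
    and F_known: "\<And>i. i < m \<Longrightarrow> known ?D (m + 1)
      {z \<in> topspace (Euclidean_space (m + 1)). clip m z \<in> V \<and> \<bar>z m\<bar> < \<epsilon>} (F i)"
    and F_in: "\<And>y t. y \<in> V \<Longrightarrow> \<bar>t\<bar> < \<epsilon> \<Longrightarrow> clip m (\<lambda>i. F i (y(m := t))) \<in> C"
    and F_0: "\<And>y. y \<in> V \<Longrightarrow> clip m (\<lambda>i. F i (y(m := 0))) = y"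
    and F_deriv: "\<And>y t i. y \<in> V \<Longrightarrow> \<bar>t\<bar> < \<epsilon> \<Longrightarrow> i < m \<Longrightarrow> ((\<lambda>t. F i (y(m := t))) has_real_derivative
      Xc (clip m (\<lambda>i. F i (y(m := t)))) i) (at t)"
    by (rule flow_known[OF x0]) blast
  define VM where "VM = {q \<in> fst c. snd c q \<in> V}"
  have snd_VM: "snd c ` VM = V"
    using V(3) C_A by (auto simp: VM_def A_def)
  have VM_open: "openin (mtop M) VM"
    unfolding VM_def using open_chart_preimage[OF M c] V(1) by (simp add: m_def)
  have X_field: "vector_field M X" using X by (simp add: contact_field_def)
  show "\<exists>\<epsilon>>0. \<exists>V. openin (mtop M) V \<and> p \<in> V \<and> V \<subseteq> fst c \<and>
        (\<exists>F. (\<forall>i<mdim M. known ?D (mdim M + 1)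
                 {z \<in> topspace (Euclidean_space (mdim M + 1)).
                    clip (mdim M) z \<in> snd c ` V \<and> \<bar>z (mdim M)\<bar> < \<epsilon>} (F i)) \<and>
             (\<forall>q\<in>V. \<exists>\<gamma>. integral_curve M X {-\<epsilon><..<\<epsilon>} \<gamma> \<and> \<gamma> 0 = q \<and>
                (\<forall>t\<in>{-\<epsilon><..<\<epsilon>}. \<gamma> t \<in> fst c \<and>
                   (\<forall>i<mdim M. snd c (\<gamma> t) i = F i ((snd c q)(mdim M := t))))))"
    unfolding m_def[symmetric]
  proof (intro exI conjI allI impI ballI)
    show "\<epsilon> > 0" by (rule \<epsilon>)
    show "openin (mtop M) VM" by (rule VM_open)
    show "p \<in> VM" using p V(2) Sx0 by (simp add: VM_def)
    show "VM \<subseteq> fst c" by (auto simp: VM_def)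
    show "known ?D (m + 1) {z \<in> topspace (Euclidean_space (m + 1)). clip m z \<in> snd c ` VM \<and> \<bar>z m\<bar> < \<epsilon>} (F i)"
      if "i < m" for i
      unfolding snd_VM by (rule F_known[OF that])
    fix q assume "q \<in> VM"
    then have q: "q \<in> fst c" "snd c q \<in> V" by (auto simp: VM_def)
    let ?f = "\<lambda>t. clip m (\<lambda>i. F i ((snd c q)(m := t)))"
    let ?\<gamma> = "\<lambda>t. param c (?f t)"
    have f_in: "?f t \<in> snd c ` fst c" if "t \<in> {-\<epsilon><..<\<epsilon>}" for t
      using F_in[OF q(2), of t] C_A that unfolding A_def by auto
    show "integral_curve M X {-\<epsilon><..<\<epsilon>} ?\<gamma>"
      unfolding m_def
    proof (rule integral_curve_from_chart[OF M c X_field])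
      show "open {-\<epsilon><..<\<epsilon>}" by simp
      show "clip (mdim M) (\<lambda>i. F i ((snd c q)(mdim M := t))) \<in> snd c ` fst c" if "t \<in> {-\<epsilon><..<\<epsilon>}" for t
        using f_in[OF that] unfolding m_def .
      show "((\<lambda>t. F i ((snd c q)(mdim M := t))) has_real_derivative
          X c (param c (clip (mdim M) (\<lambda>i. F i ((snd c q)(mdim M := t))))) i) (at t)"
        if "t \<in> {-\<epsilon><..<\<epsilon>}" "i < mdim M" for t i
        using F_deriv[OF q(2), of t i] that unfolding m_def Xc_def by auto
    qed
    show "?\<gamma> 0 = q" using F_0[OF q(2)] param_snd[OF inj_c q(1)] by simp
    fix t assume t: "t \<in> {-\<epsilon><..<\<epsilon>}"
    obtain q' where q': "q' \<in> fst c" "?f t = snd c q'" using f_in[OF t] by blast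
    have \<gamma>: "?\<gamma> t = q'" using q' param_snd[OF inj_c] by simp
    show "?\<gamma> t \<in> fst c" unfolding \<gamma> by (rule q'(1))
    show "snd c (?\<gamma> t) i = F i ((snd c q)(m := t))" if "i < m" for i
      unfolding \<gamma> q'(2)[symmetric] using that by (rule clip_nth)
  qed
qed

lemma differential_const: "differential (\<lambda>_. a) c p j = 0"
  unfolding differential_def by (rule partial_eq) simp

theorem theorem3:
  fixes M :: "'a manifold" and N :: "'b manifold" and L :: "'l manifold"
    and \<eta> \<xi> :: "'a field" and P :: "'a \<Rightarrow> 'b" and \<Sigma> :: "'b \<times> 'l \<Rightarrow> 'a"
  assumes "contact_manifold M \<eta>" and "reeb_field M \<eta> \<xi>"
    and "smooth_manifold N" and "fibration M N P"
  shows "(\<forall>H X. smooth_function M H \<longrightarrow>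
            (\<forall>c\<in>atlas M. \<forall>p\<in>fst c. pairing (mdim M) (differential H c p) (\<xi> c p) = 0) \<longrightarrow>
            contact_field M \<eta> \<xi> H X \<longrightarrow>
            complete_solution M N P X L \<Sigma> \<longrightarrow> pseudo_isotropic M N \<eta> L \<Sigma> \<longrightarrow>
            integrable_by_quadratures M X (HJ_data M \<eta> H N P L \<Sigma>)) \<and>
         contact_field M \<eta> \<xi> (\<lambda>_. 1) \<xi> \<and>
         (complete_solution M N P \<xi> L \<Sigma> \<longrightarrow> pseudo_isotropic M N \<eta> L \<Sigma> \<longrightarrow>
            integrable_by_quadratures M \<xi> (HJ_data M \<eta> (\<lambda>_. 1) N P L \<Sigma>))"
proof (intro conjI allI impI)
  show "integrable_by_quadratures M X (HJ_data M \<eta> H N P L \<Sigma>)"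
    if "smooth_function M H"
      "\<forall>c\<in>atlas M. \<forall>p\<in>fst c. pairing (mdim M) (differential H c p) (\<xi> c p) = 0"
      "contact_field M \<eta> \<xi> H X" "complete_solution M N P X L \<Sigma>" "pseudo_isotropic M N \<eta> L \<Sigma>"
    for H X
    by (rule complete_solution_integrable[OF assms(1,3) that])
  have reeb: "contact_field M \<eta> \<xi> (\<lambda>_. 1) \<xi>"
    using assms(2) unfolding reeb_field_def contact_field_def
    by (simp add: differential_const pairing_def)
  then show "contact_field M \<eta> \<xi> (\<lambda>_. 1) \<xi>" .
  assume "complete_solution M N P \<xi> L \<Sigma>" and "pseudo_isotropic M N \<eta> L \<Sigma>"
  note solution = this
  show "integrable_by_quadratures M \<xi> (HJ_data M \<eta> (\<lambda>_. 1) N P L \<Sigma>)"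
  proof (rule complete_solution_integrable[OF assms(1,3) _ _ reeb solution])
    have "smooth_manifold M" using assms(1) by (simp add: contact_manifold_def)
    then show "smooth_function M (\<lambda>_. 1)"
      unfolding smooth_function_def by (intro ballI smooth_on_const chart_image_open)
  qed (simp add: differential_const pairing_def)
qed

end
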